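(* For every integer $\Delta\ge 1$, there are constants $\varepsilon,\nu,\alpha>0$ such that the following holds for all sufficiently large $n$ and $m$. Let $H$ be an $n$-vertex graph with $m$ edges and maximum degree $\Delta$, let $G$ be an $n$-vertex graph with minimum degree at least $(1-\varepsilon)n$, and let $\mathbf c:E(G)\to\{-1,1\}$ be a $\nu$-balanced $2$-edge-colouring of $G$. If the triplet $(H,G,\mathbf c)$ is inert, let $a=4$; otherwise, let $a=2$. Then, there is an integer $b\in\{0,1,2,3\}$ such that, for every integer $k\in[-\alpha m,\alpha m]$, there is a copy $H'\subseteq G$ of $H$ with $\mathbf c(H')=k$ if and only if $k\equiv b\pmod a$.
   Context: For $\mathbf c:E(G)\to\{-1,1\}$ and a subgraph $G'\subseteq G$, write $\mathbf c(G')=\sum_{e\in E(G')}\mathbf c(e)$. The $2$-edge-colouring $\mathbf c$ is $\nu$-balanced if, for each of the two colours, the proportion of edges of $G$ having that colour lies in $[1/2-\nu,1/2+\nu]$. A colouring $\mathbf c:E(G)\to\{-1,1\}$ is called bipartite if there is a partition $(V_1,V_2)$ of $V(G)$ such that either $\mathbf c^{-1}(1)$ or $\mathbf c^{-1}(-1)$ is equal to the edge set of $G[V_1]\cup G[V_2]$. For $n$-vertex graphs $H$ and $G$, the triplet $(H,G,\mathbf c)$ is inert if all degrees in $H$ have the same parity and the colouring $\mathbf c$ is bipartite. A copy of $H$ in $G$ is a subgraph of $G$ isomorphic to $H$. *)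

theory Defs
  imports Complex_Main "HOL-Number_Theory.Cong"
begin

text \<open>A graph is a pair of a vertex set and a set of edges, an edge being the set of its two
  endpoints.\<close>

type_synonym 'a graph = "'a set \<times> 'a set set"

definition verts :: "'a graph \<Rightarrow> 'a set" where
  "verts G = fst G"

definition edges :: "'a graph \<Rightarrow> 'a set set" where
  "edges G = snd G"

definition finite_simple_graph :: "'a graph \<Rightarrow> bool" where
  "finite_simple_graph G \<longleftrightarrow> finite (verts G) \<and> (\<forall>e\<in>edges G. e \<subseteq> verts G \<and> card e = 2)"

definition degree :: "'a graph \<Rightarrow> 'a \<Rightarrow> nat" where
  "degree G v = card {e \<in> edges G. v \<in> e}"

definition max_degree :: "'a graph \<Rightarrow> nat" where
  "max_degree G = Max (degree G ` verts G)"

definition min_degree :: "'a graph \<Rightarrow> nat" where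
  "min_degree G = Min (degree G ` verts G)"

definition subgraph :: "'a graph \<Rightarrow> 'a graph \<Rightarrow> bool" where
  "subgraph G' G \<longleftrightarrow>
     finite_simple_graph G' \<and> verts G' \<subseteq> verts G \<and> edges G' \<subseteq> edges G"

definition induced_subgraph :: "'a graph \<Rightarrow> 'a set \<Rightarrow> 'a graph" where
  "induced_subgraph G S = (S, {e \<in> edges G. e \<subseteq> S})"

definition graph_union :: "'a graph \<Rightarrow> 'a graph \<Rightarrow> 'a graph" where
  "graph_union G1 G2 = (verts G1 \<union> verts G2, edges G1 \<union> edges G2)"

definition graph_isomorphic :: "'a graph \<Rightarrow> 'b graph \<Rightarrow> bool" where
  "graph_isomorphic H H' \<longleftrightarrow>
     (\<exists>f. bij_betw f (verts H) (verts H') \<and>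
          (\<forall>u\<in>verts H. \<forall>v\<in>verts H. {u, v} \<in> edges H \<longleftrightarrow> {f u, f v} \<in> edges H'))"

definition copy_of :: "'b graph \<Rightarrow> 'a graph \<Rightarrow> 'b graph \<Rightarrow> bool" where
  "copy_of H' H G \<longleftrightarrow> subgraph H' G \<and> graph_isomorphic H H'"

text \<open>Colourings are total functions of which only the values on the edges of the graph
  matter.\<close>

definition two_edge_colouring :: "'a graph \<Rightarrow> ('a set \<Rightarrow> int) \<Rightarrow> bool" where
  "two_edge_colouring G c \<longleftrightarrow> (\<forall>e\<in>edges G. c e \<in> {-1, 1})"

definition colour_class :: "'a graph \<Rightarrow> ('a set \<Rightarrow> int) \<Rightarrow> int \<Rightarrow> 'a set set" where
  "colour_class G c i = {e \<in> edges G. c e = i}"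

definition colour_sum :: "('a set \<Rightarrow> int) \<Rightarrow> 'a graph \<Rightarrow> int" where
  "colour_sum c G' = (\<Sum>e\<in>edges G'. c e)"

definition balanced_colouring :: "real \<Rightarrow> 'a graph \<Rightarrow> ('a set \<Rightarrow> int) \<Rightarrow> bool" where
  "balanced_colouring \<nu> G c \<longleftrightarrow>
     (\<forall>i\<in>{-1, 1}. real (card (colour_class G c i)) / real (card (edges G))
                    \<in> {1/2 - \<nu> .. 1/2 + \<nu>})"

text \<open>The parts \<open>V1\<close> and \<open>V2\<close> may be empty. An empty part means that all edges have the same
  colour, which is impossible for a \<open>\<nu>\<close>-balanced colouring of a graph with at least one edge
  when \<open>\<nu> < 1/2\<close>.\<close>

definition bipartite_colouring :: "'a graph \<Rightarrow> ('a set \<Rightarrow> int) \<Rightarrow> bool" where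
  "bipartite_colouring G c \<longleftrightarrow>
     (\<exists>V1 V2. V1 \<union> V2 = verts G \<and> V1 \<inter> V2 = {} \<and>
        (\<exists>i\<in>{-1, 1}. colour_class G c i =
           edges (graph_union (induced_subgraph G V1) (induced_subgraph G V2))))"

definition inert :: "'a graph \<Rightarrow> 'b graph \<Rightarrow> ('b set \<Rightarrow> int) \<Rightarrow> bool" where
  "inert H G c \<longleftrightarrow>
     (\<forall>u\<in>verts H. \<forall>v\<in>verts H. even (degree H u) \<longleftrightarrow> even (degree H v)) \<and>
     bipartite_colouring G c"

end

theory Submission
  imports Defs "HOL-Combinatorics.Permutations"
begin

text \<open>Transport \<open>H\<close> to a graph \<open>F\<close> on the vertex set \<open>V\<close> of \<open>G\<close>; copies of \<open>H\<close> are then the permutations of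
  \<open>V\<close> mapping \<open>F\<close> into \<open>G\<close> (embeddings). Averaging over all permutations, and then performing
  every profitable swap of two vertices from a large separated set of equal-degree vertices, gives
  a permutation whose colour sum is at least a constant multiple of \<open>m\<close>; non-edges of \<open>G\<close> are
  penalised so heavily that repairing them never loses. The same for \<open>-c\<close> gives an embedding with a very
  negative sum. Moving one vertex at a time from the second embedding towards the first changes
  the sum by \<open>O(1)\<close> per step, so every target is approached up to a constant. The remaining error is
  corrected inside a bounded part that was embedded beforehand and stays fixed: it contains many swaps, each
  changing the sum by 2 or 4, and, if the triplet is not inert, one swap changing the sum by
  2 modulo 4. Such a swap comes either from two vertices of \<open>H\<close> of different degree parity or from a
  4-cycle of \<open>G\<close> with negative colour product; if all 4-cycles are positive then the colouring is
  bipartite. In the inert case the sum modulo 4 is an invariant.\<close>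

section \<open>Permutations as embeddings, swaps and repairs\<close>

text \<open>Averages alone give nothing: a balanced colouring has mean near 0, so the sum must be
  driven away from 0 by swaps whose mean absolute gain is bounded below. That bound rests on
  4-cycles of \<open>G\<close> with nonzero alternating colour sum. They form a constant proportion,
  since otherwise nearly all rows of the colour matrix would be shifts of one another, which forces
  one colour to be rare. The same source of 4-cycles supplies the fixed swaps: the two exchanged
  vertices have equal degree, so that all contributions but that of one neighbour cancel and the
  gain is 2 or 4 whatever the degree. The second obstacle is that \<open>G\<close> is not complete,
  so that a swap may break edges. A broken edge is repaired by one further swap, which needs more
  than \<open>2 * \<Delta> * q\<close> free vertices, \<open>q\<close> being the bound on
  non-neighbours. Hence the walk between the two extreme embeddings stops with a few vertices left
  over; these are chosen of small total degree, so that the sum is then nearly that of the end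
  point.\<close>

definition agree_on :: "'a set \<Rightarrow> ('a \<Rightarrow> 'b) \<Rightarrow> ('a \<Rightarrow> 'b) \<Rightarrow> bool" where
  "agree_on S f g \<longleftrightarrow> (\<forall>x\<in>S. f x = g x)"

lemma agree_on_refl [simp]: "agree_on S f f"
  by (simp add: agree_on_def)

lemma agree_on_subset: "agree_on T f g \<Longrightarrow> S \<subseteq> T \<Longrightarrow> agree_on S f g"
  by (auto simp: agree_on_def)

lemma agree_on_trans: "agree_on S f g \<Longrightarrow> agree_on S g h \<Longrightarrow> agree_on S f h"
  by (auto simp: agree_on_def)

lemma agree_on_sym: "agree_on S f g \<Longrightarrow> agree_on S g f"
  by (auto simp: agree_on_def)

lemma agree_on_image: "agree_on S f g \<Longrightarrow> e \<subseteq> S \<Longrightarrow> f ` e = g ` e"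
  by (auto simp: agree_on_def intro!: image_cong)

lemma card_2_obtain_other:
  assumes "card e = 2" "u \<in> e"
  obtains z where "e = {u, z}" "z \<noteq> u"
  using assms by (auto simp: card_2_iff)

lemma image_comp_transpose: "(u \<in> e \<longleftrightarrow> v \<in> e) \<Longrightarrow> (\<pi> \<circ> transpose u v) ` e = \<pi> ` e"
  by (simp only: image_comp[symmetric] transpose_image_eq)

lemma agree_on_transpose: "u \<notin> S \<Longrightarrow> v \<notin> S \<Longrightarrow> agree_on S (\<pi> \<circ> transpose u v) \<pi>"
  unfolding agree_on_def comp_def by (metis transpose_apply_other)

lemma agree_on_transpose_Un:
  "agree_on (- S) \<sigma> (\<pi> \<circ> transpose u v) \<Longrightarrow> agree_on (- (S \<union> {u, v})) \<sigma> \<pi>"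
  by (auto simp: agree_on_def)

locale guest =
  fixes V :: "'a set" and F :: "'a set set" and \<Delta> :: nat
  assumes finite_V: "finite V"
    and F_edge: "e \<in> F \<Longrightarrow> e \<subseteq> V \<and> card e = 2"
    and card_incident: "v \<in> V \<Longrightarrow> card {e\<in>F. v \<in> e} \<le> \<Delta>"
begin

definition nbrs :: "'a \<Rightarrow> 'a set" where
  "nbrs v = {y. {v, y} \<in> F}"

definition weight :: "('a set \<Rightarrow> int) \<Rightarrow> ('a \<Rightarrow> 'a) \<Rightarrow> int" where
  "weight w \<pi> = (\<Sum>e\<in>F. w (\<pi> ` e))"

definition gain :: "('a set \<Rightarrow> int) \<Rightarrow> ('a \<Rightarrow> 'a) \<Rightarrow> 'a \<Rightarrow> 'a \<Rightarrow> int" where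
  "gain w \<pi> u v = weight w (\<pi> \<circ> transpose u v) - weight w \<pi>"

lemma finite_F: "finite F"
  by (rule finite_subset[of _ "Pow V"]) (use F_edge finite_V in auto)

lemma nbrs_sym: "y \<in> nbrs v \<longleftrightarrow> v \<in> nbrs y"
  by (simp add: nbrs_def insert_commute)

lemma nbrs_irrefl: "v \<notin> nbrs v"
  using F_edge[of "{v}"] by (auto simp: nbrs_def)

lemma nbrs_subset: "nbrs v \<subseteq> V"
  using F_edge by (auto simp: nbrs_def)

lemma nbrs_outside: "v \<notin> V \<Longrightarrow> nbrs v = {}"
  using nbrs_subset nbrs_sym by blast

lemma finite_nbrs [simp]: "finite (nbrs v)"
  using finite_subset[OF nbrs_subset finite_V] .

lemma incident_eq: "{e\<in>F. v \<in> e} = (\<lambda>y. {v, y}) ` nbrs v"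
proof
  show "{e\<in>F. v \<in> e} \<subseteq> (\<lambda>y. {v, y}) ` nbrs v"
  proof
    fix e assume "e \<in> {e\<in>F. v \<in> e}"
    moreover then obtain z where "e = {v, z}"
      using F_edge card_2_obtain_other[of e v] by blast
    ultimately show "e \<in> (\<lambda>y. {v, y}) ` nbrs v" by (auto simp: nbrs_def)
  qed
qed (auto simp: nbrs_def)

lemma inj_on_edge_at: "inj_on (\<lambda>y. {v, y}) S"
  by (auto simp: inj_on_def doubleton_eq_iff)

lemma card_incident_eq: "card {e\<in>F. v \<in> e} = card (nbrs v)"
  unfolding incident_eq by (rule card_image[OF inj_on_edge_at])

lemma card_nbrs: "card (nbrs v) \<le> \<Delta>"
  using card_incident[of v] nbrs_outside[of v] by (cases "v \<in> V") (auto simp: card_incident_eq)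

lemma sum_card_nbrs: "(\<Sum>v\<in>V. card (nbrs v)) = 2 * card F"
proof -
  have "(\<Sum>v\<in>V. card (nbrs v)) = (\<Sum>v\<in>V. \<Sum>e\<in>F. if v \<in> e then 1 else 0)"
    using finite_F by (simp add: card_incident_eq[symmetric] sum.If_cases Int_def)
  also have "\<dots> = (\<Sum>e\<in>F. \<Sum>v\<in>V. if v \<in> e then 1 else 0)" by (rule sum.swap)
  also have "\<dots> = (\<Sum>e\<in>F. card e)"
  proof (rule sum.cong)
    fix e assume "e \<in> F"
    then have "V \<inter> {v. v \<in> e} = e" using F_edge by auto
    then show "(\<Sum>v\<in>V. if v \<in> e then 1 else 0) = card e"
      using finite_V by (simp add: sum.If_cases)
  qed simp
  also have "\<dots> = (\<Sum>e\<in>F. 2)" by (rule sum.cong) (use F_edge in auto)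
  finally show ?thesis by simp
qed

lemma card_edges_meeting:
  assumes "finite S"
  shows "card {e\<in>F. e \<inter> S \<noteq> {}} \<le> (\<Sum>v\<in>S. card (nbrs v))"
proof -
  have "{e\<in>F. e \<inter> S \<noteq> {}} = (\<Union>v\<in>S. {e\<in>F. v \<in> e})" by auto
  then show ?thesis using card_UN_le[OF assms, of "\<lambda>v. {e\<in>F. v \<in> e}"]
    by (simp add: card_incident_eq)
qed

lemma sum_card_nbrs_le: "(\<Sum>v\<in>S. card (nbrs v)) \<le> card S * \<Delta>"
  using sum_bounded_above[of S "\<lambda>v. card (nbrs v)" \<Delta>] card_nbrs by simp

text \<open>Only edges meeting \<open>S\<close> can change. The bound \<open>L\<close> is demanded
  of every set, because intermediate permutations map some edges of \<open>F\<close> to non-edges of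
  the host.\<close>

lemma weight_diff_bound:
  assumes "\<And>e. \<bar>w e\<bar> \<le> L" "finite S" "agree_on (V - S) \<pi> \<rho>"
  shows "\<bar>weight w \<pi> - weight w \<rho>\<bar> \<le> 2 * L * int (\<Sum>v\<in>S. card (nbrs v))"
proof -
  let ?M = "{e\<in>F. e \<inter> S \<noteq> {}}"
  have "weight w \<pi> - weight w \<rho> = (\<Sum>e\<in>F. w (\<pi> ` e) - w (\<rho> ` e))"
    by (simp add: weight_def sum_subtractf)
  also have "\<dots> = (\<Sum>e\<in>?M. w (\<pi> ` e) - w (\<rho> ` e))"
  proof (rule sum.mono_neutral_right[OF finite_F])
    show "\<forall>e\<in>F - ?M. w (\<pi> ` e) - w (\<rho> ` e) = 0"
    proof
      fix e assume "e \<in> F - ?M"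
      then have "e \<subseteq> V - S" using F_edge by blast
      then show "w (\<pi> ` e) - w (\<rho> ` e) = 0" using agree_on_image[OF assms(3)] by simp
    qed
  qed auto
  finally have "\<bar>weight w \<pi> - weight w \<rho>\<bar> = \<bar>\<Sum>e\<in>?M. w (\<pi> ` e) - w (\<rho> ` e)\<bar>" by simp
  also have "\<dots> \<le> (\<Sum>e\<in>?M. 2 * L)"
  proof (rule order_trans[OF sum_abs sum_mono])
    fix e show "\<bar>w (\<pi> ` e) - w (\<rho> ` e)\<bar> \<le> 2 * L"
      using assms(1)[of "\<pi> ` e"] assms(1)[of "\<rho> ` e"] by linarith
  qed
  also have "\<dots> = 2 * L * int (card ?M)" by simp
  also have "\<dots> \<le> 2 * L * int (\<Sum>v\<in>S. card (nbrs v))"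
    using card_edges_meeting[OF assms(2)] assms(1)[of "{}"]
    by (intro mult_left_mono) linarith+
  finally show ?thesis .
qed

lemma weight_diff_bound_card:
  assumes "\<And>e. \<bar>w e\<bar> \<le> L" "finite S" "agree_on (V - S) \<pi> \<rho>" "card S \<le> k"
  shows "\<bar>weight w \<pi> - weight w \<rho>\<bar> \<le> 2 * L * int (k * \<Delta>)"
proof -
  have "(\<Sum>v\<in>S. card (nbrs v)) \<le> k * \<Delta>"
    using sum_card_nbrs_le[of S] assms(4) by (meson mult_le_mono1 order_trans)
  then have "2 * L * int (\<Sum>v\<in>S. card (nbrs v)) \<le> 2 * L * int (k * \<Delta>)"
    using assms(1)[of "{}"] by (intro mult_left_mono) linarith+
  then show ?thesis using weight_diff_bound[where w = w and L = L, OF assms(1-3)] by linarith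
qed

text \<open>Edges containing both or neither of \<open>u\<close> and \<open>v\<close> keep their
  image. A common neighbour occurs in both sums and its terms cancel; removing \<open>v\<close> and
  \<open>u\<close> accounts for a possible edge between them.\<close>

lemma gain_eq:
  assumes "u \<noteq> v"
  shows "gain w \<pi> u v =
    (\<Sum>y\<in>nbrs u - {v}. w {\<pi> v, \<pi> y} - w {\<pi> u, \<pi> y}) +
    (\<Sum>y\<in>nbrs v - {u}. w {\<pi> u, \<pi> y} - w {\<pi> v, \<pi> y})"
proof -
  let ?h = "\<lambda>e. w ((\<pi> \<circ> transpose u v) ` e) - w (\<pi> ` e)"
  let ?A = "(\<lambda>y. {u, y}) ` (nbrs u - {v})" and ?B = "(\<lambda>y. {v, y}) ` (nbrs v - {u})"
  have "?A = {e \<in> (\<lambda>y. {u, y}) ` nbrs u. v \<notin> e}" "?B = {e \<in> (\<lambda>y. {v, y}) ` nbrs v. u \<notin> e}"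
    using assms by auto
  then have A: "?A = {e\<in>F. u \<in> e \<and> v \<notin> e}" and B: "?B = {e\<in>F. v \<in> e \<and> u \<notin> e}"
    by (simp_all add: incident_eq[symmetric])
  have "gain w \<pi> u v = (\<Sum>e\<in>F. ?h e)"
    by (simp add: gain_def weight_def sum_subtractf)
  also have "\<dots> = (\<Sum>e\<in>?A \<union> ?B. ?h e)"
  proof (rule sum.mono_neutral_right[OF finite_F])
    show "?A \<union> ?B \<subseteq> F" unfolding A B by auto
    show "\<forall>e\<in>F - (?A \<union> ?B). ?h e = 0"
    proof
      fix e assume "e \<in> F - (?A \<union> ?B)"
      then have "u \<in> e \<longleftrightarrow> v \<in> e" unfolding A B by auto
      then show "?h e = 0" by (simp only: image_comp_transpose)
    qed
  qed
  also have "\<dots> = (\<Sum>e\<in>?A. ?h e) + (\<Sum>e\<in>?B. ?h e)"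
    by (rule sum.union_disjoint) (auto simp: A B finite_F)
  also have "(\<Sum>e\<in>?A. ?h e) = (\<Sum>y\<in>nbrs u - {v}. w {\<pi> v, \<pi> y} - w {\<pi> u, \<pi> y})"
    unfolding sum.reindex[OF inj_on_edge_at]
  proof (rule sum.cong)
    fix y assume "y \<in> nbrs u - {v}"
    then have "y \<noteq> u" "y \<noteq> v" using nbrs_irrefl by auto
    then show "(?h \<circ> (\<lambda>y. {u, y})) y = w {\<pi> v, \<pi> y} - w {\<pi> u, \<pi> y}" by simp
  qed simp
  also have "(\<Sum>e\<in>?B. ?h e) = (\<Sum>y\<in>nbrs v - {u}. w {\<pi> u, \<pi> y} - w {\<pi> v, \<pi> y})"
    unfolding sum.reindex[OF inj_on_edge_at]
  proof (rule sum.cong)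
    fix y assume "y \<in> nbrs v - {u}"
    then have "y \<noteq> v" "y \<noteq> u" using nbrs_irrefl by auto
    then show "(?h \<circ> (\<lambda>y. {v, y})) y = w {\<pi> u, \<pi> y} - w {\<pi> v, \<pi> y}" by simp
  qed simp
  finally show ?thesis .
qed

text \<open>The closed neighbourhood of a pair; the gain of swapping the pair is determined by the
  permutation on this set.\<close>

definition clo :: "'a \<Rightarrow> 'a \<Rightarrow> 'a set" where
  "clo u v = insert u (insert v (nbrs u \<union> nbrs v))"

lemma finite_clo [simp]: "finite (clo u v)"
  by (simp add: clo_def)

lemma card_clo: "card (clo u v) \<le> 2 * \<Delta> + 2"
proof -
  have "card (clo u v) \<le> Suc (Suc (card (nbrs u \<union> nbrs v)))"
    unfolding clo_def by (simp add: card_insert_if)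
  also have "card (nbrs u \<union> nbrs v) \<le> 2 * \<Delta>"
    using card_Un_le[of "nbrs u" "nbrs v"] card_nbrs[of u] card_nbrs[of v] by linarith
  finally show ?thesis by simp
qed

lemma gain_cong:
  assumes "u \<noteq> v" "agree_on (clo u v) \<pi> \<rho>"
  shows "gain w \<pi> u v = gain w \<rho> u v"
  unfolding gain_eq[OF assms(1)] using assms(2)
  by (auto simp: agree_on_def clo_def intro!: arg_cong2[where f="(+)"] sum.cong)

lemma gain_neg: "gain w (\<pi> \<circ> transpose u v) u v = - gain w \<pi> u v"
  by (simp add: gain_def comp_assoc)

lemma gain_bound:
  assumes "\<And>e. \<bar>w e\<bar> \<le> L"
  shows "\<bar>gain w \<pi> u v\<bar> \<le> 4 * L * int \<Delta>"
proof -
  have "\<bar>weight w (\<pi> \<circ> transpose u v) - weight w \<pi>\<bar> \<le> 2 * L * int (2 * \<Delta>)"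
    by (rule weight_diff_bound_card[where w = w and L = L and S = "{u, v}", OF assms])
      (auto simp: agree_on_def card_insert_if)
  then show ?thesis by (simp add: gain_def)
qed

end

text \<open>A vertex counts among its own non-neighbours, since \<open>{x, x}\<close> is not an
  edge. Choosing a place adjacent to given places therefore also keeps it distinct from
  them.\<close>

locale host =
  fixes V :: "'a set" and E :: "'a set set" and q :: nat
  assumes finite_host: "finite V"
    and E_edge: "e \<in> E \<Longrightarrow> e \<subseteq> V \<and> card e = 2"
    and card_nonadjacent: "x \<in> V \<Longrightarrow> card {y\<in>V. {x, y} \<notin> E} \<le> q"
begin

lemma E_irrefl: "{x, x} \<notin> E"
  using E_edge[of "{x}"] by auto

end

section \<open>Repairing permutations and moving embeddings in a dense host graph\<close>

locale packing = guest V F \<Delta> + host V E q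
  for V :: "'a set" and F \<Delta> E q
begin

definition bad :: "('a \<Rightarrow> 'a) \<Rightarrow> 'a set set" where
  "bad \<pi> = {e\<in>F. \<pi> ` e \<notin> E}"

definition embedding :: "('a \<Rightarrow> 'a) \<Rightarrow> bool" where
  "embedding \<pi> \<longleftrightarrow> \<pi> permutes V \<and> bad \<pi> = {}"

lemma finite_bad [simp]: "finite (bad \<pi>)"
  by (simp add: bad_def finite_F)

text \<open>The new place of \<open>u\<close> must be adjacent to the images of all neighbours of
  \<open>u\<close>, and the old place to the images of all neighbours of \<open>w\<close>. Each
  condition rules out at most \<open>\<Delta> * q\<close> choices of \<open>w\<close>; afterwards
  all edges at \<open>u\<close> and \<open>w\<close> are good.\<close>

lemma repair_swap:
  assumes \<pi>: "\<pi> permutes V" and P: "P \<subseteq> V" "2 * \<Delta> * q < card (V - P)"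
    and bad: "{u, z} \<in> bad \<pi>" "u \<notin> P"
  shows "\<exists>w\<in>V - P. bad (\<pi> \<circ> transpose u w) \<subseteq> bad \<pi> - {{u, z}}"
proof -
  have uz: "{u, z} \<in> F" "{\<pi> u, \<pi> z} \<notin> E" using bad by (auto simp: bad_def)
  then have uV: "u \<in> V" "z \<in> nbrs u" using F_edge by (auto simp: nbrs_def)
  have inV: "\<pi> x \<in> V \<longleftrightarrow> x \<in> V" for x using permutes_in_image[OF \<pi>] .
  let ?Q = "\<lambda>x. {y\<in>V. {\<pi> x, \<pi> y} \<notin> E}"
  have Q: "card (?Q x) \<le> q" if "x \<in> V" for x
  proof -
    have "card (?Q x) = card (\<pi> ` ?Q x)"
      by (rule card_image[symmetric, OF permutes_inj_on[OF \<pi>]])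
    also have "\<dots> \<le> card {y\<in>V. {\<pi> x, y} \<notin> E}"
      by (rule card_mono) (use finite_V inV in auto)
    finally show ?thesis using card_nonadjacent[of "\<pi> x"] inV that by simp
  qed
  define X where "X = (\<Union>y\<in>nbrs u. ?Q y) \<union> (\<Union>y\<in>?Q u. nbrs y)"
  have "card X \<le> card (\<Union>y\<in>nbrs u. ?Q y) + card (\<Union>y\<in>?Q u. nbrs y)"
    unfolding X_def by (rule card_Un_le)
  also have "card (\<Union>y\<in>nbrs u. ?Q y) \<le> (\<Sum>y\<in>nbrs u. card (?Q y))"
    by (rule card_UN_le) simp
  also have "\<dots> \<le> card (nbrs u) * q"
    using sum_bounded_above[of "nbrs u" "\<lambda>y. card (?Q y)" q] Q nbrs_subset by auto
  also have "\<dots> \<le> \<Delta> * q" using card_nbrs by simp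
  also have "card (\<Union>y\<in>?Q u. nbrs y) \<le> (\<Sum>y\<in>?Q u. card (nbrs y))"
    by (rule card_UN_le) (use finite_V in simp)
  also have "\<dots> \<le> card (?Q u) * \<Delta>" by (rule sum_card_nbrs_le)
  also have "\<dots> \<le> \<Delta> * q" using Q[OF uV(1)] by simp
  finally have "card X < card (V - P)" using P by simp
  moreover have "finite X" unfolding X_def using finite_V by auto
  ultimately obtain w where w: "w \<in> V - P" "w \<notin> X"
    by (metis card_mono leD subsetI)
  have w1: "{\<pi> w, \<pi> y} \<in> E" if "y \<in> nbrs u" for y
    using w that nbrs_subset by (auto simp: X_def insert_commute)
  have w2: "{\<pi> u, \<pi> y} \<in> E" if "y \<in> nbrs w" for y
    using w that nbrs_subset nbrs_sym[of w y] by (auto simp: X_def)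
  \<comment> \<open>\<open>u\<close> is excluded through its bad edge, and a neighbour of
    \<open>u\<close> through the missing loop at its own image.\<close>
  have wu: "w \<noteq> u" using w1[OF uV(2)] uz by auto
  have wnu: "w \<notin> nbrs u" using w1[of w] E_irrefl by auto
  let ?\<rho> = "\<pi> \<circ> transpose u w"
  have "e \<in> bad \<pi> \<and> e \<noteq> {u, z}" if e: "e \<in> bad ?\<rho>" for e
  proof -
    have eF: "e \<in> F" "?\<rho> ` e \<notin> E" using e by (auto simp: bad_def)
    have "u \<notin> e"
    proof
      assume "u \<in> e"
      then obtain y where y: "e = {u, y}" "y \<noteq> u" "y \<in> nbrs u"
        using F_edge[OF eF(1)] card_2_obtain_other[of e u] eF(1) by (auto simp: nbrs_def)
      then have "?\<rho> ` e = {\<pi> w, \<pi> y}" using wnu by (cases "y = w") auto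
      then show False using w1[OF y(3)] eF by simp
    qed
    moreover have "w \<notin> e"
    proof
      assume "w \<in> e"
      then obtain y where y: "e = {w, y}" "y \<noteq> w" "y \<in> nbrs w"
        using F_edge[OF eF(1)] card_2_obtain_other[of e w] eF(1) by (auto simp: nbrs_def)
      then have "?\<rho> ` e = {\<pi> u, \<pi> y}" using wnu nbrs_sym[of w u] by (cases "y = u") auto
      then show False using w2[OF y(3)] eF by simp
    qed
    ultimately have "?\<rho> ` e = \<pi> ` e" by (intro image_comp_transpose) simp
    then show ?thesis using eF \<open>u \<notin> e\<close> by (auto simp: bad_def)
  qed
  then show ?thesis using w(1) by blast
qed

text \<open>Each swap removes a bad edge and creates none, at the price of two moved vertices
  outside \<open>P\<close>. The condition on bad edges guarantees each of them an end that may be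
  moved.\<close>

lemma repair:
  assumes "\<pi> permutes V" and "P \<subseteq> V" "2 * \<Delta> * q < card (V - P)"
    and "\<And>e. e \<in> bad \<pi> \<Longrightarrow> \<not> e \<subseteq> P"
  shows "\<exists>\<rho> S. embedding \<rho> \<and> finite S \<and> card S \<le> 2 * card (bad \<pi>) \<and> S \<inter> P = {} \<and>
    agree_on (- S) \<rho> \<pi>"
  using assms(1,4)
proof (induction "card (bad \<pi>)" arbitrary: \<pi> rule: less_induct)
  case less
  show ?case
  proof (cases "bad \<pi> = {}")
    case True
    then show ?thesis using less.prems by (intro exI[of _ \<pi>] exI[of _ "{}"]) (auto simp: embedding_def)
  next
    case False
    then obtain e where e: "e \<in> bad \<pi>" by auto
    then obtain u where u: "u \<in> e" "u \<notin> P" using less.prems by blast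
    have eF: "e \<subseteq> V" "card e = 2" using F_edge e by (auto simp: bad_def)
    then obtain z where z: "e = {u, z}" using card_2_obtain_other u by metis
    obtain w where w: "w \<in> V - P" "bad (\<pi> \<circ> transpose u w) \<subseteq> bad \<pi> - {e}"
      using repair_swap[OF less.prems(1) assms(2,3)] e u z by blast
    let ?\<rho> = "\<pi> \<circ> transpose u w"
    have "card (bad ?\<rho>) \<le> card (bad \<pi> - {e})" by (rule card_mono[OF _ w(2)]) simp
    also have "\<dots> = card (bad \<pi>) - 1" using e by simp
    finally have lt: "card (bad ?\<rho>) + 1 \<le> card (bad \<pi>)"
      using e card_gt_0_iff[of "bad \<pi>"] by auto
    have "?\<rho> permutes V" using permutes_compose[OF permutes_swap_id less.prems(1)] u eF w by blast
    moreover have "\<And>e. e \<in> bad ?\<rho> \<Longrightarrow> \<not> e \<subseteq> P" using less.prems(2) w by blast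
    ultimately obtain \<sigma> S where S: "embedding \<sigma>" "finite S" "card S \<le> 2 * card (bad ?\<rho>)"
      "S \<inter> P = {}" "agree_on (- S) \<sigma> ?\<rho>"
      using less.hyps[of ?\<rho>] lt by auto
    have "agree_on (- (S \<union> {u, w})) \<sigma> \<pi>"
      by (rule agree_on_transpose_Un[OF S(5)])
    moreover have "card (S \<union> {u, w}) \<le> 2 * card (bad \<pi>)"
      using card_Un_le[of S "{u, w}"] S(3) lt card_insert_le_m1[of 2 "{w}" u] by simp
    moreover have "(S \<union> {u, w}) \<inter> P = {}" using S(4) u w by auto
    ultimately show ?thesis using S(1,2)
      by (intro exI[of _ \<sigma>] exI[of _ "S \<union> {u, w}"]) simp
  qed
qed

text \<open>Swapping \<open>v\<close> with the vertex now occupying the place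
  \<open>\<psi> v\<close> puts \<open>v\<close> right, and only the at most
  \<open>2 * \<Delta>\<close> edges at these two vertices can break. No broken edge lies inside
  \<open>insert v A\<close>, where the result copies the embedding \<open>\<psi>\<close>, so
  \<open>repair\<close> applies with that set protected.\<close>

lemma move:
  assumes \<phi>: "embedding \<phi>" and \<psi>: "embedding \<psi>" and A: "A \<subseteq> V" "agree_on A \<phi> \<psi>"
    and v: "v \<in> V - A" and big: "2 * \<Delta> * q + 1 < card (V - A)"
  shows "\<exists>\<rho> S. embedding \<rho> \<and> agree_on (insert v A) \<rho> \<psi> \<and> finite S \<and> card S \<le> 4 * \<Delta> + 2 \<and>
    agree_on (- S) \<rho> \<phi>"
proof -
  have p: "\<phi> permutes V" "\<psi> permutes V" using \<phi> \<psi> by (auto simp: embedding_def)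
  obtain w where w: "\<phi> w = \<psi> v" using permutes_surj[OF p(1)] by (metis surjD)
  have wV: "w \<in> V" using w v permutes_in_image[OF p(1)] permutes_in_image[OF p(2)] by (metis DiffD1)
  have wA: "w \<notin> A"
  proof
    assume "w \<in> A"
    then have "\<psi> w = \<psi> v" using A w by (simp add: agree_on_def)
    then have "w = v" using permutes_inj[OF p(2)] by (simp add: inj_eq)
    then show False using v \<open>w \<in> A\<close> by simp
  qed
  let ?\<rho> = "\<phi> \<circ> transpose v w"
  have \<rho>: "?\<rho> permutes V" using permutes_compose[OF permutes_swap_id p(1)] v wV by blast
  have ag: "agree_on (insert v A) ?\<rho> \<psi>"
  proof -
    have "agree_on A ?\<rho> \<phi>" by (rule agree_on_transpose) (use v wA in auto)
    then have "agree_on A ?\<rho> \<psi>" using agree_on_trans[OF _ A(2)] by blast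
    then show ?thesis using w by (simp add: agree_on_def)
  qed
  have bad_meets: "bad ?\<rho> \<subseteq> {e\<in>F. e \<inter> {v, w} \<noteq> {}}"
  proof
    fix e assume e: "e \<in> bad ?\<rho>"
    have "e \<in> F" using e by (simp add: bad_def)
    moreover have "e \<inter> {v, w} \<noteq> {}"
    proof
      assume "e \<inter> {v, w} = {}"
      then have "?\<rho> ` e = \<phi> ` e" by (intro image_comp_transpose) auto
      then show False using e \<phi> by (auto simp: embedding_def bad_def)
    qed
    ultimately show "e \<in> {e\<in>F. e \<inter> {v, w} \<noteq> {}}" by simp
  qed
  have "card (bad ?\<rho>) \<le> card {e\<in>F. e \<inter> {v, w} \<noteq> {}}"
    by (rule card_mono[OF _ bad_meets]) (simp add: finite_F)
  also have "\<dots> \<le> (\<Sum>x\<in>{v, w}. card (nbrs x))" by (rule card_edges_meeting) simp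
  also have "\<dots> \<le> card {v, w} * \<Delta>" by (rule sum_card_nbrs_le)
  also have "\<dots> \<le> 2 * \<Delta>" by (intro mult_le_mono1) (simp add: card_insert_if)
  finally have cb: "card (bad ?\<rho>) \<le> 2 * \<Delta>" .
  have "\<exists>\<sigma> S. embedding \<sigma> \<and> finite S \<and> card S \<le> 2 * card (bad ?\<rho>) \<and> S \<inter> insert v A = {} \<and>
    agree_on (- S) \<sigma> ?\<rho>"
  proof (rule repair[OF \<rho>])
    show "insert v A \<subseteq> V" using v A by auto
    have "card (V - A) = Suc (card (V - insert v A))"
      using v finite_V by (metis Diff_insert card_Suc_Diff1 finite_Diff)
    then show "2 * \<Delta> * q < card (V - insert v A)" using big by linarith
    fix e assume e: "e \<in> bad ?\<rho>"
    show "\<not> e \<subseteq> insert v A"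
    proof
      assume "e \<subseteq> insert v A"
      then have "?\<rho> ` e = \<psi> ` e" by (rule agree_on_image[OF ag])
      then show False using e \<psi> by (auto simp: embedding_def bad_def)
    qed
  qed
  then obtain \<sigma> S where S: "embedding \<sigma>" "finite S" "card S \<le> 2 * card (bad ?\<rho>)"
    "S \<inter> insert v A = {}" "agree_on (- S) \<sigma> ?\<rho>" by blast
  have "agree_on (insert v A) \<sigma> \<psi>"
    using agree_on_trans[OF agree_on_subset[OF S(5), of "insert v A"] ag] S(4) by blast
  moreover have "agree_on (- (S \<union> {v, w})) \<sigma> \<phi>"
    by (rule agree_on_transpose_Un[OF S(5)])
  moreover have "card (S \<union> {v, w}) \<le> 4 * \<Delta> + 2"
    using card_Un_le[of S "{v, w}"] S(3) cb card_insert_le_m1[of 2 "{w}" v] by simp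
  ultimately show ?thesis using S(1,2)
    by (intro exI[of _ \<sigma>] exI[of _ "S \<union> {v, w}"]) simp
qed

text \<open>A discrete intermediate value argument: the weight starts at most \<open>k\<close>,
  exceeds \<open>k\<close> once \<open>A'\<close> is reached, and one \<open>move\<close> changes it
  by at most the stated error. \<open>A'\<close> stays short of \<open>V\<close> because the repairs
  need free vertices.\<close>

lemma chain:
  assumes \<psi>: "embedding \<psi>" and A': "A' \<subseteq> V" "2 * \<Delta> * q < card (V - A')"
    and w: "\<And>e. \<bar>w e\<bar> \<le> 1"
    and "embedding \<phi>" "A \<subseteq> A'" "agree_on A \<phi> \<psi>" "weight w \<phi> \<le> k"
    and fin: "\<And>\<chi>. embedding \<chi> \<Longrightarrow> agree_on A' \<chi> \<psi> \<Longrightarrow> weight w \<chi> > k"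
  shows "\<exists>\<chi>. embedding \<chi> \<and> agree_on A \<chi> \<psi> \<and> weight w \<chi> \<le> k \<and>
    k - 2 * int ((4 * \<Delta> + 2) * \<Delta>) \<le> weight w \<chi>"
  using assms(5-8)
proof (induction "card (A' - A)" arbitrary: A \<phi>)
  case 0
  have "finite (A' - A)" using finite_subset[OF A'(1) finite_V] by simp
  then have "A' - A = {}" using 0(1) by (metis card_0_eq)
  then have "A = A'" using 0(3) by blast
  then have "weight w \<phi> > k" using fin[OF 0(2)] 0(4) by blast
  then show ?case using 0(5) by linarith
next
  case (Suc d)
  then obtain v where v: "v \<in> A' - A" by (metis card.empty equals0I nat.distinct(1))
  have "card (V - A') < card (V - A)"
    by (rule psubset_card_mono) (use v A' finite_V Suc.prems in auto)
  then have "2 * \<Delta> * q + 1 < card (V - A)" using A' by linarith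
  moreover have "A \<subseteq> V" "v \<in> V - A" using Suc.prems v A' by auto
  ultimately obtain \<rho> S where \<rho>: "embedding \<rho>" "agree_on (insert v A) \<rho> \<psi>" "finite S"
    "card S \<le> 4 * \<Delta> + 2" "agree_on (- S) \<rho> \<phi>"
    using move[OF Suc.prems(1) \<psi> _ Suc.prems(3), of v] by blast
  have d: "\<bar>weight w \<phi> - weight w \<rho>\<bar> \<le> 2 * 1 * int ((4 * \<Delta> + 2) * \<Delta>)"
    by (rule weight_diff_bound_card[where w = w and L = 1, OF w \<rho>(3) _ \<rho>(4)])
      (use agree_on_sym[OF \<rho>(5)] in \<open>auto simp: agree_on_def\<close>)
  show ?case
  proof (cases "weight w \<rho> \<le> k")
    case True
    have "card (A' - insert v A) = d"
      using Suc.hyps(2) v finite_subset[OF A'(1) finite_V]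
      by (metis Diff_insert card_Diff_singleton diff_Suc_1 )
    then obtain \<chi> where \<chi>: "embedding \<chi>" "agree_on (insert v A) \<chi> \<psi>" "weight w \<chi> \<le> k"
      "k - 2 * int ((4 * \<Delta> + 2) * \<Delta>) \<le> weight w \<chi>"
      using Suc.hyps(1)[OF _ \<rho>(1) _ \<rho>(2) True] v Suc.prems(2) by blast
    have "agree_on A \<chi> \<psi>" by (rule agree_on_subset[OF \<chi>(2) subset_insertI])
    then show ?thesis using \<chi> by (intro exI[of _ \<chi>]) simp
  next
    case False
    then show ?thesis using Suc.prems(1,3,4) d by (intro exI[of _ \<phi>]) auto
  qed
qed

end

section \<open>Averaging over permutations\<close>

lemma extend_to_permutation:
  assumes "finite V" "A \<subseteq> V" "inj_on s A" "s ` A \<subseteq> V"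
  shows "\<exists>\<pi>. \<pi> permutes V \<and> agree_on A \<pi> s"
proof -
  have fin: "finite A" "finite (s ` A)" using assms finite_subset by blast+
  have "card (V - A) = card (V - s ` A)"
    using assms fin by (simp add: card_Diff_subset card_image)
  then obtain g where g: "bij_betw g (V - A) (V - s ` A)"
    using finite_same_card_bij[of "V - A" "V - s ` A"] assms(1) by auto
  define \<pi> where "\<pi> x = (if x \<in> A then s x else if x \<in> V then g x else x)" for x
  have "bij_betw \<pi> A (s ` A)"
    using inj_on_imp_bij_betw[OF assms(3)] by (rule bij_betw_cong[THEN iffD1, rotated]) (simp add: \<pi>_def)
  moreover have "bij_betw \<pi> (V - A) (V - s ` A)"
    using g by (rule bij_betw_cong[THEN iffD1, rotated]) (simp add: \<pi>_def)
  ultimately have "bij_betw \<pi> (A \<union> (V - A)) (s ` A \<union> (V - s ` A))"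
    by (rule bij_betw_combine) auto
  moreover have "A \<union> (V - A) = V" "s ` A \<union> (V - s ` A) = V" using assms by auto
  ultimately have "bij_betw \<pi> V V" by simp
  then have "\<pi> permutes V" by (rule bij_imp_permutes) (use assms(2) in \<open>auto simp: \<pi>_def\<close>)
  then show ?thesis by (auto simp: \<pi>_def agree_on_def)
qed

text \<open>The alternating sum of \<open>w\<close> around the 4-cycle \<open>xs ! 0\<close>,
  \<open>xs ! 2\<close>, \<open>xs ! 1\<close>, \<open>xs ! 3\<close> is nonzero. Entries 0 and 1
  will be the places of two vertices to be swapped, entries 2 and 3 two possible places of one
  neighbour.\<close>

definition alternating :: "('a set \<Rightarrow> int) \<Rightarrow> 'a list \<Rightarrow> bool" where
  "alternating w xs \<longleftrightarrow>
    w {xs ! 1, xs ! 3} - w {xs ! 0, xs ! 3} \<noteq> w {xs ! 1, xs ! 2} - w {xs ! 0, xs ! 2}"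

definition tuples :: "'a set \<Rightarrow> nat \<Rightarrow> 'a list set" where
  "tuples V r = {xs. distinct xs \<and> length xs = r \<and> set xs \<subseteq> V}"

lemma finite_tuples: "finite V \<Longrightarrow> finite (tuples V r)"
  by (rule finite_subset[OF _ finite_lists_length_eq[of V r]]) (auto simp: tuples_def)

lemma card_tuples_le: "finite V \<Longrightarrow> card (tuples V r) \<le> card V ^ r"
  using card_mono[OF finite_lists_length_eq[of V r], of "tuples V r"] card_lists_length_eq[of V r]
  by (auto simp: tuples_def)

lemma permutes_map_tuples:
  assumes "\<pi> permutes V"
  shows "bij_betw (map \<pi>) (tuples V r) (tuples V r)"
proof (rule bij_betw_byWitness[where f' = "map (inv \<pi>)"])
  have i: "inj_on \<pi> S" "inj_on (inv \<pi>) S" for S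
    using permutes_inj_on[OF assms] permutes_inj_on[OF permutes_inv[OF assms]] by auto
  show "map \<pi> ` tuples V r \<subseteq> tuples V r"
    using permutes_in_image[OF assms] i by (auto simp: tuples_def distinct_map subset_iff)
  show "map (inv \<pi>) ` tuples V r \<subseteq> tuples V r"
    using permutes_in_image[OF permutes_inv[OF assms]] i by (auto simp: tuples_def distinct_map subset_iff)
qed (use permutes_inverses[OF assms] in \<open>auto simp: o_def\<close>)

lemma tuples_transitive:
  assumes "finite V" "xs \<in> tuples V r" "ys \<in> tuples V r"
  shows "\<exists>\<sigma>. \<sigma> permutes V \<and> map \<sigma> xs = ys"
proof -
  have l: "length xs = length ys" "distinct xs" "distinct ys" using assms by (auto simp: tuples_def)
  define s where "s x = the (map_of (zip xs ys) x)" for x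
  have s: "map s xs = ys"
    using l by (auto simp: s_def map_of_zip_nth intro!: nth_equalityI)
  then have "inj_on s (set xs)" using l by (metis distinct_map)
  moreover have "s ` set xs \<subseteq> V" using s assms by (metis (mono_tags, lifting) list.set_map mem_Collect_eq tuples_def)
  moreover have "set xs \<subseteq> V" using assms by (auto simp: tuples_def)
  ultimately obtain \<sigma> where "\<sigma> permutes V" "agree_on (set xs) \<sigma> s"
    using extend_to_permutation[OF assms(1)] by blast
  then show ?thesis using s by (auto simp: agree_on_def)
qed

lemma sum_permutations_compose:
  fixes f :: "('a \<Rightarrow> 'a) \<Rightarrow> real"
  assumes "\<sigma> permutes V"
  shows "(\<Sum>\<pi> | \<pi> permutes V. f (\<pi> \<circ> \<sigma>)) = (\<Sum>\<pi> | \<pi> permutes V. f \<pi>)"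
  using sum_permutations_compose_right[OF assms, of f] by simp

text \<open>A random permutation sends a fixed tuple to a uniformly random one: by transitivity the
  sum over permutations is the same for every tuple, and a single permutation merely rearranges the
  set of all tuples.\<close>

lemma sum_permutations_tuple:
  fixes g :: "'a list \<Rightarrow> real"
  assumes "finite V" "xs \<in> tuples V r"
  shows "real (card (tuples V r)) * (\<Sum>\<pi> | \<pi> permutes V. g (map \<pi> xs)) =
    real (card {\<pi>. \<pi> permutes V}) * (\<Sum>ys\<in>tuples V r. g ys)"
proof -
  have "(\<Sum>\<pi> | \<pi> permutes V. g (map \<pi> ys)) = (\<Sum>\<pi> | \<pi> permutes V. g (map \<pi> xs))"
    if ys: "ys \<in> tuples V r" for ys
  proof -
    obtain \<sigma> where \<sigma>: "\<sigma> permutes V" "map \<sigma> xs = ys"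
      using tuples_transitive[OF assms ys] by blast
    show ?thesis
      using sum_permutations_compose[OF \<sigma>(1), of "\<lambda>\<pi>. g (map \<pi> xs)"] \<sigma>(2)
      by (simp add: map_map[symmetric] del: map_map)
  qed
  then have "real (card (tuples V r)) * (\<Sum>\<pi> | \<pi> permutes V. g (map \<pi> xs)) =
    (\<Sum>ys\<in>tuples V r. \<Sum>\<pi> | \<pi> permutes V. g (map \<pi> ys))" by simp
  also have "\<dots> = (\<Sum>\<pi> | \<pi> permutes V. \<Sum>ys\<in>tuples V r. g (map \<pi> ys))" by (rule sum.swap)
  also have "\<dots> = (\<Sum>\<pi> | \<pi> permutes V. \<Sum>ys\<in>tuples V r. g ys)"
    by (rule sum.cong) (auto intro!: sum.reindex_bij_betw permutes_map_tuples)
  finally show ?thesis by simp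
qed

section \<open>Independent profitable swaps and the first-moment argument\<close>

context guest
begin

text \<open>Swapping one pair leaves the closed neighbourhood of every other pair untouched, so the
  gains of several swaps add up.\<close>

definition apart :: "('a \<times> 'a) set \<Rightarrow> bool" where
  "apart Q \<longleftrightarrow> (\<forall>u v u' v'. (u, v) \<in> Q \<longrightarrow> (u', v') \<in> Q \<longrightarrow> (u, v) \<noteq> (u', v') \<longrightarrow>
    u \<notin> clo u' v' \<and> v \<notin> clo u' v')"

lemma apartD:
  "apart Q \<Longrightarrow> (u, v) \<in> Q \<Longrightarrow> (u', v') \<in> Q \<Longrightarrow> (u, v) \<noteq> (u', v') \<Longrightarrow> {u, v} \<inter> clo u' v' = {}"
  unfolding apart_def by blast

lemma apart_subset: "apart Q \<Longrightarrow> Q' \<subseteq> Q \<Longrightarrow> apart Q'"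
  unfolding apart_def by (meson subsetD)

lemma improve:
  assumes "finite Q" "apart Q" "\<And>u v. (u, v) \<in> Q \<Longrightarrow> u \<in> V \<and> v \<in> V \<and> u \<noteq> v" "\<pi> permutes V"
  shows "\<exists>\<rho>. \<rho> permutes V \<and> agree_on (- (\<Union>(u, v)\<in>Q. {u, v})) \<rho> \<pi> \<and>
    weight w \<rho> = weight w \<pi> + (\<Sum>(u, v)\<in>Q. max 0 (gain w \<pi> u v))"
  using assms(1-3)
proof (induction Q rule: finite_induct)
  case empty
  then show ?case using assms(4) by (intro exI[of _ \<pi>]) simp
next
  case (insert p Q)
  obtain u v where p: "p = (u, v)" by force
  have "apart Q" by (rule apart_subset[OF insert.prems(1)]) auto
  then obtain \<rho> where \<rho>: "\<rho> permutes V" "agree_on (- (\<Union>(u, v)\<in>Q. {u, v})) \<rho> \<pi>"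
    "weight w \<rho> = weight w \<pi> + (\<Sum>(u, v)\<in>Q. max 0 (gain w \<pi> u v))"
    using insert.IH insert.prems(2) by blast
  have uv: "u \<in> V" "v \<in> V" "u \<noteq> v" using insert.prems(2) p by auto
  have "{u', v'} \<inter> clo u v = {}" if "(u', v') \<in> Q" for u' v'
    by (rule apartD[OF insert.prems(1)]) (use that insert.hyps(2) p in auto)
  then have "agree_on (clo u v) \<rho> \<pi>"
    by (intro agree_on_subset[OF \<rho>(2)]) auto
  then have g: "gain w \<rho> u v = gain w \<pi> u v" by (rule gain_cong[OF uv(3)])
  show ?case
  proof (cases "gain w \<pi> u v > 0")
    case True
    define \<sigma> where "\<sigma> = \<rho> \<circ> transpose u v"
    have "\<sigma> permutes V" unfolding \<sigma>_def using permutes_compose[OF permutes_swap_id \<rho>(1)] uv by blast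
    moreover have "agree_on (- (\<Union>(u, v)\<in>insert p Q. {u, v})) \<sigma> \<pi>"
      using \<rho>(2) by (auto simp: agree_on_def p \<sigma>_def)
    moreover have "weight w \<sigma> = weight w \<rho> + gain w \<rho> u v" by (simp add: gain_def \<sigma>_def)
    ultimately show ?thesis using insert.hyps True g \<rho>(3) by (intro exI[of _ \<sigma>]) (simp add: p)
  next
    case False
    have "agree_on (- (\<Union>(u, v)\<in>insert p Q. {u, v})) \<rho> \<pi>"
      using \<rho>(2) by (auto simp: agree_on_def)
    then show ?thesis using insert.hyps False \<rho> by (intro exI[of _ \<rho>]) (simp add: p)
  qed
qed

text \<open>Composing with the transposition rearranges the permutations and negates the
  gain.\<close>

lemma sum_gain_permutations:
  assumes "u \<in> V" "v \<in> V"
  shows "(\<Sum>\<pi> | \<pi> permutes V. real_of_int (gain w \<pi> u v)) = 0"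
  using sum_permutations_compose[OF permutes_swap_id[OF assms], of "\<lambda>\<pi>. real_of_int (gain w \<pi> u v)"]
  by (simp add: gain_neg sum_negf)

text \<open>Comparing the gain at \<open>\<pi>\<close> and at \<open>\<pi> \<circ> transpose y z\<close> bounds its average absolute value from below
  by a quantity that depends on the images of only four vertices, whatever the degree of \<open>u\<close>.\<close>

lemma gain_transpose_neighbour:
  assumes "u \<noteq> v" "nbrs u \<inter> nbrs v = {}" "y \<in> nbrs u" "y \<noteq> v" "z \<notin> clo u v"
  shows "gain w (\<pi> \<circ> transpose y z) u v - gain w \<pi> u v =
    (w {\<pi> v, \<pi> z} - w {\<pi> u, \<pi> z}) - (w {\<pi> v, \<pi> y} - w {\<pi> u, \<pi> y})"
proof -
  let ?\<tau> = "transpose y z"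
  have ne: "y \<noteq> u" "z \<noteq> u" "z \<noteq> v" "z \<notin> nbrs u" "z \<notin> nbrs v" "y \<notin> nbrs v"
    using assms nbrs_irrefl by (auto simp: clo_def)
  have uv: "?\<tau> u = u" "?\<tau> v = v" using ne assms by (auto simp: transpose_def)
  have y: "nbrs u - {v} = insert y (nbrs u - {v, y})" using assms by auto
  have S: "(\<Sum>x\<in>nbrs u - {v}. h x) = h y + (\<Sum>x\<in>nbrs u - {v, y}. h x)" for h :: "'a \<Rightarrow> int"
    by (subst y, subst sum.insert) auto
  have 1: "(\<Sum>x\<in>nbrs u - {v, y}. h (?\<tau> x)) = (\<Sum>x\<in>nbrs u - {v, y}. h x)" for h :: "'a \<Rightarrow> int"
    by (rule sum.cong) (use ne in \<open>auto simp: transpose_def\<close>)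
  have 2: "(\<Sum>x\<in>nbrs v - {u}. h (?\<tau> x)) = (\<Sum>x\<in>nbrs v - {u}. h x)" for h :: "'a \<Rightarrow> int"
    by (rule sum.cong) (use ne in \<open>auto simp: transpose_def\<close>)
  show ?thesis
    unfolding gain_eq[OF assms(1)] S
    using 1[of "\<lambda>x. w {\<pi> v, \<pi> x} - w {\<pi> u, \<pi> x}"] 2[of "\<lambda>x. w {\<pi> u, \<pi> x} - w {\<pi> v, \<pi> x}"]
    by (simp add: uv)
qed

text \<open>The value of \<open>h\<close> at the image of \<open>t\<close> is at most the sum of two
  absolute gains with equal averages, and it is at least 1 on alternating tuples, so the mean
  absolute gain is at least \<open>\<zeta> / 2\<close>. The mean gain being 0, the positive part has
  half that mean.\<close>

lemma sum_positive_gain: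
  fixes \<zeta> :: real
  assumes "u \<in> V" "v \<in> V" "u \<noteq> v" "nbrs u \<inter> nbrs v = {}" "nbrs u \<noteq> {}" "v \<notin> nbrs u"
    and big: "2 * \<Delta> + 2 < card V"
    and \<zeta>: "\<zeta> * real (card V) ^ 4 \<le> real (card {xs\<in>tuples V 4. alternating w xs})"
  shows "(\<Sum>\<pi> | \<pi> permutes V. real_of_int (max 0 (gain w \<pi> u v))) \<ge>
    real (card {\<pi>. \<pi> permutes V}) * (\<zeta> / 4)"
proof -
  let ?P = "{\<pi>. \<pi> permutes V}"
  obtain y where y: "y \<in> nbrs u" "y \<noteq> v" using assms by auto
  have "\<not> V \<subseteq> clo u v" using card_mono[OF finite_clo, of V u v] card_clo[of u v] big by linarith
  then obtain z where z: "z \<in> V" "z \<notin> clo u v" by auto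
  define h where "h xs = \<bar>real_of_int ((w {xs ! 1, xs ! 3} - w {xs ! 0, xs ! 3}) -
    (w {xs ! 1, xs ! 2} - w {xs ! 0, xs ! 2}))\<bar>" for xs
  define t where "t = [u, v, y, z]"
  have t: "t \<in> tuples V 4"
    using y z assms nbrs_subset nbrs_irrefl by (auto simp: t_def tuples_def clo_def)
  have \<tau>: "transpose y z permutes V" by (rule permutes_swap_id) (use y z nbrs_subset in auto)
  have "h (map \<pi> t) \<le> \<bar>real_of_int (gain w (\<pi> \<circ> transpose y z) u v)\<bar> + \<bar>real_of_int (gain w \<pi> u v)\<bar>" for \<pi>
    using gain_transpose_neighbour[OF assms(3,4) y z(2), of w \<pi>]
    by (simp add: h_def t_def eval_nat_numeral)
  then have "(\<Sum>\<pi>\<in>?P. h (map \<pi> t)) \<le>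
     (\<Sum>\<pi>\<in>?P. \<bar>real_of_int (gain w (\<pi> \<circ> transpose y z) u v)\<bar> + \<bar>real_of_int (gain w \<pi> u v)\<bar>)"
    by (intro sum_mono)
  also have "\<dots> = 2 * (\<Sum>\<pi>\<in>?P. \<bar>real_of_int (gain w \<pi> u v)\<bar>)"
    using sum_permutations_compose[OF \<tau>, of "\<lambda>\<pi>. \<bar>real_of_int (gain w \<pi> u v)\<bar>"]
    by (simp add: sum.distrib)
  finally have 1: "(\<Sum>\<pi>\<in>?P. h (map \<pi> t)) \<le> 2 * (\<Sum>\<pi>\<in>?P. \<bar>real_of_int (gain w \<pi> u v)\<bar>)" .
  have "real (card {xs\<in>tuples V 4. alternating w xs}) = (\<Sum>xs\<in>{xs\<in>tuples V 4. alternating w xs}. 1)"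
    by simp
  also have "\<dots> \<le> (\<Sum>xs\<in>{xs\<in>tuples V 4. alternating w xs}. h xs)"
    by (rule sum_mono) (auto simp: h_def alternating_def)
  also have "\<dots> \<le> (\<Sum>xs\<in>tuples V 4. h xs)"
    by (rule sum_mono2) (auto simp: finite_tuples finite_V h_def)
  finally have 2: "\<zeta> * real (card V) ^ 4 \<le> (\<Sum>xs\<in>tuples V 4. h xs)" using \<zeta> by linarith
  have n4: "real (card (tuples V 4)) \<le> real (card V) ^ 4"
    using card_tuples_le[OF finite_V, of 4] by (metis of_nat_le_iff of_nat_power)
  have pos: "real (card V) ^ 4 > 0" using big by simp
  have hp: "(\<Sum>\<pi>\<in>?P. h (map \<pi> t)) \<ge> 0" by (rule sum_nonneg) (simp add: h_def)
  have "real (card ?P) * \<zeta> * real (card V) ^ 4 \<le> real (card ?P) * (\<Sum>xs\<in>tuples V 4. h xs)"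
    using 2 by (simp add: mult.assoc mult_left_mono)
  also have "\<dots> = real (card (tuples V 4)) * (\<Sum>\<pi>\<in>?P. h (map \<pi> t))"
    using sum_permutations_tuple[OF finite_V t, of h] by simp
  also have "\<dots> \<le> real (card V) ^ 4 * (\<Sum>\<pi>\<in>?P. h (map \<pi> t))"
    by (rule mult_right_mono[OF n4 hp])
  finally have "real (card ?P) * \<zeta> \<le> (\<Sum>\<pi>\<in>?P. h (map \<pi> t))"
    using pos by (simp add: mult.commute)
  then have 3: "real (card ?P) * \<zeta> \<le> 2 * (\<Sum>\<pi>\<in>?P. \<bar>real_of_int (gain w \<pi> u v)\<bar>)" using 1 by linarith
  have "(\<Sum>\<pi>\<in>?P. real_of_int (max 0 (gain w \<pi> u v))) =
    (\<Sum>\<pi>\<in>?P. \<bar>real_of_int (gain w \<pi> u v)\<bar> / 2 + real_of_int (gain w \<pi> u v) / 2)"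
    by (rule sum.cong) (auto simp: max_def)
  also have "\<dots> = (\<Sum>\<pi>\<in>?P. \<bar>real_of_int (gain w \<pi> u v)\<bar>) / 2"
    using sum_gain_permutations[OF assms(1,2), of w]
    by (simp add: sum.distrib sum_divide_distrib[symmetric])
  finally show ?thesis using 3 by simp
qed

text \<open>Linearity of expectation: every edge of \<open>F\<close> lands on a uniformly random
  ordered pair.\<close>

lemma sum_weight_permutations:
  fixes \<kappa> :: real
  assumes \<kappa>: "- \<kappa> * real (card (tuples V 2)) \<le> (\<Sum>xs\<in>tuples V 2. real_of_int (w (set xs)))"
  shows "(\<Sum>\<pi> | \<pi> permutes V. real_of_int (weight w \<pi>)) \<ge>
    - \<kappa> * real (card F) * real (card {\<pi>. \<pi> permutes V})"
proof -
  let ?P = "{\<pi>. \<pi> permutes V}"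
  have e: "(\<Sum>\<pi>\<in>?P. real_of_int (w (\<pi> ` e))) \<ge> - \<kappa> * real (card ?P)" if "e \<in> F" for e
  proof -
    obtain x y where xy: "e = {x, y}" "x \<noteq> y" using F_edge[OF \<open>e \<in> F\<close>] by (auto simp: card_2_iff)
    have t: "[x, y] \<in> tuples V 2" using F_edge[OF \<open>e \<in> F\<close>] xy by (auto simp: tuples_def)
    then have pos: "real (card (tuples V 2)) > 0"
      using finite_tuples[OF finite_V] by (metis card_gt_0_iff empty_iff of_nat_0_less_iff)
    have "real (card (tuples V 2)) * (- \<kappa> * real (card ?P)) \<le>
      real (card ?P) * (\<Sum>xs\<in>tuples V 2. real_of_int (w (set xs)))"
      using mult_left_mono[OF \<kappa>, of "real (card ?P)"] by (simp add: algebra_simps)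
    also have "\<dots> = real (card (tuples V 2)) * (\<Sum>\<pi>\<in>?P. real_of_int (w (\<pi> ` e)))"
      using sum_permutations_tuple[OF finite_V t, of "\<lambda>xs. real_of_int (w (set xs))"] xy by simp
    finally show ?thesis using mult_le_cancel_left_pos[OF pos] by blast
  qed
  have "(\<Sum>\<pi>\<in>?P. real_of_int (weight w \<pi>)) = (\<Sum>\<pi>\<in>?P. \<Sum>e\<in>F. real_of_int (w (\<pi> ` e)))"
    by (simp add: weight_def)
  also have "\<dots> = (\<Sum>e\<in>F. \<Sum>\<pi>\<in>?P. real_of_int (w (\<pi> ` e)))" by (rule sum.swap)
  also have "\<dots> \<ge> (\<Sum>e\<in>F. - \<kappa> * real (card ?P))" by (rule sum_mono) (rule e)
  finally show ?thesis by (simp add: algebra_simps)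
qed

text \<open>Some permutation reaches at least the mean of its weight plus its positive gains over
  \<open>Q\<close>; \<open>improve\<close> then realises those gains.\<close>

lemma heavy_permutation:
  fixes \<kappa> \<zeta> :: real
  assumes Q: "finite Q" "apart Q" "\<And>u v. (u, v) \<in> Q \<Longrightarrow>
      u \<in> V \<and> v \<in> V \<and> u \<noteq> v \<and> nbrs u \<inter> nbrs v = {} \<and> nbrs u \<noteq> {} \<and> v \<notin> nbrs u"
    and big: "2 * \<Delta> + 2 < card V"
    and \<kappa>: "- \<kappa> * real (card (tuples V 2)) \<le> (\<Sum>xs\<in>tuples V 2. real_of_int (w (set xs)))"
    and \<zeta>: "\<zeta> * real (card V) ^ 4 \<le> real (card {xs\<in>tuples V 4. alternating w xs})"
  shows "\<exists>\<rho>. \<rho> permutes V \<and> real_of_int (weight w \<rho>) \<ge> - \<kappa> * real (card F) + real (card Q) * (\<zeta> / 4)"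
proof -
  let ?P = "{\<pi>. \<pi> permutes V}"
  let ?b = "- \<kappa> * real (card F) + real (card Q) * (\<zeta> / 4)"
  define \<Phi> where "\<Phi> \<pi> = real_of_int (weight w \<pi>) + (\<Sum>(u, v)\<in>Q. real_of_int (max 0 (gain w \<pi> u v)))" for \<pi>
  have finP: "finite ?P" by (rule finite_permutations[OF finite_V])
  have "id \<in> ?P" by (simp add: permutes_id)
  have "(\<Sum>\<pi>\<in>?P. \<Sum>p\<in>Q. real_of_int (max 0 (gain w \<pi> (fst p) (snd p)))) =
    (\<Sum>p\<in>Q. \<Sum>\<pi>\<in>?P. real_of_int (max 0 (gain w \<pi> (fst p) (snd p))))" by (rule sum.swap)
  also have "\<dots> \<ge> (\<Sum>p\<in>Q. real (card ?P) * (\<zeta> / 4))"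
  proof (rule sum_mono)
    fix p assume "p \<in> Q"
    then have "(fst p, snd p) \<in> Q" by simp
    from Q(3)[OF this] show "real (card ?P) * (\<zeta> / 4) \<le>
        (\<Sum>\<pi>\<in>?P. real_of_int (max 0 (gain w \<pi> (fst p) (snd p))))"
      using sum_positive_gain[OF _ _ _ _ _ _ big \<zeta>] by blast
  qed
  finally have le: "(\<Sum>\<pi>\<in>?P. \<Phi> \<pi>) \<ge> (\<Sum>\<pi>\<in>?P. ?b)"
    using sum_weight_permutations[OF \<kappa>]
    by (simp add: \<Phi>_def sum.distrib case_prod_beta algebra_simps)
  have "\<exists>\<pi>\<in>?P. \<Phi> \<pi> \<ge> ?b"
  proof (rule ccontr)
    assume neg: "\<not> (\<exists>\<pi>\<in>?P. \<Phi> \<pi> \<ge> ?b)"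
    have "\<Phi> \<pi> < ?b" if "\<pi> \<in> ?P" for \<pi>
      using neg that by (meson not_le)
    moreover have "?P \<noteq> {}" using \<open>id \<in> ?P\<close> by blast
    ultimately have "(\<Sum>\<pi>\<in>?P. \<Phi> \<pi>) < (\<Sum>\<pi>\<in>?P. ?b)"
      by (intro sum_strict_mono[OF finP])
    then show False using le by linarith
  qed
  then obtain \<pi> where \<pi>: "\<pi> permutes V" "\<Phi> \<pi> \<ge> ?b" by auto
  obtain \<rho> where "\<rho> permutes V" "weight w \<rho> = weight w \<pi> + (\<Sum>(u, v)\<in>Q. max 0 (gain w \<pi> u v))"
    using improve[OF Q(1,2) _ \<pi>(1), of w] Q(3) by blast
  then have "\<rho> permutes V" "real_of_int (weight w \<rho>) = \<Phi> \<pi>"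
    by (simp_all add: \<Phi>_def case_prod_beta)
  then show ?thesis using \<pi>(2) by (intro exI[of _ \<rho>]) simp
qed

end

section \<open>Balanced colourings of dense graphs\<close>

locale coloured_host = host +
  fixes c :: "'a set \<Rightarrow> int"
  assumes colour: "e \<in> E \<Longrightarrow> c e \<in> {-1, 1}"
begin

abbreviation "n \<equiv> card V"

definition fibre :: "'a \<Rightarrow> 'a \<Rightarrow> int \<Rightarrow> 'a set" where
  "fibre x x' a = {y\<in>V. {x, y} \<in> E \<and> {x', y} \<in> E \<and> c {x', y} - c {x, y} = a}"

text \<open>Taking \<open>y\<close> and \<open>z\<close> from two different large fibres gives an
  alternating tuple. Two vertices placed on a split pair can also be given a swap of prescribed gain
  by placing their neighbours in chosen fibres.\<close>

definition split_pair :: "real \<Rightarrow> 'a \<Rightarrow> 'a \<Rightarrow> bool" where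
  "split_pair t x x' \<longleftrightarrow> (\<exists>a b. a \<noteq> b \<and> t \<le> real (card (fibre x x' a)) \<and> t \<le> real (card (fibre x x' b)))"

definition arcs :: "int \<Rightarrow> ('a \<times> 'a) set" where
  "arcs i = {(x, y)\<in>V \<times> V. {x, y} \<in> E \<and> c {x, y} = i}"

lemma finite_fibre [simp]: "finite (fibre x x' a)"
  by (simp add: fibre_def finite_host)

lemma fibre_values:
  assumes "y \<in> fibre x x' a"
  shows "a \<in> {-2, 0, 2}"
  using assms colour[of "{x, y}"] colour[of "{x', y}"] by (auto simp: fibre_def)

text \<open>If nearly every pair \<open>(x, y)\<close> had the colour prescribed by \<open>x\<close>, pairs with \<open>Q x = 1\<close> and \<open>Q y = -1\<close>
  would need both colours, so one of the two colours would be rare.\<close>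

lemma rows_not_determined:
  fixes Q :: "'a \<Rightarrow> int"
  assumes "V \<noteq> {}"
    and arcs: "real n ^ 2 / 4 \<le> real (card (arcs 1))" "real n ^ 2 / 4 \<le> real (card (arcs (-1)))"
  shows "real (card {(x, y)\<in>V \<times> V. \<not> ({x, y} \<in> E \<and> c {x, y} = Q x)}) > 3 / 200 * real n ^ 2"
proof (rule ccontr)
  define B where "B = {(x, y)\<in>V \<times> V. \<not> ({x, y} \<in> E \<and> c {x, y} = Q x)}"
  assume "\<not> ?thesis"
  then have small: "real (card B) \<le> 3 / 200 * real n ^ 2" by (simp add: B_def)
  have n: "real n > 0" using assms(1) finite_host by (simp add: card_gt_0_iff)
  have finB: "finite B" by (rule finite_subset[of _ "V \<times> V"]) (auto simp: finite_host B_def)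
  \<comment> \<open>47/200 is 1/4 - 3/200: apart from \<open>B\<close>, arcs of colour
    \<open>i\<close> lie in the rows with \<open>Q x = i\<close>, which hold at most
    \<open>n\<close> each. The final contradiction is that (47/200)^2 exceeds twice 3/200.\<close>
  have big: "real (card {x\<in>V. Q x = i}) \<ge> 47 / 200 * real n" if "i \<in> {1, -1}" for i
  proof -
    have "arcs i \<subseteq> {x\<in>V. Q x = i} \<times> V \<union> B" by (auto simp: arcs_def B_def)
    then have "card (arcs i) \<le> card ({x\<in>V. Q x = i} \<times> V \<union> B)"
      by (rule card_mono[rotated]) (simp add: finB finite_host)
    also have "\<dots> \<le> card {x\<in>V. Q x = i} * n + card B"
      using card_Un_le[of "{x\<in>V. Q x = i} \<times> V" B] by (simp add: card_cartesian_product)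
    finally have "real (card (arcs i)) \<le> real (card {x\<in>V. Q x = i}) * real n + real (card B)"
      by (metis of_nat_add of_nat_le_iff of_nat_mult)
    moreover have "real n ^ 2 / 4 \<le> real (card (arcs i))" using that arcs by auto
    ultimately have "47 / 200 * real n * real n \<le> real (card {x\<in>V. Q x = i}) * real n"
      using small by (simp add: power2_eq_square)
    then show ?thesis using n by (simp add: mult_le_cancel_right)
  qed
  \<comment> \<open>The edge between \<open>x\<close> and \<open>y\<close> cannot have both the
    colour of row \<open>x\<close> and that of row \<open>y\<close>.\<close>
  have "{x\<in>V. Q x = 1} \<times> {x\<in>V. Q x = -1} \<subseteq> B \<union> prod.swap ` B"
  proof
    fix p assume "p \<in> {x\<in>V. Q x = 1} \<times> {x\<in>V. Q x = -1}"
    then obtain x y where p: "p = (x, y)" "x \<in> V" "y \<in> V" "Q x = 1" "Q y = -1" by auto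
    then have "(x, y) \<in> B \<or> (y, x) \<in> B" by (auto simp: insert_commute B_def)
    then show "p \<in> B \<union> prod.swap ` B"
      using p(1) by (metis UnI1 UnI2 image_eqI swap_simp)
  qed
  then have "card ({x\<in>V. Q x = 1} \<times> {x\<in>V. Q x = -1}) \<le> card (B \<union> prod.swap ` B)"
    by (rule card_mono[rotated]) (simp add: finB)
  also have "\<dots> \<le> card B + card (prod.swap ` B)" by (rule card_Un_le)
  also have "\<dots> \<le> 2 * card B" using card_image_le[OF finB, of prod.swap] by linarith
  finally have "card {x\<in>V. Q x = 1} * card {x\<in>V. Q x = -1} \<le> 2 * card B"
    by (simp only: card_cartesian_product)
  then have "real (card {x\<in>V. Q x = 1} * card {x\<in>V. Q x = -1}) \<le> real (2 * card B)"
    by (rule of_nat_mono)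
  then have "real (card {x\<in>V. Q x = 1}) * real (card {x\<in>V. Q x = -1}) \<le> 2 * real (card B)"
    by simp
  moreover have "(47 / 200 * real n) * (47 / 200 * real n) \<le>
      real (card {x\<in>V. Q x = 1}) * real (card {x\<in>V. Q x = -1})"
    by (rule mult_mono) (use big n in auto)
  ultimately have "(47 / 200 * real n) * (47 / 200 * real n) \<le> 3 / 100 * real n ^ 2"
    using small by linarith
  then show False using n by (simp add: power2_eq_square)
qed

lemma columns_not_determined:
  fixes Q :: "'a \<Rightarrow> int"
  assumes "V \<noteq> {}"
    and arcs: "real n ^ 2 / 4 \<le> real (card (arcs 1))" "real n ^ 2 / 4 \<le> real (card (arcs (-1)))"
  shows "real (card {(x, y)\<in>V \<times> V. \<not> ({x, y} \<in> E \<and> c {x, y} = Q y)}) > 3 / 200 * real n ^ 2"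
proof -
  have "{(x, y)\<in>V \<times> V. \<not> ({x, y} \<in> E \<and> c {x, y} = Q y)} =
    prod.swap ` {(x, y)\<in>V \<times> V. \<not> ({x, y} \<in> E \<and> c {x, y} = Q x)}"
    by (auto simp: insert_commute image_iff)
  then have "card {(x, y)\<in>V \<times> V. \<not> ({x, y} \<in> E \<and> c {x, y} = Q y)} =
    card {(x, y)\<in>V \<times> V. \<not> ({x, y} \<in> E \<and> c {x, y} = Q x)}"
    by (simp add: card_image)
  then show ?thesis using rows_not_determined[OF assms, of Q] by simp
qed

text \<open>If \<open>x\<close> forms no split pair with \<open>x0\<close>, then row
  \<open>x\<close> of the colour matrix is row \<open>x0\<close> shifted by a constant
  \<open>a x\<close>, up to few entries. If all shifts are 0, colours are nearly determined by the
  column; a nonzero shift forces row \<open>x0\<close> to be nearly constant, and then colours are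
  nearly determined by the row. The two preceding lemmas exclude both.\<close>

lemma many_split_pairs:
  assumes "x0 \<in> V" and q: "1200 * real q \<le> real n"
    and arcs: "real n ^ 2 / 4 \<le> real (card (arcs 1))" "real n ^ 2 / 4 \<le> real (card (arcs (-1)))"
  shows "real n / 600 \<le> real (card {x\<in>V. split_pair (real n / 600) x0 x})"
proof (rule ccontr)
  let ?t = "real n / 600"
  define W where "W = {x\<in>V. \<not> split_pair ?t x0 x}"
  assume "\<not> ?thesis"
  moreover have "V - W = {x\<in>V. split_pair ?t x0 x}" by (auto simp: W_def)
  ultimately have VW: "real (card (V - W)) \<le> ?t" by simp
  have V: "V \<noteq> {}" using assms(1) by auto
  then have n: "real n > 0" using finite_host by (simp add: card_gt_0_iff)
  \<comment> \<open>n/200 is three times n/600: two small fibres, and the at most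
    \<open>2 * q\<close> non-neighbours of \<open>x0\<close> or \<open>x\<close>.\<close>
  have "\<exists>a\<in>{-2, 0, 2}. real (card (V - fibre x0 x a)) \<le> real n / 200" if x: "x \<in> W" for x
  proof -
    have ns: "\<not> split_pair ?t x0 x" "x \<in> V" using x by (auto simp: W_def)
    have "\<exists>a\<in>{-2, 0, 2}. \<forall>b. b \<noteq> a \<longrightarrow> real (card (fibre x0 x b)) \<le> ?t"
    proof (cases "\<exists>a. ?t \<le> real (card (fibre x0 x a))")
      case True
      then obtain a where a: "?t \<le> real (card (fibre x0 x a))" by blast
      then have "card (fibre x0 x a) \<noteq> 0" using n by auto
      then obtain y where "y \<in> fibre x0 x a" by (metis card.empty equals0I)
      then have "a \<in> {-2, 0, 2}" by (rule fibre_values)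
      moreover have "real (card (fibre x0 x b)) \<le> ?t" if "b \<noteq> a" for b
        using ns(1) a that unfolding split_pair_def by (meson le_cases)
      ultimately show ?thesis by blast
    next
      case False
      \<comment> \<open>All fibres are below the threshold, so 0 is just a default.\<close>
      then show ?thesis by (intro bexI[of _ 0]) (auto simp: not_le less_imp_le)
    qed
    then obtain a where a: "a \<in> {-2, 0, 2}" "\<And>b. b \<noteq> a \<Longrightarrow> real (card (fibre x0 x b)) \<le> ?t" by blast
    define O' where "O' = (\<Union>b\<in>{-2, 0, 2} - {a}. fibre x0 x b)"
    have card_O': "real (card O') \<le> 2 * ?t"
    proof -
      have "card O' \<le> (\<Sum>b\<in>{-2, 0, 2} - {a}. card (fibre x0 x b))"
        unfolding O'_def by (rule card_UN_le) simp
      then have "real (card O') \<le> (\<Sum>b\<in>{-2, 0, 2} - {a}. real (card (fibre x0 x b)))"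
        by (metis of_nat_le_iff of_nat_sum)
      also have "\<dots> \<le> (\<Sum>b\<in>{-2, 0, 2} - {a}. ?t)" by (rule sum_mono) (use a in auto)
      also have "\<dots> = 2 * ?t" using a(1) by auto
      finally show ?thesis .
    qed
    have "V - fibre x0 x a \<subseteq> {y\<in>V. {x0, y} \<notin> E} \<union> {y\<in>V. {x, y} \<notin> E} \<union> O'"
    proof
      fix y assume y: "y \<in> V - fibre x0 x a"
      show "y \<in> {y\<in>V. {x0, y} \<notin> E} \<union> {y\<in>V. {x, y} \<notin> E} \<union> O'"
      proof (cases "{x0, y} \<in> E \<and> {x, y} \<in> E")
        case True
        then have f: "y \<in> fibre x0 x (c {x, y} - c {x0, y})" using y by (simp add: fibre_def)
        then have "c {x, y} - c {x0, y} \<in> {-2, 0, 2} - {a}" using fibre_values[OF f] y by auto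
        then show ?thesis using f unfolding O'_def by blast
      qed (use y in auto)
    qed
    then have "card (V - fibre x0 x a) \<le> card ({y\<in>V. {x0, y} \<notin> E} \<union> {y\<in>V. {x, y} \<notin> E} \<union> O')"
      by (rule card_mono[rotated]) (auto simp: finite_host O'_def)
    also have "\<dots> \<le> card {y\<in>V. {x0, y} \<notin> E} + card {y\<in>V. {x, y} \<notin> E} + card O'"
      by (meson add_le_mono1 card_Un_le order_trans)
    also have "\<dots> \<le> q + q + card O'"
      using card_nonadjacent[OF assms(1)] card_nonadjacent[OF ns(2)] by linarith
    finally have "real (card (V - fibre x0 x a)) \<le> 2 * real q + real (card O')" by linarith
    then show ?thesis using q card_O' a(1) by (intro bexI[of _ a]) auto
  qed
  then obtain a where a: "\<And>x. x \<in> W \<Longrightarrow> a x \<in> {-2, 0, 2}"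
    "\<And>x. x \<in> W \<Longrightarrow> real (card (V - fibre x0 x (a x))) \<le> real n / 200" by metis
  define M where "M x = V - fibre x0 x (a x)" for x
  have M: "finite (M x)" "x \<in> W \<Longrightarrow> real (card (M x)) \<le> real n / 200" for x
    using a by (auto simp: M_def finite_host)
  have "W \<subseteq> V" by (auto simp: W_def)
  then have finW: "finite W" "real (card W) \<le> real n"
    using finite_host finite_subset card_mono by (blast, simp add: card_mono finite_host)
  \<comment> \<open>At most n/600 rows lie outside \<open>W\<close>, and every other row has at most
    n/100 exceptional entries; 1/600 + 1/100 is below 3/200.\<close>
  have exceptional: "real (card B) \<le> 3 / 200 * real n ^ 2"
    if B: "B \<subseteq> (V - W) \<times> V \<union> Sigma W (\<lambda>x. M x \<union> M x1)" "x1 \<in> W" for B x1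
  proof -
    have fin: "finite (Sigma W (\<lambda>x. M x \<union> M x1))" using finW M by auto
    have "card B \<le> card ((V - W) \<times> V \<union> Sigma W (\<lambda>x. M x \<union> M x1))"
      by (rule card_mono[OF _ B(1)]) (use fin finite_host in auto)
    also have "\<dots> \<le> card ((V - W) \<times> V) + card (Sigma W (\<lambda>x. M x \<union> M x1))" by (rule card_Un_le)
    also have "\<dots> = card (V - W) * n + (\<Sum>x\<in>W. card (M x \<union> M x1))"
      using finW M by (simp add: card_cartesian_product)
    finally have "real (card B) \<le> real (card (V - W)) * real n + (\<Sum>x\<in>W. real (card (M x \<union> M x1)))"
      by (metis of_nat_add of_nat_le_iff of_nat_mult of_nat_sum)
    also have "(\<Sum>x\<in>W. real (card (M x \<union> M x1))) \<le> (\<Sum>x\<in>W. real n / 100)"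
    proof (rule sum_mono)
      fix x assume "x \<in> W"
      have "real (card (M x \<union> M x1)) \<le> real (card (M x)) + real (card (M x1))"
        using card_Un_le[of "M x" "M x1"] by linarith
      then show "real (card (M x \<union> M x1)) \<le> real n / 100"
        using M(2)[OF \<open>x \<in> W\<close>] M(2)[OF B(2)] by linarith
    qed
    also have "\<dots> \<le> real n * (real n / 100)" using finW by (simp add: mult_right_mono)
    also have "real (card (V - W)) * real n \<le> ?t * real n" using VW by (intro mult_right_mono) auto
    finally have "real (card B) \<le> ?t * real n + real n * (real n / 100)" by simp
    also have "\<dots> \<le> 3 / 200 * real n ^ 2" by (simp add: power2_eq_square)
    finally show ?thesis .
  qed
  have in_fibre: "{x, y} \<in> E" "c {x, y} - c {x0, y} = a x" "{x0, y} \<in> E"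
    if "y \<in> V" "y \<notin> M x" for x y using that by (auto simp: M_def fibre_def)
  show False
  proof (cases "\<exists>x1\<in>W. a x1 \<noteq> 0")
    case False
    have "W \<noteq> {}"
    proof
      assume "W = {}"
      then have "real n \<le> ?t" using VW by simp
      then show False using n by simp
    qed
    then obtain x1 where x1: "x1 \<in> W" by blast
    let ?B = "{(x, y)\<in>V \<times> V. \<not> ({x, y} \<in> E \<and> c {x, y} = c {x0, y})}"
    have "?B \<subseteq> (V - W) \<times> V \<union> Sigma W (\<lambda>x. M x \<union> M x1)"
      using in_fibre(1,2) False by fastforce
    from exceptional[OF this x1] columns_not_determined[OF V arcs, of "\<lambda>y. c {x0, y}"]
    show False by simp
  next
    case True
    then obtain x1 where x1: "x1 \<in> W" "a x1 \<noteq> 0" by blast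
    define s where "s = a x1 div 2"
    have s: "a x1 = 2 * s" "s \<in> {1, -1}" using a(1)[OF x1(1)] x1(2) by (auto simp: s_def)
    \<comment> \<open>Off \<open>M x1\<close>, row \<open>x0\<close> has the value
      \<open>- s\<close>. Only the shifts \<open>2 * s\<close> and 0 lead from there to a colour,
      and the second branch gives the value for the shift 0.\<close>
    define Q where "Q x = (if a x = 2 * s then s else - s)" for x
    let ?B = "{(x, y)\<in>V \<times> V. \<not> ({x, y} \<in> E \<and> c {x, y} = Q x)}"
    have "?B \<subseteq> (V - W) \<times> V \<union> Sigma W (\<lambda>x. M x \<union> M x1)"
    proof
      fix p assume "p \<in> ?B"
      then obtain x y where p: "p = (x, y)" "x \<in> V" "y \<in> V" "\<not> ({x, y} \<in> E \<and> c {x, y} = Q x)" by auto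
      have "x \<notin> W \<or> y \<in> M x \<union> M x1"
      proof (rule ccontr)
        assume "\<not> ?thesis"
        then have xy: "x \<in> W" "y \<notin> M x" "y \<notin> M x1" by auto
        have "c {x1, y} - c {x0, y} = 2 * s" using in_fibre(2)[OF p(3) xy(3)] s by simp
        then have "c {x0, y} = - s"
          using colour[OF in_fibre(1)[OF p(3) xy(3)]] colour[OF in_fibre(3)[OF p(3) xy(3)]] s(2) by auto
        moreover have "c {x, y} - c {x0, y} = a x" by (rule in_fibre(2)[OF p(3) xy(2)])
        ultimately have "c {x, y} = Q x"
          using colour[OF in_fibre(1)[OF p(3) xy(2)]] a(1)[OF xy(1)] s(2) by (auto simp: Q_def)
        then show False using p(4) in_fibre(1)[OF p(3) xy(2)] by simp
      qed
      then show "p \<in> (V - W) \<times> V \<union> Sigma W (\<lambda>x. M x \<union> M x1)" using p by auto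
    qed
    from exceptional[OF this x1(1)] rows_not_determined[OF V arcs, of Q] show False by simp
  qed
qed

lemma split_pair_distinct:
  assumes "split_pair t x x'" "t > 0"
  shows "x \<noteq> x'"
proof
  assume "x = x'"
  then have "fibre x x' a = {}" if "a \<noteq> 0" for a using that by (auto simp: fibre_def)
  moreover obtain a b where "a \<noteq> b" "t \<le> real (card (fibre x x' a))" "t \<le> real (card (fibre x x' b))"
    using assms(1) unfolding split_pair_def by blast
  ultimately show False using assms(2) by (metis card.empty of_nat_0 not_le)
qed

text \<open>Choose \<open>x\<close> freely, then \<open>x'\<close> in at least \<open>t\<close>
  ways, then \<open>y\<close> and \<open>z\<close> from two different fibres of the split pair,
  again in at least \<open>t\<close> ways each.\<close>

lemma many_alternating_tuples:
  assumes split: "\<And>x. x \<in> V \<Longrightarrow> t \<le> real (card {x'\<in>V. split_pair t x x'})"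
    and "t > 0" and w: "\<And>e. e \<in> E \<Longrightarrow> w e = c e"
  shows "real n * t ^ 3 \<le> real (card {xs\<in>tuples V 4. alternating w xs})"
proof -
  let ?P = "\<lambda>x. {x'\<in>V. split_pair t x x'}"
  define G where "G x x' = {(y, z)\<in>V \<times> V. {x, y} \<in> E \<and> {x', y} \<in> E \<and> {x, z} \<in> E \<and> {x', z} \<in> E \<and>
    c {x', z} - c {x, z} \<noteq> c {x', y} - c {x, y}}" for x x'
  have finG: "finite (G x x')" for x x'
    by (rule finite_subset[of _ "V \<times> V"]) (auto simp: G_def finite_host)
  have cardG: "t * t \<le> real (card (G x x'))" if sp: "split_pair t x x'" for x x'
  proof -
    obtain a b where ab: "a \<noteq> b" "t \<le> real (card (fibre x x' a))" "t \<le> real (card (fibre x x' b))"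
      using sp unfolding split_pair_def by blast
    have "t * t \<le> real (card (fibre x x' a)) * real (card (fibre x x' b))"
      using ab assms(2) by (intro mult_mono) auto
    also have "\<dots> = real (card (fibre x x' a \<times> fibre x x' b))" by (simp add: card_cartesian_product)
    also have "\<dots> \<le> real (card (G x x'))"
      by (intro of_nat_mono card_mono[OF finG]) (use ab(1) in \<open>auto simp: G_def fibre_def\<close>)
    finally show ?thesis .
  qed
  let ?S = "SIGMA x:V. SIGMA x':?P x. G x x'"
  have finS: "finite (SIGMA x':?P x. G x x')" for x using finite_host finG by auto
  have "real n * t ^ 3 = (\<Sum>x\<in>V. t * (t * t))" by (simp add: power3_eq_cube)
  also have "\<dots> \<le> (\<Sum>x\<in>V. real (card (?P x)) * (t * t))"
    using split assms(2) by (intro sum_mono mult_right_mono) auto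
  also have "\<dots> = (\<Sum>x\<in>V. \<Sum>x'\<in>?P x. t * t)" by simp
  also have "\<dots> \<le> (\<Sum>x\<in>V. \<Sum>x'\<in>?P x. real (card (G x x')))"
    by (intro sum_mono cardG) simp
  also have "\<dots> = real (card ?S)" using finite_host finG finS by (subst card_SigmaI) auto
  also have "card ?S = card ((\<lambda>(x, x', y, z). [x, x', y, z]) ` ?S)"
    by (rule card_image[symmetric]) (auto simp: inj_on_def)
  also have "\<dots> \<le> card {xs\<in>tuples V 4. alternating w xs}"
  proof (rule card_mono)
    show "finite {xs\<in>tuples V 4. alternating w xs}" by (simp add: finite_tuples finite_host)
    show "(\<lambda>(x, x', y, z). [x, x', y, z]) ` ?S \<subseteq> {xs\<in>tuples V 4. alternating w xs}"
    proof clarify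
      fix x x' y z assume h: "x \<in> V" "x' \<in> V" "split_pair t x x'" "(y, z) \<in> G x x'"
      have "x \<noteq> x'" using split_pair_distinct[OF h(3) assms(2)] .
      moreover have "x \<noteq> y" "x \<noteq> z" "x' \<noteq> y" "x' \<noteq> z" "y \<noteq> z"
        using h(4) E_irrefl by (auto simp: G_def)
      ultimately show "[x, x', y, z] \<in> tuples V 4 \<and> alternating w [x, x', y, z]"
        using h w by (auto simp: tuples_def alternating_def G_def eval_nat_numeral)
    qed
  qed
  finally show ?thesis by simp
qed

end

context host
begin

lemma common_neighbour:
  assumes "finite S" "S \<subseteq> V" "card S * q < card Y" "Y \<subseteq> V"
  shows "\<exists>z\<in>Y. \<forall>x\<in>S. {x, z} \<in> E"
proof (rule ccontr)
  assume "\<not> ?thesis"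
  then have "Y \<subseteq> (\<Union>x\<in>S. {y\<in>V. {x, y} \<notin> E})" using assms(4) by blast
  then have "card Y \<le> card (\<Union>x\<in>S. {y\<in>V. {x, y} \<notin> E})"
    by (rule card_mono[rotated]) (use assms(1) finite_host in auto)
  also have "\<dots> \<le> (\<Sum>x\<in>S. card {y\<in>V. {x, y} \<notin> E})" by (rule card_UN_le[OF assms(1)])
  also have "\<dots> \<le> card S * q"
    using sum_bounded_above[of S "\<lambda>x. card {y\<in>V. {x, y} \<notin> E}" q] card_nonadjacent assms(2) by auto
  finally show False using assms(3) by simp
qed

end

section \<open>Colourings in which all 4-cycles have positive colour product\<close>

context coloured_host
begin

text \<open>By \<open>sq\<close> the product \<open>c {x0, t} * c {x, t}\<close> does not depend on
  the common neighbour \<open>t\<close>; it is the sign of \<open>x\<close> relative to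
  \<open>x0\<close>. Then \<open>c {y, z} * s y * s z\<close> is the same for all edges: edges
  sharing a vertex are compared through \<open>sq\<close>, and any two edges are linked by a common
  neighbour. The bound on \<open>q\<close> gives every three vertices a common neighbour.\<close>

lemma signs_of_bipartite:
  assumes n: "3 * q < n"
    and sq: "\<And>x x' y z. {x, y} \<in> E \<Longrightarrow> {x', y} \<in> E \<Longrightarrow> {x, z} \<in> E \<Longrightarrow> {x', z} \<in> E \<Longrightarrow>
      c {x, y} * c {x', y} = c {x, z} * c {x', z}"
  shows "\<exists>s \<tau>. (\<forall>v. s v \<in> {-1, 1 :: int}) \<and> \<tau> \<in> {-1, 1} \<and>
    (\<forall>x y. {x, y} \<in> E \<longrightarrow> c {x, y} = \<tau> * s x * s y)"
proof -
  have common: "\<exists>t. {x, t} \<in> E \<and> {y, t} \<in> E \<and> {z, t} \<in> E" if "x \<in> V" "y \<in> V" "z \<in> V" for x y z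
  proof -
    have "card {x, y, z} * q \<le> 3 * q" by (intro mult_le_mono1) (simp add: card_insert_if)
    then have "card {x, y, z} * q < n" using n by linarith
    then show ?thesis using common_neighbour[of "{x, y, z}" V] that by auto
  qed
  obtain x0 where x0: "x0 \<in> V" using n by (metis card.empty equals0I not_less_zero)
  \<comment> \<open>The value 1 outside \<open>V\<close> keeps the range of \<open>s\<close> within
    the signs for every argument.\<close>
  define s where "s x = (if x \<in> V then let t = (SOME t. {x0, t} \<in> E \<and> {x, t} \<in> E) in c {x0, t} * c {x, t} else 1)" for x
  have s: "s x = c {x0, t} * c {x, t}" if e: "{x0, t} \<in> E" "{x, t} \<in> E" for x t
  proof -
    let ?t = "SOME t. {x0, t} \<in> E \<and> {x, t} \<in> E"
    have t: "{x0, ?t} \<in> E \<and> {x, ?t} \<in> E" 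
      by (rule someI[of "\<lambda>t. {x0, t} \<in> E \<and> {x, t} \<in> E" t]) (use e in simp)
    have "c {x0, ?t} * c {x, ?t} = c {x0, t} * c {x, t}" by (rule sq) (use t e in auto)
    moreover have "x \<in> V" using E_edge[OF e(2)] by simp
    ultimately show ?thesis by (simp add: s_def Let_def)
  qed
  have s_vals: "s x \<in> {-1, 1}" for x
  proof (cases "x \<in> V")
    case True
    obtain t where t: "{x0, t} \<in> E" "{x, t} \<in> E" using common[OF x0 True True] by blast
    show ?thesis using s[OF t] colour[OF t(1)] colour[OF t(2)] by auto
  qed (simp add: s_def)
  define d where "d y z = c {y, z} * s y * s z" for y z
  have d_sym: "d y z = d z y" for y z by (simp add: d_def insert_commute)
  have d_eq: "d y z = d y z'" if e: "{y, z} \<in> E" "{y, z'} \<in> E" for y z z'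
  proof -
    have V: "z \<in> V" "z' \<in> V" using E_edge[OF e(1)] E_edge[OF e(2)] by auto
    obtain t where t: "{x0, t} \<in> E" "{z, t} \<in> E" "{z', t} \<in> E" using common[OF x0 V] by blast
    have "c {z, t} * c {z', t} = c {z, y} * c {z', y}" using sq[of z t z' y] t e by (simp add: insert_commute)
    then have "c {z, t} * c {z', t} = c {y, z} * c {y, z'}" by (simp add: insert_commute)
    then show ?thesis
      using s[OF t(1,2)] s[OF t(1,3)] colour[OF t(1)] colour[OF t(2)] colour[OF t(3)]
        colour[OF e(1)] colour[OF e(2)] s_vals[of y] by (auto simp: d_def)
  qed
  have d_const: "d y z = d y' z'" if e: "{y, z} \<in> E" "{y', z'} \<in> E" for y z y' z'
  proof -
    have V: "y \<in> V" "y' \<in> V" using E_edge[OF e(1)] E_edge[OF e(2)] by auto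
    obtain t where t: "{y, t} \<in> E" "{y', t} \<in> E" using common[OF V V(2)] by blast
    have "d y z = d y t" by (rule d_eq[OF e(1) t(1)])
    also have "\<dots> = d t y" by (rule d_sym)
    also have "\<dots> = d t y'" by (rule d_eq) (use t in \<open>simp_all add: insert_commute\<close>)
    also have "\<dots> = d y' t" by (rule d_sym)
    also have "\<dots> = d y' z'" by (rule d_eq[OF t(2) e(2)])
    finally show ?thesis .
  qed
  obtain t0 where t0: "{x0, t0} \<in> E" using common[OF x0 x0 x0] by blast
  have "d x0 t0 \<in> {-1, 1}" using colour[OF t0] s_vals[of x0] s_vals[of t0] by (auto simp: d_def)
  moreover have "c {x, y} = d x0 t0 * s x * s y" if "{x, y} \<in> E" for x y
    using d_const[OF that t0] s_vals[of x] s_vals[of y] by (auto simp: d_def)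
  ultimately show ?thesis using s_vals by blast
qed

end

section \<open>Placing prescribed swaps\<close>

text \<open>Removing a heaviest element never raises the average, so one descends from
  \<open>X\<close> to size \<open>r\<close>. This will supply free vertices of small total
  degree.\<close>

lemma light_subset:
  fixes f :: "'a \<Rightarrow> nat"
  assumes "finite X" "r \<le> card X"
  shows "\<exists>R\<subseteq>X. card R = r \<and> card X * sum f R \<le> r * sum f X"
  using assms(2)
proof (induction rule: inc_induct)
  case base
  then show ?case by blast
next
  case (step r)
  then obtain R where R: "R \<subseteq> X" "card R = Suc r" "card X * sum f R \<le> Suc r * sum f X" by blast
  have fin: "finite R" "R \<noteq> {}" using R finite_subset assms(1) by auto
  have "Max (f ` R) \<in> f ` R" using fin by (intro Max_in) auto
  then obtain x where "x \<in> R" "f x = Max (f ` R)" by auto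
  then have x: "x \<in> R" "\<And>y. y \<in> R \<Longrightarrow> f y \<le> f x"
    using fin by auto
  have "sum f R \<le> Suc r * f x"
    using sum_bounded_above[of R f "f x"] x(2) R(2) by simp
  moreover have s: "sum f R = f x + sum f (R - {x})" by (rule sum.remove[OF fin(1) x(1)])
  ultimately have "sum f (R - {x}) \<le> r * f x" by simp
  then have "Suc r * sum f (R - {x}) \<le> r * sum f R" using s by (simp add: algebra_simps)
  then have "card X * (Suc r * sum f (R - {x})) \<le> card X * (r * sum f R)" by (rule mult_le_mono2)
  also have "\<dots> = r * (card X * sum f R)" by (simp add: mult_ac)
  also have "\<dots> \<le> r * (Suc r * sum f X)" by (rule mult_le_mono2[OF R(3)])
  finally have "Suc r * (card X * sum f (R - {x})) \<le> Suc r * (r * sum f X)" by (simp only: mult_ac)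
  then have "card X * sum f (R - {x}) \<le> r * sum f X" by (simp only: Suc_mult_le_cancel1)
  moreover have "card (R - {x}) = r" using R(2) x(1) fin by simp
  moreover have "R - {x} \<subseteq> X" using R(1) by blast
  ultimately show ?case by blast
qed

text \<open>Either there are \<open>j\<close> fours, or fewer than \<open>J\<close> fours, and then
  more than \<open>2 * J\<close> of the elements are twos.\<close>

lemma subset_sum_2_4:
  fixes g :: "'a \<Rightarrow> int"
  assumes "finite Q" "\<And>p. p \<in> Q \<Longrightarrow> g p \<in> {2, 4}" "3 * J \<le> card Q" "j \<le> J"
  shows "\<exists>Q'\<subseteq>Q. sum g Q' = 4 * int j"
proof -
  have split: "card Q = card {p\<in>Q. g p = 4} + card {p\<in>Q. g p = 2}"
  proof -
    have "Q = {p\<in>Q. g p = 4} \<union> {p\<in>Q. g p = 2}" using assms(2) by auto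
    then have "card Q = card ({p\<in>Q. g p = 4} \<union> {p\<in>Q. g p = 2})" by (rule arg_cong)
    also have "\<dots> = card {p\<in>Q. g p = 4} + card {p\<in>Q. g p = 2}"
      by (rule card_Un_disjoint) (use assms(1) in auto)
    finally show ?thesis .
  qed
  show ?thesis
  proof (cases "j \<le> card {p\<in>Q. g p = 4}")
    case True
    then obtain Q' where "Q' \<subseteq> {p\<in>Q. g p = 4}" "card Q' = j" by (metis obtain_subset_with_card_n)
    moreover then have "sum g Q' = (\<Sum>p\<in>Q'. 4)" by (intro sum.cong) auto
    ultimately show ?thesis by (intro exI[of _ Q']) auto
  next
    case False
    then have "2 * j \<le> card {p\<in>Q. g p = 2}" using split assms(3,4) by linarith
    then obtain Q' where "Q' \<subseteq> {p\<in>Q. g p = 2}" "card Q' = 2 * j" by (metis obtain_subset_with_card_n)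
    moreover then have "sum g Q' = (\<Sum>p\<in>Q'. 2)" by (intro sum.cong) auto
    ultimately show ?thesis by (intro exI[of _ Q']) auto
  qed
qed

context host
begin

text \<open>When a vertex of \<open>B\<close> is placed, at most \<open>card A + card B\<close>
  places are taken and each rules out at most \<open>q\<close> candidates. Adjacency to all taken
  places yields injectivity at once, since no vertex is adjacent to itself.\<close>

lemma greedy_extension:
  assumes "finite B" "A \<subseteq> V" "B \<subseteq> V - A" "inj_on s A" "s ` A \<subseteq> V"
    and Y: "\<And>v. v \<in> B \<Longrightarrow> Y v \<subseteq> V \<and> (card A + card B) * q < card (Y v)"
  shows "\<exists>s'. agree_on A s' s \<and> inj_on s' (A \<union> B) \<and> s' ` (A \<union> B) \<subseteq> V \<and> (\<forall>v\<in>B. s' v \<in> Y v) \<and>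
    (\<forall>v\<in>B. \<forall>z\<in>A \<union> B. z \<noteq> v \<longrightarrow> {s' v, s' z} \<in> E)"
  using assms(1,3) Y
proof (induction B rule: finite_induct)
  case empty
  then show ?case using assms(4,5) by (intro exI[of _ s]) simp
next
  case (insert v B)
  have le: "(card A + card B) * q \<le> (card A + card (insert v B)) * q"
    using insert.hyps by (intro mult_le_mono1) simp
  have YB: "\<And>u. u \<in> B \<Longrightarrow> Y u \<subseteq> V \<and> (card A + card B) * q < card (Y u)"
    using insert.prems(2) le by (meson insertCI le_less_trans)
  have "B \<subseteq> V - A" using insert.prems(1) by simp
  then obtain s' where s': "agree_on A s' s" "inj_on s' (A \<union> B)" "s' ` (A \<union> B) \<subseteq> V"
    "\<forall>v\<in>B. s' v \<in> Y v" "\<forall>v\<in>B. \<forall>z\<in>A \<union> B. z \<noteq> v \<longrightarrow> {s' v, s' z} \<in> E"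
    using insert.IH[OF _ YB] by blast
  have fin: "finite (A \<union> B)" using finite_subset[OF assms(2) finite_host] insert.hyps by simp
  have v: "v \<notin> A \<union> B" using insert by auto
  have "card (s' ` (A \<union> B)) * q \<le> (card A + card B) * q"
    using card_image_le[OF fin, of s'] card_Un_le[of A B] by (intro mult_le_mono1) linarith
  moreover have "(card A + card (insert v B)) * q < card (Y v)" using insert.prems(2)[of v] by blast
  ultimately have "card (s' ` (A \<union> B)) * q < card (Y v)" using le by linarith
  then obtain z where z: "z \<in> Y v" "\<forall>x\<in>s' ` (A \<union> B). {x, z} \<in> E"
    using common_neighbour[of "s' ` (A \<union> B)" "Y v"] fin s'(3) insert.prems(2)[of v] by auto
  have zV: "z \<in> V" using z(1) insert.prems(2)[of v] by auto
  have zn: "z \<notin> s' ` (A \<union> B)" using z(2) E_irrefl by blast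
  define s2 where "s2 = s'(v := z)"
  have eq: "s2 x = s' x" if "x \<in> A \<union> B" for x using that v by (auto simp: s2_def)
  have im: "s2 ` (A \<union> B) = s' ` (A \<union> B)" using eq by (intro image_cong) auto
  have s2v: "s2 v = z" by (simp add: s2_def)
  have "agree_on A s2 s" using s'(1) eq by (auto simp: agree_on_def)
  moreover have "inj_on s2 (A \<union> insert v B)"
  proof -
    have "inj_on s2 (A \<union> B)" using s'(2) eq by (simp add: inj_on_def)
    moreover have "s2 v \<notin> s2 ` (A \<union> B)" using im zn s2v by simp
    ultimately show ?thesis unfolding Un_insert_right inj_on_insert by blast
  qed
  moreover have "s2 ` (A \<union> insert v B) \<subseteq> V"
    using im s'(3) s2v zV by auto
  moreover have "\<forall>u\<in>insert v B. s2 u \<in> Y u" using s'(4) eq z(1) s2v by auto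
  moreover have "\<forall>u\<in>insert v B. \<forall>y\<in>A \<union> insert v B. y \<noteq> u \<longrightarrow> {s2 u, s2 y} \<in> E"
  proof (intro ballI impI)
    fix u y assume uy: "u \<in> insert v B" "y \<in> A \<union> insert v B" "y \<noteq> u"
    show "{s2 u, s2 y} \<in> E"
    proof (cases "u = v \<or> y = v")
      case True
      then obtain x where x: "x \<in> A \<union> B" "{s2 u, s2 y} = {s' x, z}"
        using uy eq s2v by (metis Un_iff insertE insert_commute)
      then show ?thesis using z(2) by simp
    next
      case False
      then have "u \<in> B" "y \<in> A \<union> B" using uy by auto
      then show ?thesis using s'(5) eq uy(3) by simp
    qed
  qed
  ultimately show ?case by blast
qed

end

context guest
begin

text \<open>Stronger than \<open>apart\<close>: a neighbour belongs to a single pair, so it can be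
  placed to suit the swap of that pair.\<close>

definition far :: "('a \<times> 'a) set \<Rightarrow> bool" where
  "far Q \<longleftrightarrow> (\<forall>u v u' v'. (u, v) \<in> Q \<longrightarrow> (u', v') \<in> Q \<longrightarrow> (u, v) \<noteq> (u', v') \<longrightarrow>
    clo u v \<inter> clo u' v' = {})"

definition twins :: "'a \<Rightarrow> 'a \<Rightarrow> bool" where
  "twins u v \<longleftrightarrow> u \<in> V \<and> v \<in> V \<and> u \<noteq> v \<and> v \<notin> nbrs u \<and> nbrs u \<inter> nbrs v = {} \<and> nbrs u \<noteq> {} \<and>
    card (nbrs u) = card (nbrs v)"

definition cores :: "('a \<times> 'a) set \<Rightarrow> 'a set" where
  "cores Q = (\<Union>(u, v)\<in>Q. {u, v})"

lemma farD: "far Q \<Longrightarrow> (u, v) \<in> Q \<Longrightarrow> (u', v') \<in> Q \<Longrightarrow> x \<in> clo u v \<Longrightarrow> x \<in> clo u' v' \<Longrightarrow> (u, v) = (u', v')"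
  unfolding far_def by blast

lemma far_subset: "far Q \<Longrightarrow> Q' \<subseteq> Q \<Longrightarrow> far Q'"
  unfolding far_def by (meson subsetD)

lemma core_in_clo: "u \<in> clo u v" "v \<in> clo u v"
  by (auto simp: clo_def)

lemma far_imp_apart: "far Q \<Longrightarrow> apart Q"
  unfolding apart_def by (metis farD core_in_clo)

lemma card_cores: "finite Q \<Longrightarrow> card (cores Q) \<le> 2 * card Q"
proof -
  assume "finite Q"
  have "cores Q = fst ` Q \<union> snd ` Q" by (force simp: cores_def)
  then show ?thesis
    using card_Un_le[of "fst ` Q" "snd ` Q"] card_image_le[OF \<open>finite Q\<close>, of fst]
      card_image_le[OF \<open>finite Q\<close>, of snd] by simp
qed

end

section \<open>Swaps that turn embeddings into embeddings\<close>

locale coloured_packing = packing V F \<Delta> E q + coloured_host V E q c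
  for V :: "'a set" and F \<Delta> E q c
begin

definition switchable :: "('a \<Rightarrow> 'a) \<Rightarrow> 'a \<Rightarrow> 'a \<Rightarrow> bool" where
  "switchable \<pi> u v \<longleftrightarrow>
    (\<forall>y\<in>nbrs u - {v}. {\<pi> v, \<pi> y} \<in> E) \<and> (\<forall>y\<in>nbrs v - {u}. {\<pi> u, \<pi> y} \<in> E)"

lemma switchable_cong:
  assumes "agree_on (clo u v) \<pi> \<rho>"
  shows "switchable \<pi> u v \<longleftrightarrow> switchable \<rho> u v"
  using assms by (simp add: switchable_def agree_on_def clo_def)

lemma embedding_switch:
  assumes "embedding \<pi>" "switchable \<pi> u v" "u \<in> V" "v \<in> V" "u \<noteq> v"
  shows "embedding (\<pi> \<circ> transpose u v)"
proof -
  have \<pi>: "\<pi> permutes V" "\<And>e. e \<in> F \<Longrightarrow> \<pi> ` e \<in> E" using assms(1) by (auto simp: embedding_def bad_def)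
  have "(\<pi> \<circ> transpose u v) ` e \<in> E" if e: "e \<in> F" for e
  proof (cases "u \<in> e \<longleftrightarrow> v \<in> e")
    case True
    then show ?thesis using \<pi>(2)[OF e] by (simp only: image_comp_transpose)
  next
    case False
    show ?thesis
    proof (cases "u \<in> e")
      case True
      then obtain y where y: "e = {u, y}" "y \<noteq> u" using F_edge[OF e] card_2_obtain_other by metis
      then have "y \<in> nbrs u - {v}" using e False by (auto simp: nbrs_def)
      then show ?thesis using assms(2) y by (auto simp: switchable_def)
    next
      case f: False
      then have "v \<in> e" using False by simp
      then obtain y where y: "e = {v, y}" "y \<noteq> v" using F_edge[OF e] card_2_obtain_other by metis
      then have "y \<in> nbrs v - {u}" using e f by (auto simp: nbrs_def)
      then show ?thesis using assms(2) y by (auto simp: switchable_def)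
    qed
  qed
  moreover have "\<pi> \<circ> transpose u v permutes V"
    using permutes_compose[OF permutes_swap_id \<pi>(1)] assms by blast
  ultimately show ?thesis by (auto simp: embedding_def bad_def)
qed

lemma switch_many:
  assumes "finite Q" "apart Q" "\<And>u v. (u, v) \<in> Q \<Longrightarrow> u \<in> V \<and> v \<in> V \<and> u \<noteq> v \<and> switchable \<pi> u v"
    and "embedding \<pi>"
  shows "\<exists>\<rho>. embedding \<rho> \<and> agree_on (- cores Q) \<rho> \<pi> \<and>
    weight w \<rho> = weight w \<pi> + (\<Sum>(u, v)\<in>Q. gain w \<pi> u v)"
  using assms(1-3)
proof (induction Q rule: finite_induct)
  case empty
  then show ?case using assms(4) by (intro exI[of _ \<pi>]) simp
next
  case (insert p Q)
  obtain u v where p: "p = (u, v)" by force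
  have "apart Q" by (rule apart_subset[OF insert.prems(1)]) auto
  then obtain \<rho> where \<rho>: "embedding \<rho>" "agree_on (- cores Q) \<rho> \<pi>"
    "weight w \<rho> = weight w \<pi> + (\<Sum>(u, v)\<in>Q. gain w \<pi> u v)"
    using insert.IH[OF _ insert.prems(2)] by blast
  have uv: "u \<in> V" "v \<in> V" "u \<noteq> v" "switchable \<pi> u v" using insert.prems(2) p by auto
  have "{u', v'} \<inter> clo u v = {}" if "(u', v') \<in> Q" for u' v'
    by (rule apartD[OF insert.prems(1)]) (use that insert.hyps(2) p in auto)
  then have ag: "agree_on (clo u v) \<rho> \<pi>"
    by (intro agree_on_subset[OF \<rho>(2)]) (auto simp: cores_def)
  then have g: "gain w \<rho> u v = gain w \<pi> u v" by (rule gain_cong[OF uv(3)])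
  define \<sigma> where "\<sigma> = \<rho> \<circ> transpose u v"
  have "embedding \<sigma>" unfolding \<sigma>_def
    using embedding_switch[OF \<rho>(1) _ uv(1-3)] uv(4) switchable_cong[OF ag] by blast
  moreover have "agree_on (- cores (insert p Q)) \<sigma> \<pi>"
    using \<rho>(2) by (auto simp: agree_on_def p \<sigma>_def cores_def)
  moreover have "weight w \<sigma> = weight w \<rho> + gain w \<rho> u v" by (simp add: gain_def \<sigma>_def)
  ultimately show ?case using insert.hyps g \<rho>(3) by (intro exI[of _ \<sigma>]) (simp add: p)
qed

lemma place_cores:
  assumes "finite Q" "far Q" "\<And>u v. (u, v) \<in> Q \<Longrightarrow> u \<noteq> v \<and> clo u v \<inter> C = {}"
    and "finite C" "inj_on s C" "s ` C \<subseteq> V" "t > 0"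
    and big: "real (card C + 2 * card Q) < t"
    and split: "\<And>x. x \<in> V \<Longrightarrow> t \<le> real (card {x'\<in>V. split_pair t x x'})" and "V \<noteq> {}"
  shows "\<exists>f. agree_on C f s \<and> inj_on f (C \<union> cores Q) \<and> f ` (C \<union> cores Q) \<subseteq> V \<and>
    (\<forall>(u, v)\<in>Q. split_pair t (f u) (f v))"
  using assms(1-3) big
proof (induction Q rule: finite_induct)
  case empty
  then show ?case using assms(5,6) by (intro exI[of _ s]) (simp add: cores_def)
next
  case (insert p Q)
  obtain u v where p: "p = (u, v)" by force
  have "far Q" by (rule far_subset[OF insert.prems(1)]) auto
  have cardQ: "real (card C + 2 * card Q) < t" using insert.prems(3) insert.hyps by simp
  with \<open>far Q\<close> obtain f where f: "agree_on C f s" "inj_on f (C \<union> cores Q)" "f ` (C \<union> cores Q) \<subseteq> V"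
    "\<forall>(u, v)\<in>Q. split_pair t (f u) (f v)"
    using insert.IH[OF _ insert.prems(2) cardQ] by blast
  let ?U = "f ` (C \<union> cores Q)"
  have finU: "finite (C \<union> cores Q)" using assms(4) insert.hyps(1) by (auto simp: cores_def)
  \<comment> \<open>The 1 reserves the place chosen for \<open>u\<close>, which the place of
    \<open>v\<close> has to avoid too.\<close>
  have cU: "real (card ?U) + 1 < t"
  proof -
    have "card ?U \<le> card C + 2 * card Q"
      using card_image_le[OF finU, of f] card_Un_le[of C "cores Q"] card_cores[OF insert.hyps(1)] by linarith
    then show ?thesis using insert.prems(3) insert.hyps by simp
  qed
  have "t \<le> real (card V)"
  proof -
    obtain x where "x \<in> V" using \<open>V \<noteq> {}\<close> by blast
    have "card {x'\<in>V. split_pair t x x'} \<le> card V" by (rule card_mono) (auto simp: finite_V)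
    then show ?thesis using split[OF \<open>x \<in> V\<close>] by linarith
  qed
  have pick: "\<exists>x\<in>X. x \<notin> insert a ?U" if X: "t \<le> real (card X)" for X a
  proof (rule ccontr)
    assume "\<not> ?thesis"
    then have "X \<subseteq> insert a ?U" by blast
    then have "card X \<le> card (insert a ?U)" by (rule card_mono[rotated]) (use finU in simp)
    also have "\<dots> \<le> card ?U + 1" using finU by (simp add: card_insert_if)
    finally show False using cU X by linarith
  qed
  obtain x where x: "x \<in> V" "x \<notin> ?U" using pick[OF \<open>t \<le> real (card V)\<close>] by blast
  obtain x' where x': "x' \<in> V" "split_pair t x x'" "x' \<notin> insert x ?U"
    using pick[OF split[OF x(1)]] by blast
  have uv: "u \<noteq> v" "clo u v \<inter> C = {}" using insert.prems(2) p by auto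
  have uvn: "w \<notin> C \<union> cores Q" if "w = u \<or> w = v" for w
  proof
    assume "w \<in> C \<union> cores Q"
    moreover have "w \<in> clo u v" using that by (auto simp: clo_def)
    ultimately have "w \<in> cores Q" using uv by blast
    then obtain u' v' where "(u', v') \<in> Q" "w \<in> {u', v'}" by (auto simp: cores_def)
    moreover then have "w \<in> clo u' v'" by (auto simp: clo_def)
    ultimately show False
      using farD[OF insert.prems(1), of u v u' v' w] \<open>w \<in> clo u v\<close> p insert.hyps(2) by auto
  qed
  define g where "g = f(u := x, v := x')"
  have eq: "g w = f w" if "w \<in> C \<union> cores Q" for w using that uvn by (auto simp: g_def)
  have gu: "g u = x" "g v = x'" using uv by (auto simp: g_def)
  have im: "g ` (C \<union> cores Q) = ?U" using eq by (intro image_cong) auto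
  have cs: "C \<union> cores (insert p Q) = insert u (insert v (C \<union> cores Q))" by (auto simp: cores_def p)
  have "agree_on C g s" using f(1) eq by (auto simp: agree_on_def)
  moreover have "inj_on g (C \<union> cores (insert p Q))"
  proof -
    have "inj_on g (C \<union> cores Q)" using f(2) eq by (simp add: inj_on_def)
    moreover have "g v \<notin> g ` (C \<union> cores Q)" using im x' gu by simp
    moreover have "g u \<notin> g ` (insert v (C \<union> cores Q))" using im x x' gu by auto
    ultimately show ?thesis unfolding cs inj_on_insert by blast
  qed
  moreover have "g ` (C \<union> cores (insert p Q)) \<subseteq> V"
    unfolding cs using im f(3) gu x x' by auto
  moreover have "\<forall>(u, v)\<in>insert p Q. split_pair t (g u) (g v)"
  proof -
    have "split_pair t (g u') (g v')" if "(u', v') \<in> Q" for u' v'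
    proof -
      have "u' \<in> cores Q" "v' \<in> cores Q" using that by (auto simp: cores_def)
      then show ?thesis using eq f(4) that by auto
    qed
    then show ?thesis using gu x'(2) p by auto
  qed
  ultimately show ?case by blast
qed

end

section \<open>Fixing a bounded part that contains prescribed swaps\<close>

context guest
begin

definition halo :: "('a \<times> 'a) set \<Rightarrow> 'a set" where
  "halo Q = (\<Union>(u, v)\<in>Q. clo u v)"

lemma card_halo:
  assumes "finite Q" shows "card (halo Q) \<le> card Q * (2 * \<Delta> + 2)"
proof -
  have "card (halo Q) \<le> (\<Sum>p\<in>Q. card (case p of (u, v) \<Rightarrow> clo u v))"
    unfolding halo_def by (rule card_UN_le[OF assms])
  also have "\<dots> \<le> (\<Sum>p\<in>Q. 2 * \<Delta> + 2)"
    by (rule sum_mono) (use card_clo in auto)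
  finally show ?thesis by simp
qed

text \<open>The swaps of \<open>move\<close> without its repairs; \<open>anchor\<close> repairs all
  broken edges together afterwards.\<close>

lemma align:
  assumes "\<rho> permutes V" "s permutes V" "finite A" "A \<subseteq> V"
  shows "\<exists>\<rho>' S. \<rho>' permutes V \<and> agree_on A \<rho>' s \<and> finite S \<and> card S \<le> 2 * card A \<and> agree_on (- S) \<rho>' \<rho>"
  using assms(3,4)
proof (induction A rule: finite_induct)
  case empty
  then show ?case using assms(1) by (intro exI[of _ \<rho>] exI[of _ "{}"]) (simp add: agree_on_def)
next
  case (insert v A)
  then obtain \<rho>' S where \<rho>': "\<rho>' permutes V" "agree_on A \<rho>' s" "finite S" "card S \<le> 2 * card A"
    "agree_on (- S) \<rho>' \<rho>" by auto
  obtain w where w: "\<rho>' w = s v" using permutes_surj[OF \<rho>'(1)] by (metis surjD)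
  have v: "v \<in> V" "v \<notin> A" using insert by auto
  have wV: "w \<in> V" using w v permutes_in_image[OF \<rho>'(1)] permutes_in_image[OF assms(2)] by metis
  have wA: "w \<notin> A"
  proof
    assume "w \<in> A"
    then have "s w = s v" using \<rho>'(2) w by (simp add: agree_on_def)
    then have "w = v" using permutes_inj[OF assms(2)] by (simp add: inj_eq)
    then show False using v \<open>w \<in> A\<close> by simp
  qed
  define \<sigma> where "\<sigma> = \<rho>' \<circ> transpose v w"
  have "\<sigma> permutes V" unfolding \<sigma>_def using permutes_compose[OF permutes_swap_id \<rho>'(1)] v wV by blast
  moreover have "agree_on A \<sigma> \<rho>'" unfolding \<sigma>_def by (rule agree_on_transpose[OF v(2) wA])
  then have "agree_on (insert v A) \<sigma> s" using \<rho>'(2) w by (simp add: agree_on_def \<sigma>_def)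
  moreover have "agree_on (- (S \<union> {v, w})) \<sigma> \<rho>" using \<rho>'(5) by (auto simp: agree_on_def \<sigma>_def)
  moreover have "card (S \<union> {v, w}) \<le> 2 * card (insert v A)"
    using card_Un_le[of S "{v, w}"] \<rho>'(4) insert.hyps card_insert_le_m1[of 2 "{w}" v] by simp
  moreover have "finite (S \<union> {v, w})" using \<rho>'(3) by simp
  ultimately show ?case by blast
qed

end

context coloured_packing
begin

text \<open>The vertices of a pair go to a split pair of places with difference values
  \<open>lo\<close> and \<open>hi\<close>, where \<open>lo\<close> is the smaller. One neighbour
  \<open>sp\<close> of \<open>u\<close> is placed in the fibre of \<open>hi\<close>, all other
  neighbours of \<open>u\<close> and \<open>v\<close> in that of \<open>lo\<close>. The degrees
  being equal, the contributions of \<open>lo\<close> cancel and the gain is \<open>hi - lo\<close>,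
  a positive difference of two numbers from -2, 0, 2.\<close>

lemma prepare:
  assumes Q: "finite Q" "far Q" "\<And>u v. (u, v) \<in> Q \<Longrightarrow> twins u v \<and> clo u v \<inter> C = {}"
    and C: "C \<subseteq> V" and s: "s permutes V" "\<And>e. e \<in> F \<Longrightarrow> e \<subseteq> C \<Longrightarrow> s ` e \<in> E"
    and t: "t > 0" "real (card C + 2 * card Q) < t" "real ((card C + card Q * (2 * \<Delta> + 2)) * q) < t"
    and split: "\<And>x. x \<in> V \<Longrightarrow> t \<le> real (card {x'\<in>V. split_pair t x x'})" and "V \<noteq> {}"
  shows "\<exists>s'. s' permutes V \<and> agree_on C s' s \<and> (\<forall>e\<in>F. e \<subseteq> C \<union> halo Q \<longrightarrow> s' ` e \<in> E) \<and>
    (\<forall>u v. (u, v) \<in> Q \<longrightarrow> switchable s' u v \<and> gain c s' u v \<in> {2, 4})"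
proof -
  have finC: "finite C" using finite_subset[OF C finite_V] .
  have tw: "u \<in> V" "v \<in> V" "u \<noteq> v" "v \<notin> nbrs u" "u \<notin> nbrs v" "nbrs u \<inter> nbrs v = {}" "nbrs u \<noteq> {}"
    "card (nbrs u) = card (nbrs v)" "clo u v \<inter> C = {}" if "(u, v) \<in> Q" for u v
    using Q(3)[OF that] nbrs_sym[of u v] by (auto simp: twins_def)
  obtain f where f: "agree_on C f s" "inj_on f (C \<union> cores Q)" "f ` (C \<union> cores Q) \<subseteq> V"
    "\<forall>(u, v)\<in>Q. split_pair t (f u) (f v)"
  proof -
    have "s ` C \<subseteq> V" using image_mono[OF C, of s] permutes_image[OF s(1)] by simp
    moreover have "\<And>u v. (u, v) \<in> Q \<Longrightarrow> u \<noteq> v \<and> clo u v \<inter> C = {}" using tw(3,9) by simp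
    ultimately show ?thesis
      using place_cores[OF Q(1,2) _ finC permutes_inj_on[OF s(1)] _ t(1,2) split \<open>V \<noteq> {}\<close>] that
      by meson
  qed
  have "\<forall>p\<in>Q. \<exists>h l y. l < h \<and> t \<le> real (card (fibre (f (fst p)) (f (snd p)) h)) \<and>
    t \<le> real (card (fibre (f (fst p)) (f (snd p)) l)) \<and> y \<in> nbrs (fst p)"
  proof
    fix p assume "p \<in> Q"
    then have "split_pair t (f (fst p)) (f (snd p))" "nbrs (fst p) \<noteq> {}"
      using f(4) tw(7)[of "fst p" "snd p"] by auto
    then obtain a b y where "a \<noteq> b" "t \<le> real (card (fibre (f (fst p)) (f (snd p)) a))"
      "t \<le> real (card (fibre (f (fst p)) (f (snd p)) b))" "y \<in> nbrs (fst p)"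
      unfolding split_pair_def by blast
    then show "\<exists>h l y. l < h \<and> t \<le> real (card (fibre (f (fst p)) (f (snd p)) h)) \<and>
      t \<le> real (card (fibre (f (fst p)) (f (snd p)) l)) \<and> y \<in> nbrs (fst p)"
      by (cases "a < b") (metis, metis linorder_neqE)
  qed
  then obtain hi lo sp where hl: "\<And>p. p \<in> Q \<Longrightarrow> lo p < hi p"
    "\<And>p. p \<in> Q \<Longrightarrow> t \<le> real (card (fibre (f (fst p)) (f (snd p)) (hi p)))"
    "\<And>p. p \<in> Q \<Longrightarrow> t \<le> real (card (fibre (f (fst p)) (f (snd p)) (lo p)))"
    "\<And>p. p \<in> Q \<Longrightarrow> sp p \<in> nbrs (fst p)" by metis
  define B where "B = (\<Union>(u, v)\<in>Q. nbrs u \<union> nbrs v)"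
  have halo: "halo Q = cores Q \<union> B" by (auto simp: halo_def cores_def B_def clo_def)
  have "\<forall>y\<in>B. \<exists>p\<in>Q. y \<in> nbrs (fst p) \<union> nbrs (snd p)" by (force simp: B_def)
  \<comment> \<open>\<open>ow y\<close> is the pair that \<open>y\<close> is a neighbour of, unique
    because \<open>Q\<close> is far.\<close>
  then obtain ow where ow: "\<And>y. y \<in> B \<Longrightarrow> ow y \<in> Q" "\<And>y. y \<in> B \<Longrightarrow> y \<in> nbrs (fst (ow y)) \<union> nbrs (snd (ow y))"
    by metis
  have ow_eq: "ow y = (u, v)" if p: "(u, v) \<in> Q" "y \<in> nbrs u \<union> nbrs v" for y u v
  proof -
    have y: "y \<in> B" using p by (auto simp: B_def)
    have "(fst (ow y), snd (ow y)) = (u, v)"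
    proof (rule farD[OF Q(2) _ p(1)])
      show "y \<in> clo u v" using p(2) by (auto simp: clo_def)
      show "y \<in> clo (fst (ow y)) (snd (ow y))" using ow(2)[OF y] by (auto simp: clo_def)
      show "(fst (ow y), snd (ow y)) \<in> Q" using ow(1)[OF y] by simp
    qed
    then show ?thesis by simp
  qed
  define Y where "Y y = fibre (f (fst (ow y))) (f (snd (ow y))) (if y = sp (ow y) then hi (ow y) else lo (ow y))" for y
  have B_disj: "B \<inter> (C \<union> cores Q) = {}"
  proof (rule ccontr)
    assume "\<not> ?thesis"
    then obtain y where y: "y \<in> B" "y \<in> C \<union> cores Q" by blast
    then obtain u v where uv: "(u, v) \<in> Q" "y \<in> nbrs u \<union> nbrs v" by (auto simp: B_def)
    have yc: "y \<in> clo u v" using uv(2) by (auto simp: clo_def)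
    then have "y \<notin> C" using tw(9)[OF uv(1)] by blast
    then obtain u' v' where uv': "(u', v') \<in> Q" "y \<in> {u', v'}" using y(2) by (auto simp: cores_def)
    then have "y \<in> clo u' v'" by (auto simp: clo_def)
    then have "(u, v) = (u', v')" by (rule farD[OF Q(2) uv(1) uv'(1) yc])
    then show False using uv(2) uv'(2) tw(4,5)[OF uv(1)] nbrs_irrefl by auto
  qed
  have coresV: "cores Q \<subseteq> V" using tw(1,2) by (auto simp: cores_def)
  have BV: "B \<subseteq> V - (C \<union> cores Q)" using B_disj subsetD[OF nbrs_subset] by (auto simp: B_def)
  have finB: "finite B" using Q(1) by (auto simp: B_def)
  have finc: "finite (cores Q)" using Q(1) by (auto simp: cores_def)
  have sz: "card (C \<union> cores Q) + card B \<le> card C + card Q * (2 * \<Delta> + 2)"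
  proof -
    have "card (halo Q) = card (cores Q) + card B"
      unfolding halo by (rule card_Un_disjoint) (use B_disj finB finc in auto)
    then show ?thesis using card_halo[OF Q(1)] card_Un_le[of C "cores Q"] by linarith
  qed
  have Y: "Y y \<subseteq> V \<and> (card (C \<union> cores Q) + card B) * q < card (Y y)" if "y \<in> B" for y
  proof -
    have "real ((card (C \<union> cores Q) + card B) * q) \<le> real ((card C + card Q * (2 * \<Delta> + 2)) * q)"
      using sz by (intro of_nat_mono mult_le_mono1)
    also have "\<dots> < t" by (rule t(3))
    also have "t \<le> real (card (Y y))" unfolding Y_def using hl(2,3) ow(1)[OF that] by simp
    finally have "(card (C \<union> cores Q) + card B) * q < card (Y y)" by (simp only: of_nat_less_iff)
    moreover have "Y y \<subseteq> V" by (auto simp: Y_def fibre_def)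
    ultimately show ?thesis by simp
  qed
  have "\<exists>s'. agree_on (C \<union> cores Q) s' f \<and> inj_on s' (C \<union> cores Q \<union> B) \<and> s' ` (C \<union> cores Q \<union> B) \<subseteq> V \<and>
    (\<forall>v\<in>B. s' v \<in> Y v) \<and> (\<forall>v\<in>B. \<forall>z\<in>C \<union> cores Q \<union> B. z \<noteq> v \<longrightarrow> {s' v, s' z} \<in> E)"
    by (rule greedy_extension[OF finB _ BV f(2,3) Y]) (use C coresV in auto)
  then obtain s1 where s1: "agree_on (C \<union> cores Q) s1 f" "inj_on s1 (C \<union> cores Q \<union> B)"
    "s1 ` (C \<union> cores Q \<union> B) \<subseteq> V" "\<forall>v\<in>B. s1 v \<in> Y v"
    "\<forall>v\<in>B. \<forall>z\<in>C \<union> cores Q \<union> B. z \<noteq> v \<longrightarrow> {s1 v, s1 z} \<in> E" by blast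
  have "C \<union> cores Q \<union> B \<subseteq> V" using C coresV BV by auto
  then obtain s' where s': "s' permutes V" "agree_on (C \<union> cores Q \<union> B) s' s1"
    using extend_to_permutation[OF finite_V _ s1(2,3)] by blast
  have s'f: "s' x = f x" if "x \<in> C \<union> cores Q" for x
    using that s'(2) s1(1) by (auto simp: agree_on_def)
  have s'Y: "s' y \<in> Y y" if "y \<in> B" for y using that s'(2) s1(4) by (auto simp: agree_on_def)
  have s'E: "{s' y, s' z} \<in> E" if "y \<in> B" "z \<in> C \<union> cores Q \<union> B" "z \<noteq> y" for y z
    using that s'(2) s1(5) by (auto simp: agree_on_def)
  have "agree_on C s' s" using f(1) s'f by (auto simp: agree_on_def)
  moreover have "s' ` e \<in> E" if e: "e \<in> F" "e \<subseteq> C \<union> halo Q" for e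
  proof (cases "e \<inter> B = {}")
    case False
    then obtain y where "y \<in> e" "y \<in> B" by blast
    moreover then obtain z where "e = {y, z}" "z \<noteq> y" using F_edge[OF e(1)] card_2_obtain_other by metis
    ultimately show ?thesis using s'E[of y z] e(2) halo by auto
  next
    case True
    have "e \<inter> cores Q = {}"
    proof (rule ccontr)
      assume "\<not> ?thesis"
      then obtain u v w where uv: "(u, v) \<in> Q" "w \<in> {u, v}" "w \<in> e" by (auto simp: cores_def)
      then obtain z where z: "e = {w, z}" using F_edge[OF e(1)] card_2_obtain_other by metis
      then have "z \<in> nbrs w" using e(1) by (simp add: nbrs_def)
      then have "z \<in> B" using uv by (auto simp: B_def)
      then show False using True z by auto
    qed
    then have "e \<subseteq> C" using True e(2) halo by auto
    then have "s' ` e = s ` e" by (rule agree_on_image[OF \<open>agree_on C s' s\<close>])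
    then show ?thesis using s(2)[OF e(1) \<open>e \<subseteq> C\<close>] by simp
  qed
  moreover have "switchable s' u v \<and> gain c s' u v \<in> {2, 4}" if p: "(u, v) \<in> Q" for u v
  proof -
    let ?p = "(u, v)"
    note twp = tw[OF p]
    have uvf: "s' u = f u" "s' v = f v" using s'f p by (auto simp: cores_def)
    have in_fib: "s' y \<in> fibre (s' u) (s' v) (if y = sp ?p then hi ?p else lo ?p)"
      if "y \<in> nbrs u \<union> nbrs v" for y
    proof -
      have "y \<in> B" using p that by (auto simp: B_def)
      moreover have "Y y = fibre (f u) (f v) (if y = sp ?p then hi ?p else lo ?p)"
        unfolding Y_def ow_eq[OF p that] by simp
      ultimately show ?thesis using s'Y[of y] uvf by simp
    qed
    have "switchable s' u v"
      unfolding switchable_def using in_fib by (auto simp: fibre_def)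
    moreover have "gain c s' u v = hi ?p - lo ?p"
    proof -
      have sp: "sp ?p \<in> nbrs u" "sp ?p \<notin> nbrs v" using hl(4)[OF p] twp(6) by auto
      have D: "c {s' v, s' y} - c {s' u, s' y} = (if y = sp ?p then hi ?p else lo ?p)"
        if "y \<in> nbrs u \<union> nbrs v" for y using in_fib[OF that] by (simp add: fibre_def)
      have D': "c {s' u, s' y} - c {s' v, s' y} = - lo ?p" if y: "y \<in> nbrs v" for y
      proof -
        have "y \<noteq> sp ?p" using y sp(2) by auto
        then have "c {s' v, s' y} - c {s' u, s' y} = lo ?p" using D[of y] y by simp
        then show ?thesis by linarith
      qed
      have "gain c s' u v = (\<Sum>y\<in>nbrs u. if y = sp ?p then hi ?p else lo ?p) + (\<Sum>y\<in>nbrs v. - lo ?p)"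
        unfolding gain_eq[OF twp(3)] using twp(4,5) D D'
        by (intro arg_cong2[where f = "(+)"] sum.cong) auto
      also have "(\<Sum>y\<in>nbrs u. if y = sp ?p then hi ?p else lo ?p) =
          hi ?p + (\<Sum>y\<in>nbrs u - {sp ?p}. if y = sp ?p then hi ?p else lo ?p)"
        by (subst sum.remove[OF finite_nbrs sp(1)]) simp
      also have "(\<Sum>y\<in>nbrs u - {sp ?p}. if y = sp ?p then hi ?p else lo ?p) = (\<Sum>y\<in>nbrs u - {sp ?p}. lo ?p)"
        by (rule sum.cong) auto
      also have "\<dots> = (int (card (nbrs v)) - 1) * lo ?p"
        using sp(1) twp(8) card_gt_0_iff[of "nbrs u"] by (auto simp: of_nat_diff)
      finally show ?thesis by (simp add: algebra_simps)
    qed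
    moreover have "hi ?p - lo ?p \<in> {2, 4}"
    proof -
      have ne: "fibre (f u) (f v) (hi ?p) \<noteq> {}" "fibre (f u) (f v) (lo ?p) \<noteq> {}"
        using hl(2,3)[OF p] t(1) by auto
      then have "hi ?p \<in> {-2, 0, 2}" "lo ?p \<in> {-2, 0, 2}" using fibre_values by blast+
      then show ?thesis using hl(1)[OF p] by auto
    qed
    ultimately show ?thesis by simp
  qed
  ultimately show ?thesis using s'(1) by blast
qed

text \<open>\<open>c\<close> is arbitrary off \<open>E\<close>, while the bounds on weight
  differences need values bounded everywhere. Extension by 0 provides this and leaves the weight of
  embeddings unchanged.\<close>

definition masked :: "('a set \<Rightarrow> int) \<Rightarrow> 'a set \<Rightarrow> int" where
  "masked w e = (if e \<in> E then w e else 0)"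

text \<open>The penalty \<open>4 \<Delta>\<close> pays for the repair of a bad edge, which moves two vertices and hence
  changes the colours of at most \<open>2 \<Delta>\<close> edges by at most 2 each.\<close>

definition penalised :: "('a set \<Rightarrow> int) \<Rightarrow> 'a set \<Rightarrow> int" where
  "penalised w e = (if e \<in> E then w e else - 4 * int \<Delta>)"

lemma weight_masked: "embedding \<pi> \<Longrightarrow> weight (masked w) \<pi> = weight w \<pi>"
  unfolding weight_def by (rule sum.cong) (auto simp: embedding_def bad_def masked_def)

lemma weight_penalised: "weight (penalised w) \<pi> = weight (masked w) \<pi> - 4 * int \<Delta> * int (card (bad \<pi>))"
proof -
  have "weight (penalised w) \<pi> = (\<Sum>e\<in>F. masked w (\<pi> ` e) - (if e \<in> bad \<pi> then 4 * int \<Delta> else 0))"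
    unfolding weight_def by (rule sum.cong) (auto simp: bad_def masked_def penalised_def)
  also have "\<dots> = weight (masked w) \<pi> - (\<Sum>e\<in>F. if e \<in> bad \<pi> then 4 * int \<Delta> else 0)"
    by (simp add: weight_def sum_subtractf)
  also have "(\<Sum>e\<in>F. if e \<in> bad \<pi> then 4 * int \<Delta> else 0) = (\<Sum>e\<in>bad \<pi>. 4 * int \<Delta>)"
    using finite_F by (intro sum.mono_neutral_cong_right) (auto simp: bad_def)
  finally show ?thesis by simp
qed

text \<open>Aligning moves at most \<open>2 * card A\<close> vertices, which accounts for the loss
  in the conclusion. The repairs cost nothing on balance: each of them loses at most
  \<open>4 * \<Delta>\<close> of masked weight, which the penalty on its bad edge has already
  charged.\<close>

lemma anchor:
  assumes \<rho>: "\<rho> permutes V" and s: "s permutes V" "\<And>e. e \<in> F \<Longrightarrow> e \<subseteq> A \<Longrightarrow> s ` e \<in> E"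
    and A: "A \<subseteq> V" "2 * \<Delta> * q < card (V - A)"
    and w: "\<And>e. e \<in> E \<Longrightarrow> w e \<in> {-1, 1}" and "\<Delta> \<ge> 1"
  shows "\<exists>\<psi>. embedding \<psi> \<and> agree_on A \<psi> s \<and>
    weight w \<psi> \<ge> weight (penalised w) \<rho> - 16 * int \<Delta> * int (card A * \<Delta>)"
proof -
  have finA: "finite A" using finite_subset[OF A(1) finite_V] .
  obtain \<rho>' S where \<rho>': "\<rho>' permutes V" "agree_on A \<rho>' s" "finite S" "card S \<le> 2 * card A" "agree_on (- S) \<rho>' \<rho>"
    using align[OF \<rho> s(1) finA A(1)] by blast
  have pb: "\<bar>penalised w e\<bar> \<le> 4 * int \<Delta>" for e
    using w[of e] assms(7) by (auto simp: penalised_def)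
  have mb: "\<bar>masked w e\<bar> \<le> 1" for e using w[of e] by (auto simp: masked_def)
  have "\<bar>weight (penalised w) \<rho>' - weight (penalised w) \<rho>\<bar> \<le> 2 * (4 * int \<Delta>) * int (2 * card A * \<Delta>)"
    by (rule weight_diff_bound_card[where w = "penalised w" and L = "4 * int \<Delta>", OF pb \<rho>'(3) _ \<rho>'(4)])
      (use \<rho>'(5) in \<open>auto simp: agree_on_def\<close>)
  then have 1: "weight (penalised w) \<rho>' \<ge> weight (penalised w) \<rho> - 16 * int \<Delta> * int (card A * \<Delta>)"
    by (simp add: algebra_simps)
  have "\<not> e \<subseteq> A" if "e \<in> bad \<rho>'" for e
  proof
    assume "e \<subseteq> A"
    then have "\<rho>' ` e = s ` e" by (rule agree_on_image[OF \<rho>'(2)])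
    then show False using s(2)[of e] \<open>e \<subseteq> A\<close> that by (simp add: bad_def)
  qed
  then obtain \<psi> T where \<psi>: "embedding \<psi>" "finite T" "card T \<le> 2 * card (bad \<rho>')" "T \<inter> A = {}" "agree_on (- T) \<psi> \<rho>'"
    using repair[OF \<rho>'(1) A] by blast
  have "\<bar>weight (masked w) \<psi> - weight (masked w) \<rho>'\<bar> \<le> 2 * 1 * int (2 * card (bad \<rho>') * \<Delta>)"
    by (rule weight_diff_bound_card[where w = "masked w" and L = 1, OF mb \<psi>(2) _ \<psi>(3)])
      (use \<psi>(5) in \<open>auto simp: agree_on_def\<close>)
  then have "weight (masked w) \<psi> \<ge> weight (penalised w) \<rho>'"
    unfolding weight_penalised by (simp add: algebra_simps)
  then have "weight w \<psi> \<ge> weight (penalised w) \<rho>'" using weight_masked[OF \<psi>(1)] by simp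
  moreover have "agree_on A \<psi> s"
    using \<psi>(4,5) \<rho>'(2) unfolding agree_on_def by (metis ComplI disjoint_iff)
  ultimately show ?thesis using 1 \<psi>(1) by (intro exI[of _ \<psi>]) linarith
qed

text \<open>Both extreme embeddings are anchored to the same \<open>s'\<close> on \<open>A\<close>,
  so the chain between them leaves the prepared swaps and their gains intact. \<open>S\<close>
  bounds the total degree of the vertices left free at the end of the chain; the margin for
  \<open>k\<close> pays for anchoring and for this freedom.\<close>

lemma flexible_embeddings:
  fixes T :: int and k :: int
  assumes Q: "finite Q" "far Q" "\<And>u v. (u, v) \<in> Q \<Longrightarrow> twins u v \<and> clo u v \<inter> C = {}"
    and C: "C \<subseteq> V" and s: "s permutes V" "\<And>e. e \<in> F \<Longrightarrow> e \<subseteq> C \<Longrightarrow> s ` e \<in> E"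
    and t: "t > 0" "real (card C + 2 * card Q) < t" "real ((card C + card Q * (2 * \<Delta> + 2)) * q) < t"
    and split: "\<And>x. x \<in> V \<Longrightarrow> t \<le> real (card {x'\<in>V. split_pair t x x'})" and "V \<noteq> {}"
    and "\<Delta> \<ge> 1" and J: "3 * J \<le> card Q"
    and \<rho>1: "\<rho>1 permutes V" "weight (penalised c) \<rho>1 \<ge> T"
    and \<rho>2: "\<rho>2 permutes V" "weight (penalised (\<lambda>e. - c e)) \<rho>2 \<ge> T"
    and Z: "card C + card Q * (2 * \<Delta> + 2) \<le> Z" "2 * \<Delta> * q + 1 + Z \<le> card V"
    and S: "(2 * \<Delta> * q + 1) * (2 * card F) \<le> S * (card V - Z)"
    and k: "\<bar>k\<bar> < T - 16 * int \<Delta> * int (Z * \<Delta>) - 2 * int S"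
  shows "\<exists>\<pi>0. embedding \<pi>0 \<and> agree_on C \<pi>0 s \<and> weight c \<pi>0 \<le> k \<and>
    k - 2 * int ((4 * \<Delta> + 2) * \<Delta>) \<le> weight c \<pi>0 \<and>
    (\<forall>j\<le>J. \<exists>\<pi>. embedding \<pi> \<and> agree_on C \<pi> s \<and> weight c \<pi> = weight c \<pi>0 + 4 * int j)"
proof -
  obtain s' where s': "s' permutes V" "agree_on C s' s" "\<And>e. e \<in> F \<Longrightarrow> e \<subseteq> C \<union> halo Q \<Longrightarrow> s' ` e \<in> E"
    "\<And>u v. (u, v) \<in> Q \<Longrightarrow> switchable s' u v \<and> gain c s' u v \<in> {2, 4}"
    using prepare[OF Q C s t split \<open>V \<noteq> {}\<close>] by blast
  define A where "A = C \<union> halo Q"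
  have tw: "u \<in> V" "v \<in> V" "u \<noteq> v" if "(u, v) \<in> Q" for u v using Q(3)[OF that] by (auto simp: twins_def)
  have "halo Q \<subseteq> V" using tw subsetD[OF nbrs_subset] by (auto simp: halo_def clo_def)
  then have AV: "A \<subseteq> V" using C by (auto simp: A_def)
  have finA: "finite A" using finite_subset[OF AV finite_V] .
  have cA: "card A \<le> Z" using card_Un_le[of C "halo Q"] card_halo[OF Q(1)] Z(1) by (simp add: A_def)
  have cVA: "card (V - A) = card V - card A" by (rule card_Diff_subset[OF finA AV])
  have big: "2 * \<Delta> * q < card (V - A)" using cVA cA Z(2) by linarith
  have s'A: "\<And>e. e \<in> F \<Longrightarrow> e \<subseteq> A \<Longrightarrow> s' ` e \<in> E" using s'(3) by (simp add: A_def)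
  have AZ: "16 * int \<Delta> * int (card A * \<Delta>) \<le> 16 * int \<Delta> * int (Z * \<Delta>)"
    using cA by (intro mult_left_mono) (simp_all add: mult_right_mono)
  obtain \<psi>1 where \<psi>1: "embedding \<psi>1" "agree_on A \<psi>1 s'" "weight c \<psi>1 \<ge> T - 16 * int \<Delta> * int (Z * \<Delta>)"
    using anchor[OF \<rho>1(1) s'(1) s'A AV big, of c] colour \<open>\<Delta> \<ge> 1\<close> \<rho>1(2) AZ by (smt (verit))
  have neg: "weight (\<lambda>e. - c e) \<pi> = - weight c \<pi>" for \<pi> by (simp add: weight_def sum_negf)
  have colour': "- c e \<in> {-1, 1}" if "e \<in> E" for e using colour[OF that] by auto
  obtain \<psi>2 where \<psi>2: "embedding \<psi>2" "agree_on A \<psi>2 s'" "- weight c \<psi>2 \<ge> T - 16 * int \<Delta> * int (Z * \<Delta>)"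
    using anchor[OF \<rho>2(1) s'(1) s'A AV big, of "\<lambda>e. - c e"] colour' \<open>\<Delta> \<ge> 1\<close> \<rho>2(2) AZ
    unfolding neg by (smt (verit))
  \<comment> \<open>Just enough vertices for \<open>repair\<close> stay free, and light ones, so
    that they hardly influence the weight.\<close>
  obtain R where R: "R \<subseteq> V - A" "card R = 2 * \<Delta> * q + 1"
    "card (V - A) * (\<Sum>v\<in>R. card (nbrs v)) \<le> (2 * \<Delta> * q + 1) * (\<Sum>v\<in>V - A. card (nbrs v))"
    using light_subset[of "V - A" "2 * \<Delta> * q + 1" "\<lambda>v. card (nbrs v)"] finite_V big by auto
  have RS: "(\<Sum>v\<in>R. card (nbrs v)) \<le> S"
  proof -
    have "(\<Sum>v\<in>V - A. card (nbrs v)) \<le> 2 * card F"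
      using sum_mono2[OF finite_V, of "V - A" "\<lambda>v. card (nbrs v)"] sum_card_nbrs by simp
    then have "(2 * \<Delta> * q + 1) * (\<Sum>v\<in>V - A. card (nbrs v)) \<le> (2 * \<Delta> * q + 1) * (2 * card F)"
      by (rule mult_le_mono2)
    then have "card (V - A) * (\<Sum>v\<in>R. card (nbrs v)) \<le> S * (card V - Z)" using R(3) S by linarith
    also have "S * (card V - Z) \<le> S * card (V - A)"
      by (rule mult_le_mono2) (use cVA cA in linarith)
    also have "\<dots> = card (V - A) * S" by (rule mult.commute)
    finally show ?thesis using big by simp
  qed
  define A' where "A' = V - R"
  have A': "A \<subseteq> A'" "A' \<subseteq> V" "V - A' = R" using AV R(1) by (auto simp: A'_def)
  have finR: "finite R" using finite_subset[OF R(1)] finite_V by simp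
  have mb: "\<bar>masked c e\<bar> \<le> 1" for e using colour[of e] by (auto simp: masked_def)
  have "\<exists>\<chi>. embedding \<chi> \<and> agree_on A \<chi> \<psi>1 \<and> weight (masked c) \<chi> \<le> k \<and>
    k - 2 * int ((4 * \<Delta> + 2) * \<Delta>) \<le> weight (masked c) \<chi>"
  proof (rule chain[OF \<psi>1(1) A'(2) _ mb \<psi>2(1) A'(1)])
    show "2 * \<Delta> * q < card (V - A')" using A'(3) R(2) by simp
    show "agree_on A \<psi>2 \<psi>1" by (rule agree_on_trans[OF \<psi>2(2) agree_on_sym[OF \<psi>1(2)]])
    show "weight (masked c) \<psi>2 \<le> k" using \<psi>2(3) weight_masked[OF \<psi>2(1), of c] k by linarith
    fix \<chi> assume \<chi>: "embedding \<chi>" "agree_on A' \<chi> \<psi>1"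
    have "\<bar>weight (masked c) \<chi> - weight (masked c) \<psi>1\<bar> \<le> 2 * 1 * int (\<Sum>v\<in>R. card (nbrs v))"
      by (rule weight_diff_bound[where w = "masked c" and L = 1, OF mb finR]) (use \<chi>(2) in \<open>simp add: A'_def\<close>)
    then show "k < weight (masked c) \<chi>"
      using RS \<psi>1(3) weight_masked[OF \<psi>1(1), of c] k by linarith
  qed
  then obtain \<chi> where \<chi>: "embedding \<chi>" "agree_on A \<chi> \<psi>1" "weight c \<chi> \<le> k"
    "k - 2 * int ((4 * \<Delta> + 2) * \<Delta>) \<le> weight c \<chi>" using weight_masked by auto
  have \<chi>s': "agree_on A \<chi> s'" by (rule agree_on_trans[OF \<chi>(2) \<psi>1(2)])
  have \<chi>s: "agree_on C \<chi> s"
    by (rule agree_on_trans[OF agree_on_subset[OF \<chi>s'] s'(2)]) (simp add: A_def)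
  have \<chi>clo: "agree_on (clo u v) \<chi> s'" if "(u, v) \<in> Q" for u v
    by (rule agree_on_subset[OF \<chi>s']) (use that in \<open>auto simp: A_def halo_def\<close>)
  have sw: "switchable \<chi> u v" "gain c \<chi> u v \<in> {2, 4}" if "(u, v) \<in> Q" for u v
    using s'(4)[OF that] switchable_cong[OF \<chi>clo[OF that]] gain_cong[OF tw(3)[OF that] \<chi>clo[OF that]] by auto
  have "\<exists>\<pi>. embedding \<pi> \<and> agree_on C \<pi> s \<and> weight c \<pi> = weight c \<chi> + 4 * int j" if j: "j \<le> J" for j
  proof -
    have "\<exists>Q'\<subseteq>Q. (\<Sum>(u, v)\<in>Q'. gain c \<chi> u v) = 4 * int j"
      by (rule subset_sum_2_4[OF Q(1) _ J j]) (use sw(2) in auto)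
    then obtain Q' where Q': "Q' \<subseteq> Q" "(\<Sum>(u, v)\<in>Q'. gain c \<chi> u v) = 4 * int j" by blast
    have "\<exists>\<rho>. embedding \<rho> \<and> agree_on (- cores Q') \<rho> \<chi> \<and>
      weight c \<rho> = weight c \<chi> + (\<Sum>(u, v)\<in>Q'. gain c \<chi> u v)"
      by (rule switch_many[OF finite_subset[OF Q'(1) Q(1)] far_imp_apart[OF far_subset[OF Q(2) Q'(1)]] _ \<chi>(1)])
        (use Q'(1) tw sw(1) in blast)
    then obtain \<rho> where \<rho>: "embedding \<rho>" "agree_on (- cores Q') \<rho> \<chi>" "weight c \<rho> = weight c \<chi> + 4 * int j"
      using Q'(2) by auto
    have "C \<inter> cores Q' = {}"
      using Q(3) Q'(1) core_in_clo by (fastforce simp: cores_def)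
    then have "agree_on C \<rho> \<chi>" by (intro agree_on_subset[OF \<rho>(2)]) auto
    then show ?thesis using \<rho> agree_on_trans[OF _ \<chi>s] by blast
  qed
  then show ?thesis using \<chi>(1,3,4) \<chi>s by blast
qed

end

section \<open>Separated vertices and the parity of the colour sum\<close>

context guest
begin

definition cn :: "'a \<Rightarrow> 'a set" where
  "cn v = insert v (nbrs v)"

text \<open>Pairwise distance at least 3 in \<open>F\<close>: no two members are adjacent or have a
  common neighbour.\<close>

definition separated :: "'a set \<Rightarrow> bool" where
  "separated I \<longleftrightarrow> (\<forall>i\<in>I. \<forall>j\<in>I. i \<noteq> j \<longrightarrow> cn i \<inter> cn j = {})"

definition conflicts :: "'a \<Rightarrow> 'a set" where
  "conflicts i = {x. cn x \<inter> cn i \<noteq> {}}"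

lemma clo_eq_cn: "clo u v = cn u \<union> cn v"
  by (auto simp: clo_def cn_def)

lemma card_cn: "card (cn v) \<le> \<Delta> + 1"
  using card_nbrs[of v] by (simp add: cn_def card_insert_if)

lemma finite_cn [simp]: "finite (cn v)"
  by (simp add: cn_def)

lemma maximal_separated:
  assumes "finite X"
  shows "\<exists>I\<subseteq>X. separated I \<and> X \<subseteq> (\<Union>i\<in>I. conflicts i)"
  using assms
proof (induction X rule: finite_induct)
  case empty
  then show ?case by (simp add: separated_def)
next
  case (insert x X)
  then obtain I where I: "I \<subseteq> X" "separated I" "X \<subseteq> (\<Union>i\<in>I. conflicts i)" by blast
  show ?case
  proof (cases "\<exists>i\<in>I. cn x \<inter> cn i \<noteq> {}")
    case True
    then show ?thesis using I by (intro exI[of _ I]) (auto simp: conflicts_def)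
  next
    case False
    then have "separated (insert x I)" using I(2) by (auto simp: separated_def Int_commute)
    moreover have "x \<in> cn x" by (simp add: cn_def)
    then have "insert x X \<subseteq> (\<Union>i\<in>insert x I. conflicts i)" using I(3) by (auto simp: conflicts_def)
    ultimately show ?thesis using I(1) by (intro exI[of _ "insert x I"]) auto
  qed
qed

lemma card_conflicts: "card (conflicts i) \<le> (\<Delta> + 1) ^ 2"
proof -
  have "conflicts i \<subseteq> (\<Union>y\<in>cn i. cn y)"
  proof
    fix x assume "x \<in> conflicts i"
    then obtain y where "y \<in> cn x" "y \<in> cn i" by (auto simp: conflicts_def)
    moreover then have "x \<in> cn y" using nbrs_sym[of x y] by (auto simp: cn_def)
    ultimately show "x \<in> (\<Union>y\<in>cn i. cn y)" by blast
  qed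
  then have "card (conflicts i) \<le> card (\<Union>y\<in>cn i. cn y)"
    by (rule card_mono[rotated]) simp
  also have "\<dots> \<le> (\<Sum>y\<in>cn i. card (cn y))" by (rule card_UN_le) simp
  also have "\<dots> \<le> card (cn i) * (\<Delta> + 1)"
    using sum_bounded_above[of "cn i" "\<lambda>y. card (cn y)" "\<Delta> + 1"] card_cn by simp
  also have "\<dots> \<le> (\<Delta> + 1) * (\<Delta> + 1)" by (rule mult_le_mono1[OF card_cn])
  finally show ?thesis by (simp add: power2_eq_square)
qed

text \<open>The degrees sum to \<open>2 * card F\<close> and isolated vertices contribute nothing,
  so one of the \<open>\<Delta>\<close> positive degrees is taken by at least
  \<open>2 * card F / \<Delta> ^ 2\<close> vertices. Each member of a maximal separated subset
  accounts for the at most \<open>(\<Delta> + 1) ^ 2\<close> vertices within distance 2.\<close>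

lemma separated_equal_degree:
  assumes "\<Delta> \<ge> 1"
  shows "\<exists>I d. I \<subseteq> V \<and> separated I \<and> d \<ge> 1 \<and> (\<forall>v\<in>I. card (nbrs v) = d) \<and>
    2 * card F \<le> \<Delta> ^ 2 * (\<Delta> + 1) ^ 2 * card I"
proof -
  define X where "X d = {v\<in>V. card (nbrs v) = d}" for d
  have finX: "finite (X d)" for d by (simp add: X_def finite_V)
  have "2 * card F = (\<Sum>v\<in>V. card (nbrs v))" by (rule sum_card_nbrs[symmetric])
  also have "\<dots> = (\<Sum>v\<in>(\<Union>d\<in>{1..\<Delta>}. X d). card (nbrs v))"
    by (rule sum.mono_neutral_right[OF finite_V])
      (use card_nbrs in \<open>auto simp: X_def not_less_eq_eq\<close>)
  also have "\<dots> = (\<Sum>d\<in>{1..\<Delta>}. \<Sum>v\<in>X d. card (nbrs v))"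
    by (rule sum.UNION_disjoint) (auto simp: finX, auto simp: X_def)
  also have "\<dots> = (\<Sum>d\<in>{1..\<Delta>}. card (X d) * d)" by (rule sum.cong) (auto simp: X_def)
  also have "\<dots> \<le> (\<Sum>d\<in>{1..\<Delta>}. card (X d) * \<Delta>)" by (rule sum_mono) auto
  finally have sum: "2 * card F \<le> (\<Sum>d\<in>{1..\<Delta>}. card (X d) * \<Delta>)" .
  have "\<exists>d\<in>{1..\<Delta>}. 2 * card F \<le> \<Delta> ^ 2 * card (X d)"
  proof (rule ccontr)
    assume "\<not> ?thesis"
    then have lt: "\<Delta> ^ 2 * card (X d) < 2 * card F" if "d \<in> {1..\<Delta>}" for d using that by (meson not_le)
    have "(\<Sum>d\<in>{1..\<Delta>}. \<Delta> ^ 2 * card (X d)) < (\<Sum>d\<in>{1..\<Delta>}. 2 * card F)"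
      by (rule sum_strict_mono) (use lt assms in auto)
    moreover have "(\<Sum>d\<in>{1..\<Delta>}. \<Delta> ^ 2 * card (X d)) = \<Delta> * (\<Sum>d\<in>{1..\<Delta>}. card (X d) * \<Delta>)"
      by (simp add: sum_distrib_left power2_eq_square mult_ac)
    ultimately have "\<Delta> * (\<Sum>d\<in>{1..\<Delta>}. card (X d) * \<Delta>) < \<Delta> * (2 * card F)" by simp
    then show False using sum by simp
  qed
  then obtain d where d: "1 \<le> d" "2 * card F \<le> \<Delta> ^ 2 * card (X d)" by auto
  obtain I where I: "I \<subseteq> X d" "separated I" "X d \<subseteq> (\<Union>i\<in>I. conflicts i)"
    using maximal_separated[OF finX, of d] by meson
  have finI: "finite I" using finite_subset[OF I(1) finX] .
  have "X d \<subseteq> (\<Union>i\<in>I. X d \<inter> conflicts i)" using I(3) by blast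
  then have "card (X d) \<le> card (\<Union>i\<in>I. X d \<inter> conflicts i)"
    by (rule card_mono[rotated]) (use finI finX in auto)
  also have "\<dots> \<le> (\<Sum>i\<in>I. card (X d \<inter> conflicts i))" by (rule card_UN_le[OF finI])
  also have "\<dots> \<le> (\<Sum>i\<in>I. (\<Delta> + 1) ^ 2)"
  proof (rule sum_mono)
    fix i
    have "finite (conflicts i)"
    proof (rule finite_subset)
      show "conflicts i \<subseteq> (\<Union>y\<in>cn i. cn y)"
        using nbrs_sym by (auto simp: cn_def conflicts_def)
    qed simp
    then show "card (X d \<inter> conflicts i) \<le> (\<Delta> + 1) ^ 2"
      using card_conflicts[of i] by (meson card_mono inf_le2 le_trans)
  qed
  finally have "card (X d) \<le> (\<Delta> + 1) ^ 2 * card I" by (simp add: mult.commute)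
  then have "\<Delta> ^ 2 * card (X d) \<le> \<Delta> ^ 2 * ((\<Delta> + 1) ^ 2 * card I)" by (rule mult_le_mono2)
  then have "2 * card F \<le> \<Delta> ^ 2 * (\<Delta> + 1) ^ 2 * card I" using d(2) unfolding mult.assoc by linarith
  moreover have "I \<subseteq> V" "\<forall>v\<in>I. card (nbrs v) = d" using I(1) by (auto simp: X_def)
  ultimately show ?thesis using I(2) d(1) by blast
qed

text \<open>The sets \<open>cn i\<close> are disjoint, so an element of \<open>C\<close> spoils at
  most one member of \<open>I\<close>.\<close>

lemma separated_avoiding:
  assumes "finite I" "separated I" "finite C"
  shows "card I \<le> card {i\<in>I. cn i \<inter> C = {}} + card C"
proof -
  let ?B = "{i\<in>I. cn i \<inter> C \<noteq> {}}"
  have "\<forall>i\<in>?B. \<exists>x. x \<in> cn i \<inter> C" by auto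
  then obtain g where g: "\<And>i. i \<in> ?B \<Longrightarrow> g i \<in> cn i \<inter> C" by metis
  have "inj_on g ?B"
  proof (rule inj_onI)
    fix i j assume ij: "i \<in> ?B" "j \<in> ?B" "g i = g j"
    then have "g i \<in> cn i \<inter> cn j" using g[of i] g[of j] by auto
    then show "i = j" using assms(2) ij by (auto simp: separated_def)
  qed
  then have "card ?B \<le> card C" by (rule card_inj_on_le) (use g assms(3) in auto)
  moreover have "card I = card {i\<in>I. cn i \<inter> C = {}} + card ?B"
  proof -
    have "card I = card ({i\<in>I. cn i \<inter> C = {}} \<union> ?B)" by (rule arg_cong[where f = card]) auto
    also have "\<dots> = card {i\<in>I. cn i \<inter> C = {}} + card ?B"
      by (rule card_Un_disjoint) (use assms(1) in auto)
    finally show ?thesis .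
  qed
  ultimately show ?thesis by linarith
qed

lemma separated_subset: "separated I \<Longrightarrow> I' \<subseteq> I \<Longrightarrow> separated I'"
  by (auto simp: separated_def)

text \<open>Pair consecutive members in an enumeration of \<open>I\<close>; separation makes them
  twins and makes distinct pairs far.\<close>

lemma pair_up:
  assumes I: "I \<subseteq> V" "separated I" "d \<ge> 1" "\<And>v. v \<in> I \<Longrightarrow> card (nbrs v) = d" and k: "2 * k \<le> card I"
  shows "\<exists>Q. finite Q \<and> card Q = k \<and> far Q \<and>
    (\<forall>u v. (u, v) \<in> Q \<longrightarrow> twins u v \<and> u \<in> I \<and> v \<in> I)"
proof -
  have finI: "finite I" using finite_subset[OF I(1) finite_V] .
  obtain f where f: "bij_betw f {0..<card I} I" using ex_bij_betw_nat_finite[OF finI] by blast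
  have inj: "f i = f j \<longleftrightarrow> i = j" if "i < card I" "j < card I" for i j
    using bij_betw_imp_inj_on[OF f] that by (auto simp: inj_on_def)
  have fI: "f i \<in> I" if "i < card I" for i using bij_betwE[OF f] that by simp
  have cn: "cn (f i) \<inter> cn (f j) = {}" if "i < card I" "j < card I" "i \<noteq> j" for i j
    using I(2) fI inj that by (simp add: separated_def)
  define Q where "Q = (\<lambda>i. (f (2 * i), f (2 * i + 1))) ` {..<k}"
  have "card Q = k"
    unfolding Q_def by (subst card_image) (use inj k in \<open>auto simp: inj_on_def\<close>)
  moreover have "far Q"
    unfolding far_def
  proof (intro allI impI)
    fix u v u' v' assume h: "(u, v) \<in> Q" "(u', v') \<in> Q" "(u, v) \<noteq> (u', v')"
    then obtain i j where ij: "i < k" "j < k" "u = f (2 * i)" "v = f (2 * i + 1)" "u' = f (2 * j)" "v' = f (2 * j + 1)"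
      by (auto simp: Q_def)
    then have ne: "i \<noteq> j" using h(3) by auto
    have b: "2 * i < card I" "2 * i + 1 < card I" "2 * j < card I" "2 * j + 1 < card I" using ij(1,2) k by auto
    have d: "2 * i \<noteq> 2 * j" "2 * i \<noteq> 2 * j + 1" "2 * i + 1 \<noteq> 2 * j" "2 * i + 1 \<noteq> 2 * j + 1"
      using ne by presburger+
    show "clo u v \<inter> clo u' v' = {}"
      unfolding clo_eq_cn ij Int_Un_distrib Int_Un_distrib2
      using cn[OF b(1,3) d(1)] cn[OF b(1,4) d(2)] cn[OF b(2,3) d(3)] cn[OF b(2,4) d(4)] by simp
  qed
  moreover have "twins u v \<and> u \<in> I \<and> v \<in> I" if p: "(u, v) \<in> Q" for u v
  proof -
    obtain i where i: "i < k" "u = f (2 * i)" "v = f (2 * i + 1)" using p by (auto simp: Q_def)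
    have b: "2 * i < card I" "2 * i + 1 < card I" using i(1) k by auto
    have uv: "u \<in> I" "v \<in> I" "u \<noteq> v" "cn u \<inter> cn v = {}"
      using fI[OF b(1)] fI[OF b(2)] inj[OF b] cn[OF b] by (auto simp: i)
    have "nbrs u \<noteq> {}" using I(3,4) uv(1) by force
    then show ?thesis using uv I(1,4) by (auto simp: twins_def cn_def)
  qed
  ultimately show ?thesis by (intro exI[of _ Q]) (simp add: Q_def)
qed

end

lemma sum_twos_mod_4:
  fixes g :: "'a \<Rightarrow> int"
  assumes "finite S" "\<And>x. x \<in> S \<Longrightarrow> g x \<in> {-2, 2}"
  shows "[sum g S = 2 * int (card S)] (mod 4)"
proof -
  have "[sum g S = (\<Sum>x\<in>S. 2)] (mod 4)"
    by (rule cong_sum) (use assms(2) in \<open>force simp: cong_def\<close>)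
  then show ?thesis by (simp add: mult.commute)
qed

section \<open>Invariants of the colour sum, and swaps that change it by 2 modulo 4\<close>

context coloured_packing
begin

lemma weight_parity:
  assumes "embedding \<pi>"
  shows "[weight c \<pi> = int (card F)] (mod 2)"
proof -
  have "[weight c \<pi> = (\<Sum>e\<in>F. 1)] (mod 2)"
    unfolding weight_def
  proof (rule cong_sum)
    fix e assume "e \<in> F"
    then have "\<pi> ` e \<in> E" using assms by (auto simp: embedding_def bad_def)
    then show "[c (\<pi> ` e) = 1] (mod 2)" using colour by (force simp: cong_def)
  qed
  then show ?thesis by simp
qed

text \<open>Modulo 4 a product of two signs is 1 - 2j, where j counts the minus signs. Summed over
  the edges, j counts the degrees of the vertices sent to minus places. There are always
  \<open>card N\<close> such vertices, and after doubling only the common parity of the degrees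
  matters.\<close>

lemma weight_invariant:
  assumes \<sigma>: "\<And>v. \<sigma> v \<in> {-1, 1 :: int}" and \<tau>: "\<tau> \<in> {-1, 1}"
    and bip: "\<And>x y. {x, y} \<in> E \<Longrightarrow> c {x, y} = \<tau> * \<sigma> x * \<sigma> y"
    and deg: "\<And>u v. u \<in> V \<Longrightarrow> v \<in> V \<Longrightarrow> even (card (nbrs u)) \<longleftrightarrow> even (card (nbrs v))"
  shows "\<exists>b. \<forall>\<pi>. embedding \<pi> \<longrightarrow> [weight c \<pi> = b] (mod 4)"
proof -
  obtain d :: int where d: "\<And>v. v \<in> V \<Longrightarrow> [int (card (nbrs v)) = d] (mod 2)"
  proof (cases "V = {}")
    case False
    then obtain u where u: "u \<in> V" by blast
    have "[int (card (nbrs v)) = int (card (nbrs u))] (mod 2)" if "v \<in> V" for v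
      using deg[OF u that] by (simp add: cong_iff_dvd_diff)
    then show ?thesis using that by blast
  qed (use that in blast)
  define N where "N = {v\<in>V. \<sigma> v = -1}"
  have "[weight c \<pi> = \<tau> * (int (card F) - 2 * (d * int (card N)))] (mod 4)" if "embedding \<pi>" for \<pi>
  proof -
    have \<pi>: "\<pi> permutes V" "\<And>e. e \<in> F \<Longrightarrow> \<pi> ` e \<in> E" using that by (auto simp: embedding_def bad_def)
    define P where "P = {v\<in>V. \<sigma> (\<pi> v) = -1}"
    have finP: "finite P" by (simp add: P_def finite_V)
    have "\<pi> ` P = N"
    proof -
      have "N \<subseteq> \<pi> ` P"
      proof
        fix y assume y: "y \<in> N"
        then obtain x where "x \<in> V" "y = \<pi> x" using permutes_image[OF \<pi>(1)] by (auto simp: N_def)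
        then show "y \<in> \<pi> ` P" using y by (auto simp: N_def P_def)
      qed
      then show ?thesis using permutes_in_image[OF \<pi>(1)] by (auto simp: N_def P_def)
    qed
    then have cP: "card P = card N" using card_image[OF permutes_inj_on[OF \<pi>(1)], of P] by simp
    have e: "[c (\<pi> ` e) = \<tau> * (1 - 2 * int (card (e \<inter> P)))] (mod 4)" if eF: "e \<in> F" for e
    proof -
      obtain x y where xy: "e = {x, y}" "x \<noteq> y" "x \<in> V" "y \<in> V"
        using F_edge[OF eF] by (auto simp: card_2_iff)
      have "c (\<pi> ` e) = \<tau> * \<sigma> (\<pi> x) * \<sigma> (\<pi> y)" using bip[of "\<pi> x" "\<pi> y"] \<pi>(2)[OF eF] xy(1) by simp
      moreover have "card (e \<inter> P) = (if \<sigma> (\<pi> x) = -1 then 1 else 0) + (if \<sigma> (\<pi> y) = -1 then 1 else 0)"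
        using xy by (auto simp: P_def Int_insert_left)
      ultimately show ?thesis
        using \<sigma>[of "\<pi> x"] \<sigma>[of "\<pi> y"] \<tau> by (auto simp: cong_def)
    qed
    have inc: "(\<Sum>e\<in>F. int (card (e \<inter> P))) = (\<Sum>v\<in>P. int (card (nbrs v)))"
    proof -
      have "(\<Sum>e\<in>F. card (e \<inter> P)) = (\<Sum>e\<in>F. \<Sum>v\<in>P. if v \<in> e then 1 else 0)"
        using finP by (simp add: sum.If_cases Int_commute Int_def)
      also have "\<dots> = (\<Sum>v\<in>P. \<Sum>e\<in>F. if v \<in> e then 1 else 0)" by (rule sum.swap)
      also have "\<dots> = (\<Sum>v\<in>P. card (nbrs v))"
        using finite_F by (simp add: card_incident_eq[symmetric] sum.If_cases Int_def)
      finally show ?thesis by (metis of_nat_sum)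
    qed
    have "[weight c \<pi> = (\<Sum>e\<in>F. \<tau> * (1 - 2 * int (card (e \<inter> P))))] (mod 4)"
      unfolding weight_def by (rule cong_sum) (rule e)
    also have "(\<Sum>e\<in>F. \<tau> * (1 - 2 * int (card (e \<inter> P)))) =
        \<tau> * (int (card F) - 2 * (\<Sum>v\<in>P. int (card (nbrs v))))"
      by (simp add: sum_distrib_left[symmetric] sum_subtractf inc)
    finally have 1: "[weight c \<pi> = \<tau> * (int (card F) - 2 * (\<Sum>v\<in>P. int (card (nbrs v))))] (mod 4)" .
    have "[(\<Sum>v\<in>P. int (card (nbrs v))) = (\<Sum>v\<in>P. d)] (mod 2)"
      by (rule cong_sum) (use d in \<open>simp add: P_def\<close>)
    then have "2 dvd (\<Sum>v\<in>P. int (card (nbrs v))) - d * int (card N)"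
      by (simp add: cong_iff_dvd_diff cP mult.commute)
    then obtain j where j: "(\<Sum>v\<in>P. int (card (nbrs v))) = d * int (card N) + 2 * j"
      by (metis diff_eq_eq add.commute dvdE)
    have "\<tau> * (int (card F) - 2 * (\<Sum>v\<in>P. int (card (nbrs v)))) - \<tau> * (int (card F) - 2 * (d * int (card N))) =
      4 * (- \<tau> * j)" unfolding j by (simp add: algebra_simps)
    then have "[\<tau> * (int (card F) - 2 * (\<Sum>v\<in>P. int (card (nbrs v)))) = \<tau> * (int (card F) - 2 * (d * int (card N)))] (mod 4)"
      by (simp add: cong_iff_dvd_diff)
    then show ?thesis using 1 cong_trans by blast
  qed
  then show ?thesis by blast
qed

text \<open>\<open>s\<close> has to respect the host only on \<open>clo u v\<close>, since it serves
  as the prescription for the fixed part and is replaced by an embedding elsewhere.\<close>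

definition parity_switch :: "('a \<Rightarrow> 'a) \<Rightarrow> 'a \<Rightarrow> 'a \<Rightarrow> bool" where
  "parity_switch s u v \<longleftrightarrow> u \<in> V \<and> v \<in> V \<and> u \<noteq> v \<and> s permutes V \<and>
    (\<forall>e\<in>F. e \<subseteq> clo u v \<longrightarrow> s ` e \<in> E) \<and> switchable s u v \<and> [gain c s u v = 2] (mod 4)"

text \<open>The vertices of \<open>clo u v\<close> outside \<open>A\<close> are placed adjacent to
  everything already placed, so only edges inside \<open>A\<close> remain to be checked.\<close>

lemma place_around:
  assumes "finite A" "A \<subseteq> V" "inj_on s A" "s ` A \<subseteq> V" "{u, v} \<subseteq> A" "u \<in> V" "v \<in> V"
    and big: "(card A + (2 * \<Delta> + 2)) * q < card V"
    and E: "\<And>e. e \<in> F \<Longrightarrow> e \<subseteq> A \<Longrightarrow> e \<subseteq> clo u v \<Longrightarrow> s ` e \<in> E"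
  shows "\<exists>s'. s' permutes V \<and> agree_on A s' s \<and> (\<forall>e\<in>F. e \<subseteq> clo u v \<longrightarrow> s' ` e \<in> E) \<and>
    (\<forall>y\<in>clo u v - A. \<forall>z\<in>A \<union> clo u v. z \<noteq> y \<longrightarrow> {s' y, s' z} \<in> E)"
proof -
  let ?B = "clo u v - A"
  have cV: "clo u v \<subseteq> V" using assms(6,7) subsetD[OF nbrs_subset] by (auto simp: clo_def)
  have B: "finite ?B" "?B \<subseteq> V - A" using cV by auto
  have "card ?B \<le> 2 * \<Delta> + 2" using card_mono[OF finite_clo, of ?B u v] card_clo[of u v] by auto
  then have "(card A + card ?B) * q \<le> (card A + (2 * \<Delta> + 2)) * q" by (intro mult_le_mono1) simp
  then have "(card A + card ?B) * q < card V" using big by linarith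
  then obtain s1 where s1: "agree_on A s1 s" "inj_on s1 (A \<union> ?B)" "s1 ` (A \<union> ?B) \<subseteq> V"
    "\<forall>v\<in>?B. \<forall>z\<in>A \<union> ?B. z \<noteq> v \<longrightarrow> {s1 v, s1 z} \<in> E"
    using greedy_extension[OF B(1) assms(2) B(2) assms(3,4), of "\<lambda>_. V"] by auto
  have "A \<union> ?B \<subseteq> V" using assms(2) cV by auto
  then obtain s' where s': "s' permutes V" "agree_on (A \<union> ?B) s' s1"
    using extend_to_permutation[OF finite_V _ s1(2,3)] by blast
  have AB: "A \<union> clo u v = A \<union> ?B" by auto
  have adj: "{s' y, s' z} \<in> E" if "y \<in> ?B" "z \<in> A \<union> clo u v" "z \<noteq> y" for y z
  proof -
    have "z \<in> A \<union> ?B" "y \<in> A \<union> ?B" using that by auto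
    then show ?thesis using s1(4) s'(2) that by (auto simp: agree_on_def)
  qed
  have ag: "agree_on A s' s" using agree_on_trans[OF agree_on_subset[OF s'(2), of A] s1(1)] by blast
  have "s' ` e \<in> E" if e: "e \<in> F" "e \<subseteq> clo u v" for e
  proof (cases "e \<subseteq> A")
    case True
    then show ?thesis using agree_on_image[OF ag True] E[OF e(1) True e(2)] by simp
  next
    case False
    then obtain y where y: "y \<in> e" "y \<in> ?B" using e by blast
    then obtain z where "e = {y, z}" "z \<noteq> y" using F_edge[OF e(1)] card_2_obtain_other by metis
    then show ?thesis using adj[of y z] y e(2) by auto
  qed
  then show ?thesis using s'(1) ag adj by blast
qed

text \<open>With \<open>u\<close> and \<open>v\<close> on places of opposite sign each neighbour
  contributes 2 or -2, so modulo 4 the gain is twice the number of contributions. That number is odd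
  because the degrees differ in parity; a possible edge between \<open>u\<close> and
  \<open>v\<close> removes one from each side. The two places are adjacent to allow for this
  edge.\<close>

lemma parity_switch_bipartite:
  assumes \<sigma>: "\<And>v. \<sigma> v \<in> {-1, 1 :: int}" and \<tau>: "\<tau> \<in> {-1, 1}"
    and bip: "\<And>x y. {x, y} \<in> E \<Longrightarrow> c {x, y} = \<tau> * \<sigma> x * \<sigma> y"
    and uv: "u \<in> V" "v \<in> V" "even (card (nbrs u)) \<noteq> even (card (nbrs v))"
    and xx: "{x, x'} \<in> E" "\<sigma> x \<noteq> \<sigma> x'"
    and big: "(2 * \<Delta> + 4) * q < card V"
  shows "\<exists>s. parity_switch s u v"
proof -
  have ne: "u \<noteq> v" "x \<noteq> x'" using uv xx by auto
  have xV: "x \<in> V" "x' \<in> V" using E_edge[OF xx(1)] by auto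
  define s0 where "s0 = (\<lambda>w. if w = u then x else x')"
  have s0: "s0 u = x" "s0 v = x'" using ne by (auto simp: s0_def)
  have "\<exists>s'. s' permutes V \<and> agree_on {u, v} s' s0 \<and> (\<forall>e\<in>F. e \<subseteq> clo u v \<longrightarrow> s' ` e \<in> E) \<and>
    (\<forall>y\<in>clo u v - {u, v}. \<forall>z\<in>{u, v} \<union> clo u v. z \<noteq> y \<longrightarrow> {s' y, s' z} \<in> E)"
  proof (rule place_around)
    show "inj_on s0 {u, v}" using s0 ne by (auto simp: inj_on_def)
    show "s0 ` {u, v} \<subseteq> V" using s0 xV by auto
    show "(card {u, v} + (2 * \<Delta> + 2)) * q < card V" using big ne by (simp add: algebra_simps)
    fix e assume e: "e \<in> F" "e \<subseteq> {u, v}"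
    then have "e = {u, v}" using F_edge[OF e(1)] ne by (intro card_subset_eq) auto
    then show "s0 ` e \<in> E" using s0 xx(1) by simp
  qed (use uv in auto)
  then obtain s where s: "s permutes V" "agree_on {u, v} s s0"
    "\<forall>e\<in>F. e \<subseteq> clo u v \<longrightarrow> s ` e \<in> E"
    "\<forall>y\<in>clo u v - {u, v}. \<forall>z\<in>{u, v} \<union> clo u v. z \<noteq> y \<longrightarrow> {s y, s z} \<in> E" by blast
  have su: "s u = x" "s v = x'" using s(2) s0 by (auto simp: agree_on_def)
  have adj: "{x, s y} \<in> E" "{x', s y} \<in> E" if "y \<in> nbrs u - {v} \<or> y \<in> nbrs v - {u}" for y
  proof -
    have y: "y \<in> clo u v - {u, v}" using that nbrs_irrefl by (auto simp: clo_def)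
    then have "{s y, s u} \<in> E" "{s y, s v} \<in> E" using s(4) by auto
    then show "{x, s y} \<in> E" "{x', s y} \<in> E" using su by (simp_all add: insert_commute)
  qed
  have sw: "switchable s u v" using adj by (simp add: switchable_def su)
  have diff: "c {x', s y} - c {x, s y} \<in> {-2, 2}" "c {x, s y} - c {x', s y} \<in> {-2, 2}"
    if "y \<in> nbrs u - {v} \<or> y \<in> nbrs v - {u}" for y
    using bip[OF adj(1)[OF that]] bip[OF adj(2)[OF that]] \<tau> \<sigma>[of x] \<sigma>[of x'] \<sigma>[of "s y"] xx(2) by auto
  have "[(\<Sum>y\<in>nbrs u - {v}. c {x', s y} - c {x, s y}) = 2 * int (card (nbrs u - {v}))] (mod 4)"
    "[(\<Sum>y\<in>nbrs v - {u}. c {x, s y} - c {x', s y}) = 2 * int (card (nbrs v - {u}))] (mod 4)"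
    by (rule sum_twos_mod_4; use diff in simp)+
  from cong_add[OF this]
  have g: "[gain c s u v = 2 * (int (card (nbrs u - {v})) + int (card (nbrs v - {u})))] (mod 4)"
    unfolding gain_eq[OF ne(1)] su by (simp add: algebra_simps)
  have "odd (card (nbrs u - {v}) + card (nbrs v - {u}))"
  proof (cases "v \<in> nbrs u")
    case True
    then have "u \<in> nbrs v" using nbrs_sym by blast
    then have "card (nbrs u) = Suc (card (nbrs u - {v}))" "card (nbrs v) = Suc (card (nbrs v - {u}))"
      using True by (metis card_Suc_Diff1 finite_nbrs)+
    then show ?thesis using uv(3) by simp
  next
    case False
    then have "u \<notin> nbrs v" using nbrs_sym by blast
    then show ?thesis using uv(3) False by simp
  qed
  then obtain k where "card (nbrs u - {v}) + card (nbrs v - {u}) = 2 * k + 1" by (rule oddE)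
  then have "int (card (nbrs u - {v}) + card (nbrs v - {u})) = int (2 * k + 1)" by (rule arg_cong)
  then have "2 * (int (card (nbrs u - {v})) + int (card (nbrs v - {u}))) - 2 = 4 * int k" by simp
  then have "[2 * (int (card (nbrs u - {v})) + int (card (nbrs v - {u}))) = 2] (mod 4)"
    by (simp add: cong_iff_dvd_diff)
  then have "[gain c s u v = 2] (mod 4)" using g cong_trans by blast
  then show ?thesis using s(1,3) sw uv ne by (intro exI[of _ s]) (auto simp: parity_switch_def)
qed

lemma even_gain:
  assumes "u \<noteq> v" "\<And>e. e \<in> F \<Longrightarrow> e \<subseteq> clo u v \<Longrightarrow> s ` e \<in> E" "switchable s u v"
  shows "even (gain c s u v)"
proof -
  have e: "even (c e - c f)" if "e \<in> E" "f \<in> E" for e f using colour[OF that(1)] colour[OF that(2)] by auto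
  have in_E: "{s a, s y} \<in> E" if "a \<in> {u, v}" "y \<in> nbrs a" for a y
    using assms(2)[of "{a, y}"] that by (auto simp: nbrs_def clo_def)
  show ?thesis
    unfolding gain_eq[OF assms(1)]
    by (intro dvd_add dvd_sum e) (use assms(3) in_E in \<open>auto simp: switchable_def\<close>)
qed

lemma parity_switch_square:
  assumes tw: "twins u v"
    and e: "{x, y} \<in> E" "{x', y} \<in> E" "{x, z} \<in> E" "{x', z} \<in> E"
    and sq: "c {x, y} * c {x', y} \<noteq> c {x, z} * c {x', z}"
    and big: "(2 * \<Delta> + 6) * q < card V" "2 * \<Delta> + 2 < card V"
  shows "\<exists>s. parity_switch s u v"
proof -
  have uv: "u \<in> V" "v \<in> V" "u \<noteq> v" "v \<notin> nbrs u" "u \<notin> nbrs v" "nbrs u \<inter> nbrs v = {}"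
    using tw nbrs_sym[of u v] by (auto simp: twins_def)
  obtain y1 where y1: "y1 \<in> nbrs u" using tw by (auto simp: twins_def)
  have y1': "y1 \<noteq> u" "y1 \<noteq> v" "y1 \<in> V" "y1 \<notin> nbrs v" using y1 uv nbrs_irrefl nbrs_subset by auto
  have "\<not> V \<subseteq> clo u v" using card_mono[OF finite_clo, of V u v] card_clo[of u v] big(2) by linarith
  then obtain w where w: "w \<in> V" "w \<notin> clo u v" by auto
  then have w': "w \<noteq> u" "w \<noteq> v" "w \<noteq> y1" "w \<notin> nbrs u" "w \<notin> nbrs v" using y1 by (auto simp: clo_def)
  have ne: "x \<noteq> x'" "y \<noteq> z" using sq colour[OF e(1)] colour[OF e(3)] by auto
  have ne2: "x \<noteq> y" "x' \<noteq> y" "x \<noteq> z" "x' \<noteq> z" using e E_irrefl by auto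
  have inV: "x \<in> V" "x' \<in> V" "y \<in> V" "z \<in> V" using E_edge[OF e(1)] E_edge[OF e(4)] by auto
  \<comment> \<open>\<open>w\<close> keeps \<open>z\<close> in reserve: exchanging \<open>y1\<close> and \<open>w\<close> replaces \<open>y\<close> by \<open>z\<close> and alters the gain
    of the swap of \<open>u\<close> and \<open>v\<close> by 2 modulo 4, so one of the two placements has gain 2 modulo 4.\<close>
  let ?A = "{u, v, y1, w}"
  define s0 where "s0 = (\<lambda>a. if a = u then x else if a = v then x' else if a = y1 then y else z)"
  have s0: "s0 u = x" "s0 v = x'" "s0 y1 = y" "s0 w = z" using uv y1' w' by (auto simp: s0_def)
  have "\<exists>s'. s' permutes V \<and> agree_on ?A s' s0 \<and> (\<forall>e\<in>F. e \<subseteq> clo u v \<longrightarrow> s' ` e \<in> E) \<and>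
    (\<forall>y\<in>clo u v - ?A. \<forall>z\<in>?A \<union> clo u v. z \<noteq> y \<longrightarrow> {s' y, s' z} \<in> E)"
  proof (rule place_around)
    show "inj_on s0 ?A" using s0 ne ne2 by (auto simp: inj_on_def)
    show "s0 ` ?A \<subseteq> V" using s0 inV by auto
    have "card ?A \<le> 4" by (simp add: card_insert_if)
    then have "(card ?A + (2 * \<Delta> + 2)) * q \<le> (2 * \<Delta> + 6) * q" by (intro mult_le_mono1) simp
    then show "(card ?A + (2 * \<Delta> + 2)) * q < card V" using big(1) by linarith
    fix e assume f: "e \<in> F" "e \<subseteq> ?A" "e \<subseteq> clo u v"
    obtain a b where ab: "e = {a, b}" "a \<noteq> b" using F_edge[OF f(1)] by (auto simp: card_2_iff)
    have nb: "b \<in> nbrs a" "a \<in> nbrs b" using f(1) ab(1) by (auto simp: nbrs_def insert_commute)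
    have "w \<notin> e" using f(3) w by auto
    then have "{a, b} \<subseteq> {u, v, y1}" using f(2) ab by auto
    then have "e = {u, y1}" using ab nb uv y1' by auto
    then show "s0 ` e \<in> E" using s0 e(1) by simp
  qed (use uv y1' w in auto)
  then obtain s where s: "s permutes V" "agree_on ?A s s0"
    "\<And>e. e \<in> F \<Longrightarrow> e \<subseteq> clo u v \<Longrightarrow> s ` e \<in> E"
    "\<And>a b. a \<in> clo u v - ?A \<Longrightarrow> b \<in> ?A \<union> clo u v \<Longrightarrow> b \<noteq> a \<Longrightarrow> {s a, s b} \<in> E" by blast
  have sv: "s u = x" "s v = x'" "s y1 = y" "s w = z" using s(2) s0 by (auto simp: agree_on_def)
  define s2 where "s2 = s \<circ> transpose y1 w"
  have s2v: "s2 u = x" "s2 v = x'" "s2 y1 = z" using sv y1' w' by (auto simp: s2_def)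
  have s2o: "s2 a = s a" if "a \<noteq> y1" "a \<noteq> w" for a using that by (simp add: s2_def)
  have s2p: "s2 permutes V"
    unfolding s2_def using permutes_compose[OF permutes_swap_id s(1)] y1'(3) w(1) by blast
  have out: "a \<in> clo u v - ?A" if "a \<in> nbrs u \<union> nbrs v" "a \<noteq> y1" for a
    using that w' uv nbrs_irrefl by (auto simp: clo_def)
  have adj: "{x, s a} \<in> E" "{x', s a} \<in> E" "{z, s a} \<in> E" if "a \<in> nbrs u \<union> nbrs v" "a \<noteq> y1" for a
    using s(4)[OF out[OF that], of u] s(4)[OF out[OF that], of v] s(4)[OF out[OF that], of w] out[OF that] sv
    by (auto simp: insert_commute)
  have sw1: "switchable s u v"
    unfolding switchable_def
  proof (intro conjI ballI)
    fix a assume "a \<in> nbrs u - {v}"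
    then show "{s v, s a} \<in> E" using adj[of a] e(2) sv by (cases "a = y1") auto
  next
    fix a assume "a \<in> nbrs v - {u}"
    then show "{s u, s a} \<in> E" using adj[of a] y1' sv by (cases "a = y1") auto
  qed
  have sw2: "switchable s2 u v"
    unfolding switchable_def
  proof (intro conjI ballI)
    fix a assume a: "a \<in> nbrs u - {v}"
    then have "a \<noteq> w" using w' by auto
    then show "{s2 v, s2 a} \<in> E" using a adj[of a] e(4) s2v s2o[of a] by (cases "a = y1") auto
  next
    fix a assume a: "a \<in> nbrs v - {u}"
    then have "a \<noteq> w" using w' by auto
    then show "{s2 u, s2 a} \<in> E" using a adj[of a] y1' s2v s2o[of a] by (cases "a = y1") auto
  qed
  have val2: "s2 ` f \<in> E" if f: "f \<in> F" "f \<subseteq> clo u v" for f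
  proof (cases "y1 \<in> f")
    case False
    moreover have "w \<notin> f" using f(2) w by auto
    ultimately have "s2 ` f = s ` f" unfolding s2_def by (intro image_comp_transpose) simp
    then show ?thesis using s(3)[OF f] by simp
  next
    case True
    then obtain b where b: "f = {y1, b}" "b \<noteq> y1" using F_edge[OF f(1)] card_2_obtain_other by metis
    then have nb: "b \<in> nbrs y1" "b \<in> clo u v" using f by (auto simp: nbrs_def)
    then have "b \<noteq> v" "b \<noteq> w" using nbrs_sym[of b y1] y1'(4) w by auto
    have "{z, s b} \<in> E"
    proof (cases "b = u")
      case True
      then show ?thesis using e(3) sv by (simp add: insert_commute)
    next
      case False
      then have "b \<in> nbrs u \<union> nbrs v" using nb(2) \<open>b \<noteq> v\<close> by (auto simp: clo_def)
      then show ?thesis using adj(3) b(2) by blast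
    qed
    then show ?thesis using b s2v(3) s2o[OF b(2) \<open>b \<noteq> w\<close>] by simp
  qed
  have "gain c s2 u v - gain c s u v = (c {x', z} - c {x, z}) - (c {x', y} - c {x, y})"
    unfolding s2_def using gain_transpose_neighbour[OF uv(3,6) y1 y1'(2) w(2), of c s] sv by simp
  \<comment> \<open>The two products differ, so exactly one of the brackets vanishes and the other
    is 2 or -2.\<close>
  then have "gain c s2 u v - gain c s u v \<in> {-2, 2}"
    using colour[OF e(1)] colour[OF e(2)] colour[OF e(3)] colour[OF e(4)] sq by auto
  moreover have "even (gain c s u v)" by (rule even_gain[OF uv(3) s(3) sw1])
  moreover have "a mod 4 = 2 \<or> b mod 4 = 2" if "b - a = -2 \<or> b - a = 2" "even a" for a b :: int
    using that by presburger
  ultimately have "gain c s u v mod 4 = 2 \<or> gain c s2 u v mod 4 = 2" by blast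
  then have "[gain c s u v = 2] (mod 4) \<or> [gain c s2 u v = 2] (mod 4)" by (simp add: cong_def)
  then show ?thesis
    using uv(1-3) s(1,3) s2p val2 sw1 sw2 unfolding parity_switch_def by blast
qed

end

section \<open>Attained colour sums\<close>

lemma card_ordered_pairs:
  assumes "finite S" "\<And>e. e \<in> S \<Longrightarrow> card e = 2"
  shows "card {(x, y). {x, y} \<in> S} = 2 * card S" "finite {(x, y). {x, y} \<in> S}"
proof -
  have e2: "card {(x, y). {x, y} = e} = 2 \<and> finite {(x, y). {x, y} = e}" if e: "e \<in> S" for e
  proof -
    obtain a b where ab: "e = {a, b}" "a \<noteq> b" using assms(2)[OF e] by (auto simp: card_2_iff)
    have "{(x, y). {x, y} = e} = {(a, b), (b, a)}" using ab by (auto simp: doubleton_eq_iff)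
    then show ?thesis using ab by simp
  qed
  have U: "{(x, y). {x, y} \<in> S} = (\<Union>e\<in>S. {(x, y). {x, y} = e})" by auto
  show "finite {(x, y). {x, y} \<in> S}" unfolding U using assms(1) e2 by blast
  have "card (\<Union>e\<in>S. {(x, y). {x, y} = e}) = (\<Sum>e\<in>S. card {(x, y). {x, y} = e})"
    by (rule card_UN_disjoint[OF assms(1)]) (use e2 in auto)
  also have "\<dots> = (\<Sum>e\<in>S. 2)" by (rule sum.cong) (use e2 in auto)
  finally show "card {(x, y). {x, y} \<in> S} = 2 * card S" unfolding U by simp
qed

lemma tuples_2: "tuples V 2 = (\<lambda>(x, y). [x, y]) ` {(x, y)\<in>V \<times> V. x \<noteq> y}"
proof
  show "tuples V 2 \<subseteq> (\<lambda>(x, y). [x, y]) ` {(x, y)\<in>V \<times> V. x \<noteq> y}"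
  proof
    fix xs assume xs: "xs \<in> tuples V 2"
    then have "length xs = Suc (Suc 0)" by (simp add: tuples_def)
    then obtain x y where "xs = [x, y]" by (metis length_0_conv length_Suc_conv)
    then show "xs \<in> (\<lambda>(x, y). [x, y]) ` {(x, y)\<in>V \<times> V. x \<noteq> y}"
      using xs by (auto simp: tuples_def)
  qed
qed (auto simp: tuples_def)

lemma card_distinct_pairs:
  assumes "finite V"
  shows "card {(x, y)\<in>V \<times> V. x \<noteq> y} = card V * (card V - 1)" "finite {(x, y)\<in>V \<times> V. x \<noteq> y}"
proof -
  have S: "{(x, y)\<in>V \<times> V. x \<noteq> y} = (SIGMA x:V. V - {x})" by auto
  show "finite {(x, y)\<in>V \<times> V. x \<noteq> y}" unfolding S using assms by simp
  show "card {(x, y)\<in>V \<times> V. x \<noteq> y} = card V * (card V - 1)" unfolding S using assms by simp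
qed

context coloured_host
begin

lemma finite_E: "finite E"
  by (rule finite_subset[of _ "Pow V"]) (use E_edge finite_host in auto)

lemma card_arcs: "card (arcs i) = 2 * card {e\<in>E. c e = i}"
proof -
  have "arcs i = {(x, y). {x, y} \<in> {e\<in>E. c e = i}}" using E_edge by (auto simp: arcs_def)
  then show ?thesis using card_ordered_pairs(1)[of "{e\<in>E. c e = i}"] finite_E E_edge by auto
qed

lemma card_E_bounds: "2 * card E \<le> n * (n - 1)" "n * n \<le> 2 * card E + n * q"
proof -
  have E2: "card {(x, y). {x, y} \<in> E} = 2 * card E" "finite {(x, y). {x, y} \<in> E}"
    using card_ordered_pairs[OF finite_E] E_edge by auto
  have "{(x, y). {x, y} \<in> E} \<subseteq> {(x, y)\<in>V \<times> V. x \<noteq> y}" using E_edge E_irrefl by auto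
  then have "card {(x, y). {x, y} \<in> E} \<le> card {(x, y)\<in>V \<times> V. x \<noteq> y}"
    by (rule card_mono[OF card_distinct_pairs(2)[OF finite_host]])
  then show "2 * card E \<le> n * (n - 1)"
    unfolding card_distinct_pairs(1)[OF finite_host] E2(1) .
  have "V \<times> V \<subseteq> {(x, y). {x, y} \<in> E} \<union> (SIGMA x:V. {y\<in>V. {x, y} \<notin> E})" by auto
  then have "card (V \<times> V) \<le> card ({(x, y). {x, y} \<in> E} \<union> (SIGMA x:V. {y\<in>V. {x, y} \<notin> E}))"
    by (rule card_mono[rotated]) (use E2 finite_host in auto)
  also have "\<dots> \<le> 2 * card E + card (SIGMA x:V. {y\<in>V. {x, y} \<notin> E})"
    using card_Un_le[of "{(x, y). {x, y} \<in> E}" "SIGMA x:V. {y\<in>V. {x, y} \<notin> E}"] unfolding E2(1) .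
  also have "card (SIGMA x:V. {y\<in>V. {x, y} \<notin> E}) = (\<Sum>x\<in>V. card {y\<in>V. {x, y} \<notin> E})"
    using finite_host by simp
  also have "\<dots> \<le> (\<Sum>x\<in>V. q)" by (rule sum_mono) (rule card_nonadjacent)
  finally show "n * n \<le> 2 * card E + n * q" by (simp add: card_cartesian_product)
qed

end

context coloured_packing
begin

text \<open>At most \<open>n * q\<close> ordered pairs are non-adjacent, and each of them costs
  \<open>4 * \<Delta>\<close>.\<close>

lemma sum_penalised:
  "real_of_int (\<Sum>xs\<in>tuples V 2. penalised c (set xs)) \<ge>
    real (card (arcs 1)) - real (card (arcs (-1))) - 4 * real \<Delta> * real n * real q"
proof -
  let ?P = "{(x, y)\<in>V \<times> V. x \<noteq> y}"
  define N where "N = {(x, y)\<in>V \<times> V. x \<noteq> y \<and> {x, y} \<notin> E}"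
  have finP: "finite ?P" by (rule card_distinct_pairs(2)[OF finite_host])
  have sub: "arcs 1 \<subseteq> ?P" "arcs (-1) \<subseteq> ?P" "N \<subseteq> ?P" using E_irrefl by (auto simp: arcs_def N_def)
  have ind: "(\<Sum>p\<in>?P. if p \<in> A then k else 0) = k * int (card A)" if "A \<subseteq> ?P" for A and k :: int
  proof -
    have "?P \<inter> {p. p \<in> A} = A" using that by blast
    then show ?thesis using finP by (simp add: sum.If_cases)
  qed
  have "(\<Sum>xs\<in>tuples V 2. penalised c (set xs)) = (\<Sum>(x, y)\<in>?P. penalised c {x, y})"
  proof -
    have inj: "inj_on (\<lambda>(x, y). [x, y]) ?P" by (auto simp: inj_on_def)
    show ?thesis
      unfolding tuples_2 sum.reindex[OF inj]
    proof (rule sum.cong)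
      fix p assume "p \<in> ?P"
      obtain x y where "p = (x, y)" by force
      then show "((\<lambda>xs. penalised c (set xs)) \<circ> (\<lambda>(x, y). [x, y])) p = (case p of (x, y) \<Rightarrow> penalised c {x, y})"
        by simp
    qed simp
  qed
  also have "\<dots> = (\<Sum>p\<in>?P. (if p \<in> arcs 1 then 1 else 0) + (if p \<in> arcs (-1) then -1 else 0) +
      (if p \<in> N then - 4 * int \<Delta> else 0))"
  proof (rule sum.cong)
    fix p assume "p \<in> ?P"
    then obtain x y where p: "p = (x, y)" "x \<in> V" "y \<in> V" "x \<noteq> y" by auto
    show "(case p of (x, y) \<Rightarrow> penalised c {x, y}) = (if p \<in> arcs 1 then 1 else 0) +
      (if p \<in> arcs (-1) then -1 else 0) + (if p \<in> N then - 4 * int \<Delta> else 0)"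
      using p colour[of "{x, y}"] by (auto simp: arcs_def N_def penalised_def)
  qed simp
  also have "\<dots> = int (card (arcs 1)) - int (card (arcs (-1))) - 4 * int \<Delta> * int (card N)"
    using ind[OF sub(1), of 1] ind[OF sub(2), of "-1"] ind[OF sub(3), of "- 4 * int \<Delta>"]
    by (simp add: sum.distrib)
  finally have eq: "(\<Sum>xs\<in>tuples V 2. penalised c (set xs)) =
    int (card (arcs 1)) - int (card (arcs (-1))) - 4 * int \<Delta> * int (card N)" .
  have "N \<subseteq> (SIGMA x:V. {y\<in>V. {x, y} \<notin> E})" by (auto simp: N_def)
  then have "card N \<le> card (SIGMA x:V. {y\<in>V. {x, y} \<notin> E})"
    by (rule card_mono[rotated]) (use finite_host in auto)
  also have "\<dots> = (\<Sum>x\<in>V. card {y\<in>V. {x, y} \<notin> E})" using finite_host by simp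
  also have "\<dots> \<le> (\<Sum>x\<in>V. q)" by (rule sum_mono) (rule card_nonadjacent)
  finally have "real (card N) \<le> real (n * q)" by (intro of_nat_mono) simp
  then have "4 * real \<Delta> * real (card N) \<le> 4 * real \<Delta> * (real n * real q)"
    by (intro mult_left_mono) auto
  then show ?thesis unfolding eq by simp
qed

end

text \<open>A fraction \<open>1 / 600 ^ 3\<close> of all 4-tuples is alternating, and passing to separated vertices of
  equal degree costs a factor \<open>\<Delta> ^ 2 * (\<Delta> + 1) ^ 2\<close>; this gives \<open>\<beta>\<close>. The approach along a chain of
  embeddings leaves an error of \<open>2 * ((4 * \<Delta> + 2) * \<Delta>)\<close> and the swap that adjusts the parity one
  of at most \<open>8 * \<Delta>\<close>, so \<open>J\<close> corrections by 4 suffice, for which \<open>3 * J\<close> swaps by 2 or 4 are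
  prescribed; \<open>Z\<close> bounds the number of vertices that they involve.\<close>

locale dense_packing = coloured_packing +
  fixes \<beta> :: real and J Z :: nat
  assumes \<Delta>_pos: "\<Delta> \<ge> 1"
    and \<beta>: "8 * 600 ^ 3 * real (\<Delta> ^ 2 * (\<Delta> + 1) ^ 2) * \<beta> = 1"
    and J: "J = 2 * ((4 * \<Delta> + 2) * \<Delta>) + 8 * \<Delta>"
    and Z: "Z = (2 * \<Delta> + 2) * (3 * J + 1)"
    and q_small: "1200 * real Z * real q \<le> real n" "256 * real \<Delta> * real q \<le> \<beta> * real n"
    and n_large: "128 \<le> \<beta> * real n" "1200 * real Z < real n"
    and m_large: "4 * (1 + 16 * real \<Delta> ^ 2 * real Z) \<le> \<beta> * real (card F)"
    and arcs_large: "real n ^ 2 / 4 \<le> real (card (arcs 1))" "real n ^ 2 / 4 \<le> real (card (arcs (-1)))"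
    and arcs_balanced: "\<bar>real (card (arcs 1)) - real (card (arcs (-1)))\<bar> \<le> \<beta> / 2 * (real n * (real n - 1))"
begin

lemma \<beta>_pos: "\<beta> > 0"
proof (rule ccontr)
  assume "\<not> ?thesis"
  then have "8 * 600 ^ 3 * real (\<Delta> ^ 2 * (\<Delta> + 1) ^ 2) * \<beta> \<le> 0"
    by (intro mult_nonneg_nonpos) auto
  then show False unfolding \<beta> by simp
qed

lemma Z_ge: "2 * \<Delta> + 2 + 6 * J \<le> Z" "1 \<le> Z"
proof -
  have "Z = 2 * \<Delta> + 2 + (2 * \<Delta> + 2) * (3 * J)" by (simp add: Z algebra_simps)
  moreover have "2 * (3 * J) \<le> (2 * \<Delta> + 2) * (3 * J)" by (rule mult_le_mono1) simp
  ultimately show "2 * \<Delta> + 2 + 6 * J \<le> Z" by linarith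
  then show "1 \<le> Z" by linarith
qed

lemma q_le: "1200 * real q \<le> real n"
proof -
  have "1200 * real q * 1 \<le> 1200 * real q * real Z" using Z_ge(2) by (intro mult_left_mono) auto
  then show ?thesis using q_small(1) by (simp add: mult_ac)
qed

lemma V_nonempty: "V \<noteq> {}"
  using n_large(1) by auto

lemma split_pairs: "x \<in> V \<Longrightarrow> real n / 600 \<le> real (card {x'\<in>V. split_pair (real n / 600) x x'})"
  by (rule many_split_pairs[OF _ q_le arcs_large])

lemma many_separated:
  obtains I d where "I \<subseteq> V" "separated I" "d \<ge> 1" "\<And>v. v \<in> I \<Longrightarrow> card (nbrs v) = d"
    "16 * 600 ^ 3 * \<beta> * real (card F) \<le> real (card I)"
proof -
  obtain I d where I: "I \<subseteq> V" "separated I" "d \<ge> 1" "\<forall>v\<in>I. card (nbrs v) = d"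
    "2 * card F \<le> \<Delta> ^ 2 * (\<Delta> + 1) ^ 2 * card I"
    using separated_equal_degree[OF \<Delta>_pos] by blast
  let ?D = "real (\<Delta> ^ 2 * (\<Delta> + 1) ^ 2)"
  have "real (2 * card F) \<le> real (\<Delta> ^ 2 * (\<Delta> + 1) ^ 2 * card I)" using I(5) by (rule of_nat_mono)
  then have "2 * real (card F) \<le> ?D * real (card I)" by simp
  then have "(8 * 600 ^ 3 * \<beta>) * (2 * real (card F)) \<le> (8 * 600 ^ 3 * \<beta>) * (?D * real (card I))"
    using \<beta>_pos by (intro mult_left_mono) auto
  also have "\<dots> = (8 * 600 ^ 3 * ?D * \<beta>) * real (card I)" by (simp only: mult_ac)
  finally have "16 * 600 ^ 3 * \<beta> * real (card F) \<le> real (card I)" unfolding \<beta> by simp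
  then show thesis using that[OF I(1-3)] I(4) by blast
qed

text \<open>This is \<open>heavy_permutation\<close> with \<open>\<kappa> = \<beta>\<close> and
  \<open>\<zeta> = 1 / 600 ^ 3\<close>. Half of \<open>\<kappa>\<close> pays for the imbalance of
  the colouring and half for the penalties, while the pairs contribute about
  \<open>2 * \<beta> * card F\<close>. The 1 absorbs the rounding in
  \<open>card I div 2\<close>.\<close>

lemma heavy: "\<exists>\<rho>. \<rho> permutes V \<and> \<beta> * real (card F) - 1 \<le> real_of_int (weight (penalised c) \<rho>)"
proof -
  obtain I d where I: "I \<subseteq> V" "separated I" "d \<ge> 1" "\<And>v. v \<in> I \<Longrightarrow> card (nbrs v) = d"
    "16 * 600 ^ 3 * \<beta> * real (card F) \<le> real (card I)" by (rule many_separated) blast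
  obtain Q where Q: "finite Q" "card Q = card I div 2" "far Q"
    "\<And>u v. (u, v) \<in> Q \<Longrightarrow> twins u v \<and> u \<in> I \<and> v \<in> I"
    using pair_up[OF I(1-4), of "card I div 2"] by auto
  have n1: "real n \<ge> 1200" using n_large(2) Z_ge(2) by linarith
  have "2 * \<Delta> + 2 < n"
  proof -
    have "real (2 * \<Delta> + 2) \<le> real Z" using Z_ge(1) by (intro of_nat_mono) simp
    then show ?thesis using n_large(2) by linarith
  qed
  moreover have "- \<beta> * real (card (tuples V 2)) \<le> (\<Sum>xs\<in>tuples V 2. real_of_int (penalised c (set xs)))"
  proof -
    have ct: "real (card (tuples V 2)) = real n * (real n - 1)"
      unfolding tuples_2 using card_distinct_pairs(1)[OF finite_V] n1
      by (subst card_image) (auto simp: inj_on_def of_nat_diff)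
    have "\<beta> * real n \<le> \<beta> * (32 * (real n - 1))"
      by (rule mult_left_mono) (use n1 \<beta>_pos in auto)
    moreover have "32 * (8 * real \<Delta> * real q) = 256 * real \<Delta> * real q"
      "32 * (\<beta> * (real n - 1)) = \<beta> * (32 * (real n - 1))" by simp_all
    ultimately have "32 * (8 * real \<Delta> * real q) \<le> 32 * (\<beta> * (real n - 1))"
      using q_small(2) by linarith
    then have "real n * (8 * real \<Delta> * real q) \<le> real n * (\<beta> * (real n - 1))"
      by (intro mult_left_mono) auto
    then have "4 * real \<Delta> * real n * real q \<le> \<beta> / 2 * (real n * (real n - 1))" by (simp add: algebra_simps)
    moreover have "- (\<beta> / 2 * (real n * (real n - 1))) \<le> real (card (arcs 1)) - real (card (arcs (-1)))"
      using arcs_balanced by linarith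
    ultimately have "- \<beta> * (real n * (real n - 1)) \<le> real_of_int (\<Sum>xs\<in>tuples V 2. penalised c (set xs))"
      using sum_penalised by (simp add: algebra_simps)
    then show ?thesis unfolding ct by simp
  qed
  moreover have "1 / 600 ^ 3 * real n ^ 4 \<le> real (card {xs\<in>tuples V 4. alternating (penalised c) xs})"
  proof -
    have "real n * (real n / 600) ^ 3 \<le> real (card {xs\<in>tuples V 4. alternating (penalised c) xs})"
      by (rule many_alternating_tuples[OF split_pairs]) (use n1 in \<open>auto simp: penalised_def\<close>)
    then show ?thesis by (simp add: power_divide power4_eq_xxxx power3_eq_cube)
  qed
  ultimately have "\<exists>\<rho>. \<rho> permutes V \<and>
      - \<beta> * real (card F) + real (card Q) * (1 / 600 ^ 3 / 4) \<le> real_of_int (weight (penalised c) \<rho>)"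
    using Q(4) by (intro heavy_permutation[OF Q(1) far_imp_apart[OF Q(3)]]) (auto simp: twins_def)
  moreover have "\<beta> * real (card F) - 1 \<le> - \<beta> * real (card F) + real (card Q) * (1 / 600 ^ 3 / 4)"
  proof -
    have "real (card I) - 1 \<le> 2 * real (card Q)" using Q(2) by linarith
    then have "16 * 600 ^ 3 * \<beta> * real (card F) - 1 \<le> 2 * real (card Q)" using I(5) by linarith
    then show ?thesis by simp
  qed
  ultimately show ?thesis by (meson order_trans)
qed

text \<open>The assumptions are symmetric in the two colours, so a lower bound on large sums also
  yields very negative ones.\<close>

lemma dense_packing_uminus: "dense_packing V F \<Delta> E q (\<lambda>e. - c e) \<beta> J Z"
proof -
  interpret neg: coloured_host V E q "\<lambda>e. - c e"
    by unfold_locales (use colour in force)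
  have "neg.arcs i = arcs (- i)" for i
    by (auto simp: neg.arcs_def arcs_def)
  then show ?thesis
    using \<Delta>_pos \<beta> J Z q_small n_large m_large arcs_large arcs_balanced
    by unfold_locales (auto simp: abs_minus_commute)
qed

text \<open>\<open>C\<close> will be empty or the closed neighbourhood \<open>clo u v\<close> of a
  parity switch, whence the bound on its size.\<close>

lemma flexible_near:
  fixes k :: int
  assumes C: "C \<subseteq> V" "card C \<le> 2 * \<Delta> + 2" and s: "s permutes V" "\<And>e. e \<in> F \<Longrightarrow> e \<subseteq> C \<Longrightarrow> s ` e \<in> E"
    and k: "2 * \<bar>real_of_int k\<bar> < \<beta> * real (card F)"
  shows "\<exists>\<pi>0. embedding \<pi>0 \<and> agree_on C \<pi>0 s \<and> weight c \<pi>0 \<le> k \<and>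
    k - 2 * int ((4 * \<Delta> + 2) * \<Delta>) \<le> weight c \<pi>0 \<and>
    (\<forall>j\<le>J. \<exists>\<pi>. embedding \<pi> \<and> agree_on C \<pi> s \<and> weight c \<pi> = weight c \<pi>0 + 4 * int j)"
proof -
  let ?m = "real (card F)"
  have \<Delta>Z: "real \<Delta> ^ 2 * real Z \<ge> real Z" "real Z \<ge> 1"
  proof -
    have "1 \<le> real \<Delta> ^ 2" using \<Delta>_pos by simp
    then have "1 * real Z \<le> real \<Delta> ^ 2 * real Z" by (intro mult_right_mono) auto
    then show "real \<Delta> ^ 2 * real Z \<ge> real Z" by simp
    show "real Z \<ge> 1" using Z_ge(2) by simp
  qed
  have m16: "\<beta> * ?m \<ge> 64 * real Z + 4" 
  proof -
    have "4 * (1 + 16 * real \<Delta> ^ 2 * real Z) = 4 + 64 * (real \<Delta> ^ 2 * real Z)" by simp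
    then show ?thesis using m_large \<Delta>Z(1) by linarith
  qed
  obtain I d where I: "I \<subseteq> V" "separated I" "d \<ge> 1" "\<And>v. v \<in> I \<Longrightarrow> card (nbrs v) = d"
    "16 * 600 ^ 3 * \<beta> * ?m \<le> real (card I)" by (rule many_separated) blast
  define I' where "I' = {i\<in>I. cn i \<inter> C = {}}"
  have finC: "finite C" using finite_subset[OF C(1) finite_V] .
  have finI: "finite I" using finite_subset[OF I(1) finite_V] .
  have "real Z \<le> real (card I)" using I(5) m16 by simp
  then have "2 * (3 * J) \<le> card I'"
    using separated_avoiding[OF finI I(2) finC] C(2) Z_ge(1) by (simp add: I'_def)
  then obtain Q where Q: "finite Q" "card Q = 3 * J" "far Q"
    "\<And>u v. (u, v) \<in> Q \<Longrightarrow> twins u v \<and> u \<in> I' \<and> v \<in> I'"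
  proof -
    have sub: "I' \<subseteq> I" by (auto simp: I'_def)
    have IV: "I' \<subseteq> V" using sub I(1) by blast
    have deg: "card (nbrs v) = d" if "v \<in> I'" for v using I(4) sub that by blast
    show ?thesis
      using pair_up[OF IV separated_subset[OF I(2) sub] I(3) deg \<open>2 * (3 * J) \<le> card I'\<close>] that by blast
  qed
  have Q': "twins u v \<and> clo u v \<inter> C = {}" if "(u, v) \<in> Q" for u v
    using Q(4)[OF that] by (auto simp: I'_def clo_eq_cn)
  obtain \<rho>1 where \<rho>1: "\<rho>1 permutes V" "\<beta> * ?m - 1 \<le> real_of_int (weight (penalised c) \<rho>1)"
    using heavy by blast
  interpret neg: dense_packing V F \<Delta> E q "\<lambda>e. - c e" \<beta> J Z by (rule dense_packing_uminus)
  obtain \<rho>2 where \<rho>2: "\<rho>2 permutes V" "\<beta> * ?m - 1 \<le> real_of_int (weight (penalised (\<lambda>e. - c e)) \<rho>2)"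
    using neg.heavy by blast
  define T where "T = \<lceil>\<beta> * ?m - 1\<rceil>"
  \<comment> \<open>The light free vertices have total degree at most
    \<open>\<beta> * ?m / 16\<close>, which \<open>S\<close> exceeds after rounding; leaving them
    free costs \<open>2 * S\<close>, at most a quarter of \<open>\<beta> * ?m\<close>.\<close>
  define S where "S = nat \<lfloor>\<beta> * ?m / 8\<rfloor>"
  have S_le: "real S \<le> \<beta> * ?m / 8" "\<beta> * ?m / 16 \<le> real S"
  proof -
    have nn: "0 \<le> \<beta> * ?m / 8" using \<beta>_pos by simp
    then have "real S = real_of_int \<lfloor>\<beta> * ?m / 8\<rfloor>" by (simp add: S_def)
    then show "real S \<le> \<beta> * ?m / 8" "\<beta> * ?m / 16 \<le> real S" using m16 \<Delta>Z by linarith+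
  qed
  have cQ: "card C + card Q * (2 * \<Delta> + 2) \<le> Z" using C(2) Q(2) by (simp add: Z algebra_simps)
  show ?thesis
  proof (rule flexible_embeddings[OF Q(1,3) Q' C(1) s _ _ _ split_pairs V_nonempty \<Delta>_pos _ \<rho>1(1) _ \<rho>2(1) _ cQ])
    show "0 < real n / 600" using n_large \<Delta>Z by simp
    have "real (card C + 2 * card Q) \<le> real Z" using C(2) Q(2) Z_ge(1) by (intro of_nat_mono) simp
    then show "real (card C + 2 * card Q) < real n / 600" using n_large(2) \<Delta>Z by simp
    have "real ((card C + card Q * (2 * \<Delta> + 2)) * q) \<le> real (Z * q)" using cQ by (intro of_nat_mono mult_le_mono1)
    then show "real ((card C + card Q * (2 * \<Delta> + 2)) * q) < real n / 600"
      using q_small(1) n_large(2) \<Delta>Z by simp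
    show "3 * J \<le> card Q" using Q(2) by simp
    show "T \<le> weight (penalised c) \<rho>1" using \<rho>1(2) unfolding T_def by (simp only: ceiling_le_iff)
    show "T \<le> weight (penalised (\<lambda>e. - c e)) \<rho>2" using \<rho>2(2) unfolding T_def by (simp only: ceiling_le_iff)
    have "2 * \<Delta> * q \<le> Z * q" using Z_ge(1) by (intro mult_le_mono1) simp
    then have "real (2 * \<Delta> * q) \<le> real (Z * q)" by (rule of_nat_mono)
    then have "real (2 * \<Delta> * q + 1 + Z) \<le> real n" using q_small(1) n_large(2) \<Delta>Z by simp
    then show Zn: "2 * \<Delta> * q + 1 + Z \<le> n" by (simp only: of_nat_le_iff)
    show "(2 * \<Delta> * q + 1) * (2 * card F) \<le> S * (n - Z)"
    proof -
      have nZ: "real n / 2 \<le> real (n - Z)" using Zn n_large(2) \<Delta>Z by (simp add: of_nat_diff)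
      \<comment> \<open>Each of \<open>2 * \<Delta> * q\<close> and 1 is at most
        \<open>\<beta> * n / 128\<close>.\<close>
      have "real (2 * \<Delta> * q + 1) \<le> \<beta> * real n / 64" using q_small(2) n_large(1) by simp
      then have "real (2 * \<Delta> * q + 1) * (2 * ?m) \<le> (\<beta> * real n / 64) * (2 * ?m)"
        by (intro mult_right_mono) auto
      also have "\<dots> = (\<beta> * ?m / 16) * (real n / 2)" by simp
      also have "\<dots> \<le> real S * real (n - Z)" using S_le(2) nZ \<beta>_pos by (intro mult_mono) auto
      finally have "real ((2 * \<Delta> * q + 1) * (2 * card F)) \<le> real (S * (n - Z))"
        by (simp only: of_nat_mult of_nat_numeral)
      then show ?thesis by (simp only: of_nat_le_iff)
    qed
    \<comment> \<open>Of \<open>\<beta> * ?m\<close>, less than a half goes to \<open>k\<close>, at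
      most a quarter to \<open>2 * S\<close>, and the remaining quarter covers the 1 and the
      anchoring cost by \<open>m_large\<close>.\<close>
    have "\<beta> * ?m - 1 \<le> real_of_int T" by (simp add: T_def)
    then have "real_of_int \<bar>k\<bar> < real_of_int T - 16 * real \<Delta> * real (Z * \<Delta>) - 2 * real S"
      using k S_le(1) m_large by (simp add: power2_eq_square algebra_simps)
    also have "\<dots> = real_of_int (T - 16 * int \<Delta> * int (Z * \<Delta>) - 2 * int S)" by simp
    finally show "\<bar>k\<bar> < T - 16 * int \<Delta> * int (Z * \<Delta>) - 2 * int S" by (simp only: of_int_less_iff)
  qed
qed

section \<open>Reaching exact values of the colour sum\<close>

lemma values_mod_4:
  assumes inv: "\<And>\<pi>. embedding \<pi> \<Longrightarrow> [weight c \<pi> = b] (mod 4)"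
    and k: "2 * \<bar>real_of_int k\<bar> < \<beta> * real (card F)" "[k = b] (mod 4)"
  shows "\<exists>\<pi>. embedding \<pi> \<and> weight c \<pi> = k"
proof -
  have noF: "s ` e \<in> E" if "e \<in> F" "e \<subseteq> {}" for e and s :: "'a \<Rightarrow> 'a" using F_edge[OF that(1)] that(2) by auto
  obtain \<pi>0 where \<pi>0: "embedding \<pi>0" "weight c \<pi>0 \<le> k" "k - 2 * int ((4 * \<Delta> + 2) * \<Delta>) \<le> weight c \<pi>0"
    "\<And>j. j \<le> J \<Longrightarrow> \<exists>\<pi>. embedding \<pi> \<and> agree_on {} \<pi> id \<and> weight c \<pi> = weight c \<pi>0 + 4 * int j"
    using flexible_near[OF empty_subsetI _ permutes_id noF k(1)] by (metis card.empty zero_le)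
  have "[k = weight c \<pi>0] (mod 4)" using k(2) inv[OF \<pi>0(1)] cong_sym cong_trans by blast
  then have "4 dvd k - weight c \<pi>0" by (simp add: cong_iff_dvd_diff)
  then obtain i where i: "k - weight c \<pi>0 = 4 * i" by (rule dvdE)
  have "int J = 2 * int ((4 * \<Delta> + 2) * \<Delta>) + 8 * int \<Delta>" by (simp add: J)
  then have "0 \<le> i" "i \<le> int J" using i \<pi>0(2,3) by linarith+
  then have "weight c \<pi>0 + 4 * int (nat i) = k" "nat i \<le> J" using i by simp_all
  then show ?thesis using \<pi>0(4)[of "nat i"] by auto
qed

text \<open>The prepared swaps reach sums congruent to that of \<open>\<pi>0\<close> modulo 4. If
  \<open>k\<close> is not congruent to it, it is off by 2; then the sum
  \<open>k - gain c s u v\<close> is reached first, and the parity switch, still available on the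
  fixed part, adds the rest.\<close>

lemma values_mod_2:
  assumes ps: "parity_switch s u v"
    and k: "2 * (\<bar>real_of_int k\<bar> + 4 * real \<Delta>) < \<beta> * real (card F)" "[k = int (card F)] (mod 2)"
  shows "\<exists>\<pi>. embedding \<pi> \<and> weight c \<pi> = k"
proof -
  have p: "u \<in> V" "v \<in> V" "u \<noteq> v" "s permutes V" "\<And>e. e \<in> F \<Longrightarrow> e \<subseteq> clo u v \<Longrightarrow> s ` e \<in> E"
    "switchable s u v" "[gain c s u v = 2] (mod 4)"
    using ps by (auto simp: parity_switch_def)
  have cV: "clo u v \<subseteq> V" using p(1,2) subsetD[OF nbrs_subset] by (auto simp: clo_def)
  \<comment> \<open>The gain is at most \<open>4 * \<Delta>\<close> in absolute value, so aiming
    lower by this amount keeps both \<open>k\<close> and \<open>k - gain c s u v\<close> at or above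
    the starting sum.\<close>
  define k' where "k' = k - 4 * int \<Delta>"
  have k': "2 * \<bar>real_of_int k'\<bar> < \<beta> * real (card F)" 
  proof -
    have "real_of_int k' = real_of_int k - 4 * real \<Delta>" by (simp add: k'_def)
    then have "\<bar>real_of_int k'\<bar> \<le> \<bar>real_of_int k\<bar> + 4 * real \<Delta>" by linarith
    then have "2 * \<bar>real_of_int k'\<bar> \<le> 2 * (\<bar>real_of_int k\<bar> + 4 * real \<Delta>)" by (rule mult_left_mono) simp
    then show ?thesis using k(1) by (rule le_less_trans)
  qed
  obtain \<pi>0 where \<pi>0: "embedding \<pi>0" "weight c \<pi>0 \<le> k'" "k' - 2 * int ((4 * \<Delta> + 2) * \<Delta>) \<le> weight c \<pi>0"
    "\<And>j. j \<le> J \<Longrightarrow> \<exists>\<pi>. embedding \<pi> \<and> agree_on (clo u v) \<pi> s \<and> weight c \<pi> = weight c \<pi>0 + 4 * int j"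
    using flexible_near[OF cV card_clo p(4,5) k'] by blast
  \<comment> \<open>\<open>s\<close> may send edges to non-edges, where \<open>c\<close> is
    arbitrary; the gain is therefore bounded at an embedding that agrees with \<open>s\<close> on
    \<open>clo u v\<close>.\<close>
  have gb: "\<bar>gain c s u v\<bar> \<le> 4 * int \<Delta>"
  proof -
    obtain \<pi> where \<pi>: "embedding \<pi>" "agree_on (clo u v) \<pi> s" using \<pi>0(4)[of 0] by auto
    have sw: "switchable \<pi> u v" using p(6) switchable_cong[OF \<pi>(2)] by simp
    have "gain c s u v = gain c \<pi> u v" using gain_cong[OF p(3) \<pi>(2)] by simp
    also have "\<dots> = gain (masked c) \<pi> u v"
      unfolding gain_def using weight_masked[OF \<pi>(1)] weight_masked[OF embedding_switch[OF \<pi>(1) sw p(1-3)]] by simp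
    finally show ?thesis
      using gain_bound[of "masked c" 1 \<pi> u v] colour by (force simp: masked_def)
  qed
  have reach: "\<exists>\<pi>. embedding \<pi> \<and> agree_on (clo u v) \<pi> s \<and> weight c \<pi> = k''"
    if k'': "4 dvd k'' - weight c \<pi>0" "weight c \<pi>0 \<le> k''" "k'' \<le> weight c \<pi>0 + 4 * int J" for k''
  proof -
    obtain i where i: "k'' - weight c \<pi>0 = 4 * i" using k''(1) by (rule dvdE)
    have "weight c \<pi>0 + 4 * int (nat i) = k''" "nat i \<le> J"
      using i k''(2,3) by auto
    then show ?thesis using \<pi>0(4)[of "nat i"] by auto
  qed
  have "[k = weight c \<pi>0] (mod 2)" using k(2) weight_parity[OF \<pi>0(1)] cong_sym cong_trans by blast
  then have ev: "even (k - weight c \<pi>0)" by (simp add: cong_iff_dvd_diff)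
  show ?thesis
  proof (cases "4 dvd k - weight c \<pi>0")
    case True
    have "weight c \<pi>0 \<le> k" "k \<le> weight c \<pi>0 + 4 * int J" using \<pi>0(2,3) by (simp_all add: k'_def J)
    then show ?thesis using reach[OF True] by blast
  next
    case False
    have "4 dvd gain c s u v - 2" using p(7) by (simp add: cong_iff_dvd_diff)
    moreover have "4 dvd a - b - g" if "4 dvd g - 2" "even (a - b)" "\<not> 4 dvd a - b" for a b g :: int
      using that by presburger
    ultimately have "4 dvd k - weight c \<pi>0 - gain c s u v" using ev False by blast
    then have "4 dvd (k - gain c s u v) - weight c \<pi>0" by (simp add: algebra_simps)
    moreover have "weight c \<pi>0 \<le> k - gain c s u v" "k - gain c s u v \<le> weight c \<pi>0 + 4 * int J"
      using \<pi>0(2,3) gb by (simp_all add: k'_def J)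
    ultimately obtain \<pi> where \<pi>: "embedding \<pi>" "agree_on (clo u v) \<pi> s" "weight c \<pi> = k - gain c s u v"
      using reach by blast
    have sw: "switchable \<pi> u v" using p(6) switchable_cong[OF \<pi>(2)] by simp
    have "weight c (\<pi> \<circ> transpose u v) = k"
      using \<pi>(3) gain_cong[OF p(3) \<pi>(2), of c] by (simp add: gain_def)
    then show ?thesis using embedding_switch[OF \<pi>(1) sw p(1-3)] by blast
  qed
qed

definition bipartite_signs :: bool where
  "bipartite_signs \<longleftrightarrow> (\<exists>\<sigma> \<tau>. (\<forall>v. \<sigma> v \<in> {-1, 1 :: int}) \<and> \<tau> \<in> {-1, 1} \<and>
    (\<forall>x y. {x, y} \<in> E \<longrightarrow> c {x, y} = \<tau> * \<sigma> x * \<sigma> y))"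

definition equal_parities :: bool where
  "equal_parities \<longleftrightarrow> (\<forall>u\<in>V. \<forall>v\<in>V. even (card (nbrs u)) \<longleftrightarrow> even (card (nbrs v)))"

text \<open>If signs exist, two vertices have degrees of different parity, and some edge joins
  opposite signs because both colours occur. If not, the contrapositive of
  \<open>signs_of_bipartite\<close> yields a 4-cycle of negative product.\<close>

lemma exists_parity_switch:
  assumes "\<not> (equal_parities \<and> bipartite_signs)"
  shows "\<exists>s u v. parity_switch s u v"
proof -
  have JZ: "2 * \<Delta> + 6 \<le> Z" using Z_ge(1) \<Delta>_pos J by linarith
  then have "(2 * \<Delta> + 6) * q \<le> Z * q" by (rule mult_le_mono1)
  then have "real ((2 * \<Delta> + 6) * q) \<le> real (Z * q)" by (rule of_nat_mono)
  moreover have "real (Z * q) < real n" using q_small(1) n_large(2) Z_ge(2) by simp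
  ultimately have big6: "(2 * \<Delta> + 6) * q < n" by (metis le_less_trans of_nat_less_iff)
  then have big4: "(2 * \<Delta> + 4) * q < n" by (simp add: algebra_simps)
  have bigD: "2 * \<Delta> + 2 < n"
  proof -
    have "real (2 * \<Delta> + 2) \<le> real Z" using Z_ge(1) by (intro of_nat_mono) simp
    then show ?thesis using n_large(2) by linarith
  qed
  show ?thesis
  proof (cases bipartite_signs)
    case True
    then obtain \<sigma> \<tau> where st: "\<And>v. \<sigma> v \<in> {-1, 1 :: int}" "\<tau> \<in> {-1, 1}"
      "\<And>x y. {x, y} \<in> E \<Longrightarrow> c {x, y} = \<tau> * \<sigma> x * \<sigma> y" unfolding bipartite_signs_def by blast
    obtain u v where uv: "u \<in> V" "v \<in> V" "even (card (nbrs u)) \<noteq> even (card (nbrs v))"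
      using assms True unfolding equal_parities_def by blast
    have "\<exists>x x'. {x, x'} \<in> E \<and> \<sigma> x \<noteq> \<sigma> x'"
    proof (rule ccontr)
      assume "\<not> ?thesis"
      then have "c {x, y} = \<tau>" if "{x, y} \<in> E" for x y using st(1)[of x] st(3)[OF that] that by auto
      then have "arcs (- \<tau>) = {}" using st(2) by (auto simp: arcs_def)
      then have "real n ^ 2 / 4 \<le> 0" using st(2) arcs_large by auto
      then show False using bigD by simp
    qed
    then obtain x x' where "{x, x'} \<in> E" "\<sigma> x \<noteq> \<sigma> x'" by blast
    from parity_switch_bipartite[OF st uv this big4] show ?thesis by blast
  next
    case False
    have "3 * q < n"
    proof -
      have "3 * q \<le> (2 * \<Delta> + 6) * q" by (rule mult_le_mono1) simp
      then show ?thesis using big6 by linarith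
    qed
    have "\<exists>x x' y z. {x, y} \<in> E \<and> {x', y} \<in> E \<and> {x, z} \<in> E \<and> {x', z} \<in> E \<and>
        c {x, y} * c {x', y} \<noteq> c {x, z} * c {x', z}"
    proof (rule ccontr)
      assume neg: "\<not> ?thesis"
      have bipartite_signs
        unfolding bipartite_signs_def
        by (rule signs_of_bipartite[OF \<open>3 * q < n\<close>]) (use neg in blast)
      then show False using False by simp
    qed
    then obtain x x' y z where e: "{x, y} \<in> E" "{x', y} \<in> E" "{x, z} \<in> E" "{x', z} \<in> E"
        "c {x, y} * c {x', y} \<noteq> c {x, z} * c {x', z}" by blast
    obtain I d where I: "I \<subseteq> V" "separated I" "d \<ge> 1" "\<And>v. v \<in> I \<Longrightarrow> card (nbrs v) = d"
      "16 * 600 ^ 3 * \<beta> * real (card F) \<le> real (card I)" by (rule many_separated) blast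
    have "4 \<le> \<beta> * real (card F)"
    proof -
      have "0 \<le> real \<Delta> ^ 2 * real Z" by simp
      moreover have "4 * (1 + 16 * real \<Delta> ^ 2 * real Z) = 4 + 64 * (real \<Delta> ^ 2 * real Z)" by simp
      ultimately show ?thesis using m_large by linarith
    qed
    then have "2 * 1 \<le> card I" using I(5) by simp
    then obtain Q where Q: "card Q = 1" "\<And>u v. (u, v) \<in> Q \<Longrightarrow> twins u v"
      using pair_up[OF I(1-4) \<open>2 * 1 \<le> card I\<close>] by blast
    from Q(1) obtain p where "Q = {p}" by (rule card_1_singletonE)
    then have "twins (fst p) (snd p)" using Q(2)[of "fst p" "snd p"] by simp
    from parity_switch_square[OF this e big6 bigD] show ?thesis by blast
  qed
qed

text \<open>The factor 4 leaves room for the shift by \<open>4 * \<Delta>\<close> in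
  \<open>values_mod_2\<close>, since \<open>\<beta> * card F\<close> is at least
  \<open>64 * \<Delta>\<close>. When only the parity is invariant, \<open>b\<close> is the parity of
  the number of edges.\<close>

lemma attained_weights:
  "\<exists>b\<in>{0, 1, 2, 3 :: int}. \<forall>k. 4 * \<bar>real_of_int k\<bar> \<le> \<beta> * real (card F) \<longrightarrow>
    ((\<exists>\<pi>. embedding \<pi> \<and> weight c \<pi> = k) \<longleftrightarrow> [k = b] (mod (if equal_parities \<and> bipartite_signs then 4 else 2)))"
proof -
  let ?m = "real (card F)"
  have m64: "64 * real \<Delta> \<le> \<beta> * ?m" "0 < \<beta> * ?m"
  proof -
    have "real \<Delta> * 1 \<le> real \<Delta> * (real \<Delta> * real Z)"
    proof (intro mult_left_mono)
      have "1 * 1 \<le> real \<Delta> * real Z" using \<Delta>_pos Z_ge(2) by (intro mult_mono) auto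
      then show "1 \<le> real \<Delta> * real Z" by simp
    qed simp
    then have "64 * real \<Delta> \<le> 4 * (16 * real \<Delta> ^ 2 * real Z)" by (simp add: power2_eq_square mult.assoc)
    then show "64 * real \<Delta> \<le> \<beta> * ?m" using m_large by simp
    then show "0 < \<beta> * ?m" using \<Delta>_pos by linarith
  qed
  show ?thesis
  proof (cases "equal_parities \<and> bipartite_signs")
    case True
    then obtain \<sigma> \<tau> where st: "\<And>v. \<sigma> v \<in> {-1, 1 :: int}" "\<tau> \<in> {-1, 1}"
      "\<And>x y. {x, y} \<in> E \<Longrightarrow> c {x, y} = \<tau> * \<sigma> x * \<sigma> y" unfolding bipartite_signs_def by blast
    obtain b where b: "\<And>\<pi>. embedding \<pi> \<Longrightarrow> [weight c \<pi> = b] (mod 4)"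
      using weight_invariant[OF st] True unfolding equal_parities_def by blast
    then have b4: "[weight c \<pi> = b mod 4] (mod 4)" if "embedding \<pi>" for \<pi>
      using that by (simp add: cong_def)
    have rng: "b mod 4 \<in> {0, 1, 2, 3}" by (simp, presburger)
    have iff: "(\<exists>\<pi>. embedding \<pi> \<and> weight c \<pi> = k) \<longleftrightarrow> [k = b mod 4] (mod 4)"
      if k: "4 * \<bar>real_of_int k\<bar> \<le> \<beta> * ?m" for k
    proof -
      have "2 * \<bar>real_of_int k\<bar> < \<beta> * ?m" using k m64(2) by linarith
      then show ?thesis using values_mod_4[OF b4] b4 by blast
    qed
    show ?thesis unfolding if_P[OF True] by (rule bexI[OF _ rng]) (intro allI impI iff)
  next
    case False
    then obtain s u v where ps: "parity_switch s u v" using exists_parity_switch by blast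
    have m2: "[weight c \<pi> = int (card F) mod 2] (mod 2)" if "embedding \<pi>" for \<pi>
      using weight_parity[OF that] by (simp add: cong_def)
    have rng: "int (card F) mod 2 \<in> {0, 1, 2, 3}" by (simp, presburger)
    have iff: "(\<exists>\<pi>. embedding \<pi> \<and> weight c \<pi> = k) \<longleftrightarrow> [k = int (card F) mod 2] (mod 2)"
      if k: "4 * \<bar>real_of_int k\<bar> \<le> \<beta> * ?m" for k
    proof
      assume "[k = int (card F) mod 2] (mod 2)"
      then have "[k = int (card F)] (mod 2)" by (simp add: cong_def)
      moreover have "2 * (\<bar>real_of_int k\<bar> + 4 * real \<Delta>) < \<beta> * ?m"
        using k m64 \<Delta>_pos by (simp add: algebra_simps)
      ultimately show "\<exists>\<pi>. embedding \<pi> \<and> weight c \<pi> = k" using values_mod_2[OF ps] by blast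
    qed (use m2 in blast)
    show ?thesis unfolding if_not_P[OF False] by (rule bexI[OF _ rng]) (intro allI impI iff)
  qed
qed

end

section \<open>Copies as permutations\<close>

text \<open>A copy has as many vertices as \<open>G\<close>, hence spans it, and an isomorphism onto
  it preceded by the inverse of \<open>\<phi>\<close> is a permutation. Several permutations may
  give the same copy, which is harmless as only existence is compared.\<close>

lemma spanning_copies:
  fixes H :: "'a graph" and G :: "'b graph"
  assumes H: "finite_simple_graph H" and G: "finite_simple_graph G"
    and \<phi>: "bij_betw \<phi> (verts H) (verts G)"
  shows "(\<exists>H'. copy_of H' H G \<and> colour_sum c H' = k) \<longleftrightarrow>
    (\<exists>\<pi>. \<pi> permutes verts G \<and> (\<forall>e\<in>(`) \<phi> ` edges H. \<pi> ` e \<in> edges G) \<and>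
      (\<Sum>e\<in>(`) \<phi> ` edges H. c (\<pi> ` e)) = k)"
proof -
  have eH: "e \<subseteq> verts H \<and> card e = 2" if "e \<in> edges H" for e
    using H that by (simp add: finite_simple_graph_def)
  have sumF: "(\<Sum>e\<in>(`) \<phi> ` edges H. h e) = (\<Sum>e\<in>edges H. h (\<phi> ` e))" for h :: "'b set \<Rightarrow> int"
  proof -
    have "inj_on ((`) \<phi>) (edges H)"
      by (rule inj_on_subset[OF inj_on_image_Pow[OF bij_betw_imp_inj_on[OF \<phi>]]]) (use eH in auto)
    then show ?thesis by (simp add: sum.reindex)
  qed
  show ?thesis
  proof
    assume "\<exists>H'. copy_of H' H G \<and> colour_sum c H' = k"
    then obtain H' f where H': "subgraph H' G" "colour_sum c H' = k"
      and f: "bij_betw f (verts H) (verts H')"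
        "\<And>u v. u \<in> verts H \<Longrightarrow> v \<in> verts H \<Longrightarrow> {u, v} \<in> edges H \<longleftrightarrow> {f u, f v} \<in> edges H'"
      unfolding copy_of_def graph_isomorphic_def by blast
    have "card (verts H') = card (verts G)" using bij_betw_same_card[OF f(1)] bij_betw_same_card[OF \<phi>] by simp
    then have VH': "verts H' = verts G"
      using H'(1) G by (intro card_subset_eq) (auto simp: subgraph_def finite_simple_graph_def)
    have eH': "e \<subseteq> verts G \<and> card e = 2" if "e \<in> edges H'" for e
      using H'(1) that VH' by (simp add: subgraph_def finite_simple_graph_def)
    have img: "(`) f ` edges H = edges H'"
    proof
      show "(`) f ` edges H \<subseteq> edges H'"
      proof clarify
        fix e assume e: "e \<in> edges H"
        then obtain u v where uv: "e = {u, v}" using eH by (meson card_2_iff)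
        then have "{f u, f v} \<in> edges H'" using f(2) eH[OF e] e by auto
        then show "f ` e \<in> edges H'" using uv by simp
      qed
      show "edges H' \<subseteq> (`) f ` edges H"
      proof
        fix e assume e: "e \<in> edges H'"
        then obtain a b where ab: "e = {a, b}" using eH' by (meson card_2_iff)
        then have "a \<in> f ` verts H" "b \<in> f ` verts H"
          using eH'[OF e] bij_betw_imp_surj_on[OF f(1)] VH' by auto
        then obtain u v where uv: "u \<in> verts H" "v \<in> verts H" "a = f u" "b = f v" by blast
        then have "{u, v} \<in> edges H" using f(2) e ab by simp
        then have "f ` {u, v} \<in> (`) f ` edges H" by (rule imageI)
        then show "e \<in> (`) f ` edges H" using ab uv by simp
      qed
    qed
    define \<pi> where "\<pi> x = (if x \<in> verts G then f (inv_into (verts H) \<phi> x) else x)" for x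
    have "bij_betw (\<lambda>x. f (inv_into (verts H) \<phi> x)) (verts G) (verts G)"
      using bij_betw_trans[OF bij_betw_inv_into[OF \<phi>] f(1)] by (simp add: VH' o_def)
    then have "bij_betw \<pi> (verts G) (verts G)"
      by (rule bij_betw_cong[THEN iffD1, rotated]) (simp add: \<pi>_def)
    then have \<pi>: "\<pi> permutes verts G" by (rule bij_imp_permutes) (simp add: \<pi>_def)
    have \<pi>\<phi>: "\<pi> (\<phi> v) = f v" if "v \<in> verts H" for v
      using that bij_betwE[OF \<phi>] bij_betw_inv_into_left[OF \<phi> that] by (simp add: \<pi>_def)
    have im: "\<pi> ` \<phi> ` e = f ` e" if "e \<in> edges H" for e
      unfolding image_image using eH[OF that] \<pi>\<phi> by (intro image_cong) auto
    have "\<forall>e\<in>(`) \<phi> ` edges H. \<pi> ` e \<in> edges G"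
      using im img H'(1) by (force simp: subgraph_def)
    moreover have "(\<Sum>e\<in>(`) \<phi> ` edges H. c (\<pi> ` e)) = k"
    proof -
      have inj: "inj_on ((`) f) (edges H)"
        by (rule inj_on_subset[OF inj_on_image_Pow[OF bij_betw_imp_inj_on[OF f(1)]]]) (use eH in auto)
      have "(\<Sum>e\<in>(`) \<phi> ` edges H. c (\<pi> ` e)) = (\<Sum>e\<in>edges H. c (f ` e))"
        unfolding sumF using im by (intro sum.cong) auto
      also have "\<dots> = (\<Sum>e\<in>(`) f ` edges H. c e)" by (simp add: sum.reindex[OF inj])
      finally show ?thesis using H'(2) img by (simp add: colour_sum_def)
    qed
    ultimately show "\<exists>\<pi>. \<pi> permutes verts G \<and> (\<forall>e\<in>(`) \<phi> ` edges H. \<pi> ` e \<in> edges G) \<and>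
      (\<Sum>e\<in>(`) \<phi> ` edges H. c (\<pi> ` e)) = k" using \<pi> by blast
  next
    assume "\<exists>\<pi>. \<pi> permutes verts G \<and> (\<forall>e\<in>(`) \<phi> ` edges H. \<pi> ` e \<in> edges G) \<and>
      (\<Sum>e\<in>(`) \<phi> ` edges H. c (\<pi> ` e)) = k"
    then obtain \<pi> where \<pi>: "\<pi> permutes verts G" "\<And>e. e \<in> edges H \<Longrightarrow> \<pi> ` \<phi> ` e \<in> edges G"
      "(\<Sum>e\<in>edges H. c (\<pi> ` \<phi> ` e)) = k" unfolding sumF by auto
    define f where "f = \<pi> \<circ> \<phi>"
    have f: "bij_betw f (verts H) (verts G)"
      unfolding f_def by (rule bij_betw_trans[OF \<phi> permutes_imp_bij[OF \<pi>(1)]])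
    have fe: "f ` e = \<pi> ` \<phi> ` e" for e by (simp add: f_def image_comp)
    have injP: "inj_on ((`) f) (Pow (verts H))" by (rule inj_on_image_Pow[OF bij_betw_imp_inj_on[OF f]])
    have inj: "inj_on ((`) f) (edges H)" by (rule inj_on_subset[OF injP]) (use eH in auto)
    define H' where "H' = (verts G, (`) f ` edges H)"
    have vH': "verts H' = verts G" "edges H' = (`) f ` edges H" by (simp_all add: H'_def verts_def edges_def)
    have sub: "edges H' \<subseteq> edges G" unfolding vH' using \<pi>(2) fe by auto
    have "subgraph H' G" using sub G vH'(1) by (auto simp: subgraph_def finite_simple_graph_def)
    moreover have "graph_isomorphic H H'"
      unfolding graph_isomorphic_def
    proof (intro exI[of _ f] conjI ballI)
      show "bij_betw f (verts H) (verts H')" using f vH' by simp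
      fix u v assume uv: "u \<in> verts H" "v \<in> verts H"
      show "{u, v} \<in> edges H \<longleftrightarrow> {f u, f v} \<in> edges H'"
      proof
        assume "{u, v} \<in> edges H"
        then have "f ` {u, v} \<in> edges H'" unfolding vH' by (rule imageI)
        then show "{f u, f v} \<in> edges H'" by simp
      next
        assume "{f u, f v} \<in> edges H'"
        then obtain e where e: "e \<in> edges H" "f ` {u, v} = f ` e" unfolding vH' by auto
        then have "{u, v} = e" using inj_onD[OF injP e(2)] uv eH by auto
        then show "{u, v} \<in> edges H" using e by simp
      qed
    qed
    moreover have "colour_sum c H' = k"
      unfolding colour_sum_def vH' sum.reindex[OF inj] using \<pi>(3) by (simp add: fe o_def)
    ultimately show "\<exists>H'. copy_of H' H G \<and> colour_sum c H' = k" unfolding copy_of_def by blast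
  qed
qed

text \<open>\<open>\<sigma>\<close> records the part of a vertex and \<open>\<tau>\<close> the
  colour of the edges inside the parts. The product form is the one that the computations modulo 4
  and with 4-cycles use.\<close>

lemma bipartite_colouring_iff_signs:
  assumes G: "finite_simple_graph G" and c: "two_edge_colouring G c"
  shows "bipartite_colouring G c \<longleftrightarrow> (\<exists>\<sigma> \<tau>. (\<forall>v. \<sigma> v \<in> {-1, 1 :: int}) \<and> \<tau> \<in> {-1, 1} \<and>
    (\<forall>x y. {x, y} \<in> edges G \<longrightarrow> c {x, y} = \<tau> * \<sigma> x * \<sigma> y))"
proof
  assume "bipartite_colouring G c"
  then obtain V1 V2 i where V: "V1 \<union> V2 = verts G" "V1 \<inter> V2 = {}" "i \<in> {-1, 1}"
    "{e \<in> edges G. c e = i} = {e \<in> edges G. e \<subseteq> V1} \<union> {e \<in> edges G. e \<subseteq> V2}"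
    by (auto simp: bipartite_colouring_def colour_class_def graph_union_def induced_subgraph_def edges_def)
  define \<sigma> where "\<sigma> v = (if v \<in> V1 then 1 else -1 :: int)" for v
  have "c {x, y} = i * \<sigma> x * \<sigma> y" if e: "{x, y} \<in> edges G" for x y
  proof -
    have "{x, y} \<subseteq> verts G" using G e by (auto simp: finite_simple_graph_def)
    then have xy: "x \<in> V1 \<or> x \<in> V2" "y \<in> V1 \<or> y \<in> V2" using V(1) by auto
    have "c {x, y} = i \<longleftrightarrow> {x, y} \<subseteq> V1 \<or> {x, y} \<subseteq> V2" 
      using V(4)[unfolded set_eq_iff, rule_format, of "{x, y}"] e by simp
    then have "c {x, y} = i \<longleftrightarrow> \<sigma> x = \<sigma> y" using xy V(2) by (auto simp: \<sigma>_def)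
    moreover have "c {x, y} \<in> {-1, 1}" using c e by (simp add: two_edge_colouring_def)
    ultimately show ?thesis using V(3) by (auto simp: \<sigma>_def split: if_splits)
  qed
  moreover have "\<sigma> v \<in> {-1, 1}" for v by (simp add: \<sigma>_def)
  ultimately show "\<exists>\<sigma> \<tau>. (\<forall>v. \<sigma> v \<in> {-1, 1 :: int}) \<and> \<tau> \<in> {-1, 1} \<and>
    (\<forall>x y. {x, y} \<in> edges G \<longrightarrow> c {x, y} = \<tau> * \<sigma> x * \<sigma> y)" using V(3) by blast
next
  assume "\<exists>\<sigma> \<tau>. (\<forall>v. \<sigma> v \<in> {-1, 1 :: int}) \<and> \<tau> \<in> {-1, 1} \<and>
    (\<forall>x y. {x, y} \<in> edges G \<longrightarrow> c {x, y} = \<tau> * \<sigma> x * \<sigma> y)"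
  then obtain \<sigma> \<tau> where s: "\<And>v. \<sigma> v \<in> {-1, 1 :: int}" "\<tau> \<in> {-1, 1 :: int}"
    "\<And>x y. {x, y} \<in> edges G \<Longrightarrow> c {x, y} = \<tau> * \<sigma> x * \<sigma> y" by blast
  define V1 where "V1 = {v \<in> verts G. \<sigma> v = 1}"
  define V2 where "V2 = {v \<in> verts G. \<sigma> v = -1}"
  have "V1 \<union> V2 = verts G" "V1 \<inter> V2 = {}" using s(1) by (auto simp: V1_def V2_def)
  moreover have "colour_class G c \<tau> = edges (graph_union (induced_subgraph G V1) (induced_subgraph G V2))"
  proof -
    have "c e = \<tau> \<longleftrightarrow> e \<subseteq> V1 \<or> e \<subseteq> V2" if e: "e \<in> edges G" for e
    proof -
      have e2: "e \<subseteq> verts G" "card e = 2" using G e by (auto simp: finite_simple_graph_def)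
      then obtain x y where xy: "e = {x, y}" by (meson card_2_iff)
      then have "c e = \<tau> * \<sigma> x * \<sigma> y" using s(3) e by simp
      then show ?thesis using s(1)[of x] s(1)[of y] s(2) e2(1) xy by (auto simp: V1_def V2_def)
    qed
    then show ?thesis
      by (auto simp: colour_class_def graph_union_def induced_subgraph_def edges_def)
  qed
  ultimately show "bipartite_colouring G c" using s(2) unfolding bipartite_colouring_def by blast
qed

section \<open>The choice of the constants\<close>

theorem theorem1p15:
  fixes \<Delta> :: nat
  assumes "\<Delta> \<ge> 1"
  shows "\<exists>\<epsilon> \<nu> \<alpha> :: real. \<epsilon> > 0 \<and> \<nu> > 0 \<and> \<alpha> > 0 \<and>
    (\<exists>n0 m0 :: nat. \<forall>n\<ge>n0. \<forall>m\<ge>m0.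
      \<forall>(H :: 'a graph) (G :: 'b graph) (c :: 'b set \<Rightarrow> int).
        finite_simple_graph H \<and> card (verts H) = n \<and> card (edges H) = m \<and> max_degree H = \<Delta> \<and>
        finite_simple_graph G \<and> card (verts G) = n \<and> real (min_degree G) \<ge> (1 - \<epsilon>) * real n \<and>
        two_edge_colouring G c \<and> balanced_colouring \<nu> G c \<longrightarrow>
        (let a = (if inert H G c then 4 else 2) in
          \<exists>b \<in> {0, 1, 2, 3 :: int}. \<forall>k :: int.
            real_of_int k \<in> {- \<alpha> * real m .. \<alpha> * real m} \<longrightarrow>
            ((\<exists>H'. copy_of H' H G \<and> colour_sum c H' = k) \<longleftrightarrow> [k = b] (mod a))))"
proof -
  define J where "J = 2 * ((4 * \<Delta> + 2) * \<Delta>) + 8 * \<Delta>"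
  define Z where "Z = (2 * \<Delta> + 2) * (3 * J + 1)"
  define \<beta> :: real where "\<beta> = 1 / (8 * 600 ^ 3 * real (\<Delta> ^ 2 * (\<Delta> + 1) ^ 2))"
  have "1 \<le> \<Delta> ^ 2 * (\<Delta> + 1) ^ 2" using assms by (simp add: Suc_le_eq)
  then have D1: "1 \<le> real (\<Delta> ^ 2 * (\<Delta> + 1) ^ 2)" by (metis of_nat_1 of_nat_mono)
  then have \<beta>: "8 * 600 ^ 3 * real (\<Delta> ^ 2 * (\<Delta> + 1) ^ 2) * \<beta> = 1" using assms by (simp add: \<beta>_def)
  have \<beta>0: "0 < \<beta>" "\<beta> \<le> 1 / 2"
  proof -
    show "0 < \<beta>" unfolding \<beta>_def using D1 by (intro divide_pos_pos mult_pos_pos) auto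
    then have "2 * \<beta> \<le> 8 * 600 ^ 3 * real (\<Delta> ^ 2 * (\<Delta> + 1) ^ 2) * \<beta>"
      using D1 by (intro mult_right_mono) auto
    then show "\<beta> \<le> 1 / 2" unfolding \<beta> by simp
  qed
  have Z1: "1 \<le> real Z" by (simp add: Z_def)
  \<comment> \<open>With \<open>q\<close> at most \<open>\<epsilon> * n\<close>, the two terms of
    the minimum become the two bounds of \<open>q_small\<close>.\<close>
  define \<epsilon> where "\<epsilon> = min (1 / (1200 * real Z)) (\<beta> / (256 * real \<Delta>))"
  define n0 where "n0 = max (nat \<lceil>128 / \<beta>\<rceil>) (1200 * Z + 1)"
  define m0 where "m0 = nat \<lceil>4 * (1 + 16 * real \<Delta> ^ 2 * real Z) / \<beta>\<rceil>"
  have \<epsilon>: "0 < \<epsilon>" "1200 * real Z * \<epsilon> \<le> 1" "256 * real \<Delta> * \<epsilon> \<le> \<beta>"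
  proof -
    show "0 < \<epsilon>" using Z1 \<beta>0 assms by (simp add: \<epsilon>_def)
    have "\<epsilon> \<le> 1 / (1200 * real Z)" "\<epsilon> \<le> \<beta> / (256 * real \<Delta>)" by (simp_all add: \<epsilon>_def)
    then show "1200 * real Z * \<epsilon> \<le> 1" "256 * real \<Delta> * \<epsilon> \<le> \<beta>" using Z1 assms by (simp_all add: field_simps)
  qed
  have main: "let a = (if inert H G c then 4 else 2) in
      \<exists>b \<in> {0, 1, 2, 3 :: int}. \<forall>k :: int. real_of_int k \<in> {- (\<beta> / 4) * real m .. \<beta> / 4 * real m} \<longrightarrow>
        ((\<exists>H'. copy_of H' H G \<and> colour_sum c H' = k) \<longleftrightarrow> [k = b] (mod a))"
    if nm: "n0 \<le> n" "m0 \<le> m"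
      and H: "finite_simple_graph H" "card (verts H) = n" "card (edges H) = m" "max_degree H = \<Delta>"
      and G: "finite_simple_graph G" "card (verts G) = n" "real (min_degree G) \<ge> (1 - \<epsilon>) * real n"
      and c: "two_edge_colouring G c" "balanced_colouring (\<beta> / 4) G c"
    for n m and H :: "'a graph" and G :: "'b graph" and c
  proof -
    define V where "V = verts G"
    define E where "E = edges G"
    have finV: "finite V" and finH: "finite (verts H)" using G(1) H(1) by (auto simp: V_def finite_simple_graph_def)
    have n_large: "128 \<le> \<beta> * real n" "1200 * real Z < real n"
    proof -
      have "128 / \<beta> \<le> real (nat \<lceil>128 / \<beta>\<rceil>)" by (rule real_nat_ceiling_ge)
      also have "\<dots> \<le> real n" using nm(1) by (simp add: n0_def)
      finally show "128 \<le> \<beta> * real n" using \<beta>0 by (simp add: field_simps)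
      have "real (1200 * Z + 1) \<le> real n" using nm(1) by (intro of_nat_mono) (simp add: n0_def)
      then show "1200 * real Z < real n" by simp
    qed
    have m_large: "4 * (1 + 16 * real \<Delta> ^ 2 * real Z) \<le> \<beta> * real m"
    proof -
      have "4 * (1 + 16 * real \<Delta> ^ 2 * real Z) / \<beta> \<le> real m0" unfolding m0_def by (rule real_nat_ceiling_ge)
      also have "\<dots> \<le> real m" using nm(2) by simp
      finally show ?thesis using \<beta>0 by (simp add: pos_divide_le_eq mult.commute)
    qed
    have E_edge: "e \<subseteq> V \<and> card e = 2" if "e \<in> E" for e
      using G(1) that by (simp add: finite_simple_graph_def V_def E_def)
    obtain \<phi> where \<phi>: "bij_betw \<phi> (verts H) V"
      using finite_same_card_bij[OF finH finV] H(2) G(2) by (auto simp: V_def)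
    have inj\<phi>: "inj_on \<phi> (verts H)" using \<phi> by (rule bij_betw_imp_inj_on)
    have eH: "e \<subseteq> verts H \<and> card e = 2" if "e \<in> edges H" for e
      using H(1) that by (simp add: finite_simple_graph_def)
    have injP: "inj_on ((`) \<phi>) (edges H)"
      by (rule inj_on_subset[OF inj_on_image_Pow[OF inj\<phi>]]) (use eH in auto)
    define F where "F = (`) \<phi> ` edges H"
    have cardF: "card F = m" unfolding F_def using card_image[OF injP] H(3) by simp
    have F_edge: "e \<subseteq> V \<and> card e = 2" if "e \<in> F" for e
    proof -
      obtain e0 where e0: "e0 \<in> edges H" "e = \<phi> ` e0" using \<open>e \<in> F\<close> by (auto simp: F_def)
      have "card e = card e0" unfolding e0(2) by (rule card_image[OF inj_on_subset[OF inj\<phi>]]) (use eH[OF e0(1)] in simp)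
      then show ?thesis using eH[OF e0(1)] e0 bij_betw_imp_surj_on[OF \<phi>] by auto
    qed
    have degF: "card {e\<in>F. \<phi> v \<in> e} = degree H v" if v: "v \<in> verts H" for v
    proof -
      have "{e\<in>F. \<phi> v \<in> e} = (`) \<phi> ` {e\<in>edges H. v \<in> e}"
      proof -
        have "\<phi> v \<in> \<phi> ` e \<longleftrightarrow> v \<in> e" if "e \<in> edges H" for e
          by (rule inj_on_image_mem_iff[OF inj\<phi> v]) (use eH[OF that] in simp)
        then show ?thesis by (auto simp: F_def)
      qed
      then show ?thesis unfolding degree_def
        by (simp add: card_image[OF inj_on_subset[OF injP, of "{e\<in>edges H. v \<in> e}"]])
    qed
    \<comment> \<open>A vertex of degree d has n - d non-neighbours, itself included.\<close>
    define q where "q = nat \<lfloor>\<epsilon> * real n\<rfloor>"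
    have qn: "real q \<le> \<epsilon> * real n" using \<epsilon>(1) by (simp add: q_def)
    interpret guest V F \<Delta>
    proof
      fix v assume "v \<in> V"
      then obtain u where u: "u \<in> verts H" "v = \<phi> u" using bij_betw_imp_surj_on[OF \<phi>] by auto
      have "degree H u \<le> max_degree H" unfolding max_degree_def using finH u(1) by (intro Max_ge) auto
      then show "card {e\<in>F. v \<in> e} \<le> \<Delta>" using degF[OF u(1)] u(2) H(4) by simp
    qed (use finV F_edge in auto)
    \<comment> \<open>\<open>G\<close> is viewed as a guest only for the facts about neighbourhoods,
      with a trivial bound on the degrees.\<close>
    interpret G: guest V E "card E"
    proof
      have "finite E" by (rule finite_subset[of _ "Pow V"]) (use E_edge finV in auto)
      then show "card {e\<in>E. v \<in> e} \<le> card E" for v by (intro card_mono) auto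
    qed (use finV E_edge in auto)
    interpret coloured_packing V F \<Delta> E q c
    proof
      fix x assume x: "x \<in> V"
      have "min_degree G \<le> degree G x" unfolding min_degree_def using finV x by (intro Min_le) (auto simp: V_def)
      then have d: "(1 - \<epsilon>) * real n \<le> real (card (G.nbrs x))"
        using G(3) G.card_incident_eq[of x] by (simp add: degree_def E_def)
      have "{y\<in>V. {x, y} \<notin> E} = V - G.nbrs x" by (auto simp: G.nbrs_def)
      then have "card {y\<in>V. {x, y} \<notin> E} = n - card (G.nbrs x)"
        using card_Diff_subset[OF G.finite_nbrs G.nbrs_subset] G(2) by (simp add: V_def)
      moreover have "card (G.nbrs x) \<le> n" using card_mono[OF finV G.nbrs_subset] G(2) by (simp add: V_def)
      ultimately have "real (card {y\<in>V. {x, y} \<notin> E}) \<le> \<epsilon> * real n" using d by (simp add: of_nat_diff algebra_simps)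
      then have "int (card {y\<in>V. {x, y} \<notin> E}) \<le> \<lfloor>\<epsilon> * real n\<rfloor>" by (simp add: le_floor_iff)
      then show "card {y\<in>V. {x, y} \<notin> E} \<le> q" by (simp add: q_def)
    next
      fix e assume "e \<in> E"
      then show "c e \<in> {-1, 1}" using c(1) by (simp add: two_edge_colouring_def E_def)
    qed (use finV E_edge in auto)
    have nV: "card V = n" using G(2) by (simp add: V_def)
    have n0: "0 < real n" using n_large(2) Z1 by linarith
    have q1: "1200 * real Z * real q \<le> real n"
    proof -
      have "1200 * real Z * real q \<le> 1200 * real Z * (\<epsilon> * real n)" by (rule mult_left_mono[OF qn]) simp
      also have "\<dots> = (1200 * real Z * \<epsilon>) * real n" by simp
      also have "\<dots> \<le> 1 * real n" by (rule mult_right_mono[OF \<epsilon>(2)]) simp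
      finally show ?thesis by simp
    qed
    have q2: "256 * real \<Delta> * real q \<le> \<beta> * real n"
    proof -
      have "256 * real \<Delta> * real q \<le> 256 * real \<Delta> * (\<epsilon> * real n)" by (rule mult_left_mono[OF qn]) simp
      also have "\<dots> = (256 * real \<Delta> * \<epsilon>) * real n" by simp
      also have "\<dots> \<le> \<beta> * real n" by (rule mult_right_mono[OF \<epsilon>(3)]) simp
      finally show ?thesis .
    qed
    have E_low: "1199 / 1200 * real n ^ 2 \<le> 2 * real (card E)"
    proof -
      have "1 * (1200 * real q) \<le> real Z * (1200 * real q)" using Z1 by (intro mult_right_mono) auto
      then have "1200 * real q \<le> real n" using q1 by (simp add: mult_ac)
      then have "real n * (1200 * real q) \<le> real n * real n" by (rule mult_left_mono) simp
      moreover have "real (n * n) \<le> real (2 * card E + n * q)"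
        using card_E_bounds(2) unfolding nV by (rule of_nat_mono)
      ultimately show ?thesis by (simp add: power2_eq_square)
    qed
    have E_up: "2 * real (card E) \<le> real n * (real n - 1)"
    proof -
      have "real (2 * card E) \<le> real (n * (n - 1))" using card_E_bounds(1) unfolding nV by (rule of_nat_mono)
      then show ?thesis using n0 by (simp add: of_nat_diff)
    qed
    have E_pos: "0 < real (card E)"
    proof -
      have "0 < 1199 / 1200 * real n ^ 2" using n0 by simp
      then show ?thesis using E_low by linarith
    qed
    have bal: "(1 / 2 - \<beta> / 4) * (2 * real (card E)) \<le> real (card (arcs i))"
      "real (card (arcs i)) \<le> (1 / 2 + \<beta> / 4) * (2 * real (card E))" if "i \<in> {1, -1}" for i
    proof -
      have "real (card (colour_class G c i)) / real (card E) \<in> {1 / 2 - \<beta> / 4 .. 1 / 2 + \<beta> / 4}"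
        using c(2) that by (auto simp: balanced_colouring_def E_def)
      moreover have "card (arcs i) = 2 * card (colour_class G c i)"
        unfolding card_arcs by (simp add: colour_class_def E_def)
      ultimately show "(1 / 2 - \<beta> / 4) * (2 * real (card E)) \<le> real (card (arcs i))"
        "real (card (arcs i)) \<le> (1 / 2 + \<beta> / 4) * (2 * real (card E))"
        using E_pos by (simp_all add: field_simps)
    qed
    have arcs_large: "real n ^ 2 / 4 \<le> real (card (arcs i))" if "i \<in> {1, -1}" for i
    proof -
      \<comment> \<open>\<open>\<beta> \<le> 1 / 2\<close> gives the factor 3/8, and the slack
        between 3/8 and 1/4 absorbs the missing edges.\<close>
      have "3 / 8 * (1199 / 1200 * real n ^ 2) \<le> (1 / 2 - \<beta> / 4) * (2 * real (card E))"
        by (rule mult_mono[OF _ E_low]) (use \<beta>0 in auto)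
      moreover have "real n ^ 2 / 4 \<le> 3 / 8 * (1199 / 1200 * real n ^ 2)" by simp
      ultimately show ?thesis using bal(1)[OF that] by linarith
    qed
    have arcs_balanced: "\<bar>real (card (arcs 1)) - real (card (arcs (-1)))\<bar> \<le> \<beta> / 2 * (real n * (real n - 1))"
    proof -
      \<comment> \<open>The two proportions, each within \<open>\<beta> / 4\<close> of 1/2, differ
        by at most \<open>\<beta> / 2\<close>; this is the half of \<open>\<kappa> = \<beta>\<close>
        reserved for the imbalance.\<close>
      have "\<bar>real (card (arcs 1)) - real (card (arcs (-1)))\<bar> \<le> \<beta> / 2 * (2 * real (card E))"
        using bal[of 1] bal[of "-1"] by (simp add: algebra_simps abs_le_iff)
      also have "\<dots> \<le> \<beta> / 2 * (real n * (real n - 1))" using E_up \<beta>0 by (intro mult_left_mono) auto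
      finally show ?thesis .
    qed
    interpret dense_packing V F \<Delta> E q c \<beta> J Z
      by unfold_locales
        (use assms \<beta> J_def Z_def q1 q2 n_large m_large arcs_large arcs_balanced in \<open>simp_all add: nV cardF\<close>)
    have "equal_parities \<longleftrightarrow> (\<forall>u\<in>verts H. \<forall>v\<in>verts H. even (degree H u) \<longleftrightarrow> even (degree H v))"
    proof -
      have "V = \<phi> ` verts H" using bij_betw_imp_surj_on[OF \<phi>] by simp
      then show ?thesis
        unfolding equal_parities_def using degF by (auto simp: card_incident_eq)
    qed
    moreover have "bipartite_signs \<longleftrightarrow> bipartite_colouring G c"
      unfolding bipartite_signs_def bipartite_colouring_iff_signs[OF G(1) c(1)] by (simp add: E_def)
    ultimately have inert: "inert H G c \<longleftrightarrow> equal_parities \<and> bipartite_signs" by (simp add: inert_def)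
    have copies: "(\<exists>H'. copy_of H' H G \<and> colour_sum c H' = k) \<longleftrightarrow> (\<exists>\<pi>. embedding \<pi> \<and> weight c \<pi> = k)" for k
      unfolding spanning_copies[OF H(1) G(1) \<phi>[unfolded V_def]]
      by (simp add: embedding_def bad_def weight_def F_def[symmetric] V_def[symmetric] E_def[symmetric] conj_assoc Ball_def)
    obtain b where b: "b \<in> {0, 1, 2, 3 :: int}" "\<And>k. 4 * \<bar>real_of_int k\<bar> \<le> \<beta> * real m \<Longrightarrow>
      (\<exists>\<pi>. embedding \<pi> \<and> weight c \<pi> = k) \<longleftrightarrow> [k = b] (mod (if inert H G c then 4 else 2))"
      using attained_weights unfolding cardF inert by blast
    have bound: "4 * \<bar>real_of_int k\<bar> \<le> \<beta> * real m"
      if k: "real_of_int k \<in> {- (\<beta> / 4) * real m .. \<beta> / 4 * real m}" for k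
    proof -
      have "real_of_int k \<le> \<beta> * real m / 4" "- (\<beta> * real m / 4) \<le> real_of_int k" using k by simp_all
      then show ?thesis by linarith
    qed
    show ?thesis unfolding Let_def copies by (intro bexI[OF _ b(1)] allI impI b(2) bound)
  qed
  show ?thesis
  proof (rule exI[of _ \<epsilon>], rule exI[of _ "\<beta> / 4"], rule exI[of _ "\<beta> / 4"], intro conjI)
    show "0 < \<epsilon>" by (rule \<epsilon>(1))
    show "0 < \<beta> / 4" "0 < \<beta> / 4" using \<beta>0(1) by simp_all
  qed (rule exI[of _ n0], rule exI[of _ m0], intro allI impI, elim conjE, rule main; assumption)
qed

end
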